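(* For the three-state, two-action discounted MDP specified in the context and the update distribution $q=(0.02,0.18,0.80)$, with $D=\operatorname{diag}(q_1,q_2,q_3)$, the hybrid ODE $$\dot J=D\bigl(J^{\mu(J)}-J\bigr)$$ has a nonconstant locally attracting periodic orbit $C\subset\mathbb R^3$ following the policy sequence $$(0,1,1)\to(0,0,1)\to(1,0,1)\to(1,0,0)\to(1,1,0)\to(1,1,1)\to(0,1,1).$$ Moreover, $C$ is a strict local attractor for the local Filippov differential inclusion $$\dot J\in H(J),\qquad H(J)=D\,\mathrm{co}\{J^\mu-J:\mu\in G(J)\}.$$
   Context: **MDP data** (all decimals are exact rational numbers). States $S=\{1,2,3\}$, actions $A=\{0,1\}$, discount $\alpha=0.95$. One-stage costs $g(i,a)$ (row $i=1,2,3$; columns $a=0,1$): $$g=\begin{pmatrix}2.8645365128&6.2604856687\\8.8765458733&-6.6644477357\\-4.4428868652&-7.5034828348\end{pmatrix}.$$ Transition rows $P(i,a)=(P(i,a,1),P(i,a,2),P(i,a,3))$: $$\begin{aligned} P(1,0)&=(0.0083421983,\,0.5161392971,\,0.4755185046),\\ P(1,1)&=(0.4115295055,\,0.3414919270,\,0.2469785675),\\ P(2,0)&=(0.0176113658,\,0.9549690854,\,0.0274195488),\\ P(2,1)&=(0.3574261643,\,0.1754143753,\,0.4671594604),\\ P(3,0)&=(0.6791060489,\,0.0358694514,\,0.2850244997),\\ P(3,1)&=(0.3221209528,\,0.3803472570,\,0.2975317902). \end{aligned}$$ **Policies and greediness.** A deterministic policy is $\mu=(\mu(1),\mu(2),\mu(3))\in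 A^3$; $P_\mu(i,j)=P(i,\mu(i),j)$, $g_\mu(i)=g(i,\mu(i))$, and its discounted cost-to-go is $J^\mu=(I-\alpha P_\mu)^{-1}g_\mu$. For $J\in\mathbb R^3$ let $Q_i(a;J)=g(i,a)+\alpha\sum_jP(i,a,j)J(j)$ and $d_i(J)=Q_i(1;J)-Q_i(0;J)$. Costs are minimized: $\mu$ is greedy at $J$ if $\mu(i)$ minimizes $a\mapsto Q_i(a;J)$ for every $i$; $G(J)$ is the (finite, nonempty) set of greedy policies at $J$. Thus $d_i(J)>0$ means action $0$ is uniquely greedy at state $i$, and $d_i(J)<0$ means action $1$ is. When $G(J)$ is a singleton, its element is $\mu(J)$. The tie surfaces are $\{d_i=0\}$, $i=1,2,3$. $\mathrm{co}$ denotes the convex hull. **Hybrid ODE.** A solution is a continuous, piecewise continuously differentiable curve satisfying $\dot J=D(J^{\mu(J)}-J)$ off the tie surfaces and meeting the tie surfaces only at isolated switching times. A periodic orbit follows the policy sequence $\nu_0\to\nu_1\to\cdots\to\nu_5\to\nu_0$ if one period splits into six consecutive arcs, separated by switching points lying on tie surfaces, such that on the interior of the $k$-th arc the unique greedy policy is $\nu_k$. It is locally attracting if it has a neighborhood from which all solutions converge to it. **Differential inclusion.** Solutions are absolutely continuous curves with $\dot J(t)\in H(J(t))$ for almost every $t$; "local" means considered in a neighborhood of $C$. The compact set $C$ is a strict local attractor if it is invariant, Lyapunov stable, and has a neighborhood $W$ such that $\operatorname{dist}(J(t),C)\to0$ as $t\to\infty$, uniformly over all solutions with $J(0)\in W$.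 *)

theory Defs
  imports "HOL-Analysis.Analysis"
begin

section \<open>The Markov decision process\<close>

text \<open>
  States are the elements \<open>1, 2, 3\<close> of the numeral type \<open>3\<close>, and actions are the elements
  \<open>0, 1\<close> of the numeral type \<open>2\<close>. In a numeral type the size of the type equals \<open>0\<close>, so
  the final \<open>else\<close> branch of \<open>trans\<close> is state \<open>3\<close>, and the final \<open>else\<close> branch
  on actions is action \<open>1\<close>. A deterministic policy is a vector of type \<open>2 ^ 3\<close>.
\<close>

definition discount :: real where
  "discount = 0.95"

definition cost :: "3 \<Rightarrow> 2 \<Rightarrow> real" where
  "cost i a =
     (if a = 0 then vector [2.8645365128, 8.8765458733, -4.4428868652] $ i
      else vector [6.2604856687, -6.6644477357, -7.5034828348] $ i)"

definition trans :: "3 \<Rightarrow> 2 \<Rightarrow> real ^ 3" where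
  "trans i a =
     (if i = 1 then
        (if a = 0 then vector [0.0083421983, 0.5161392971, 0.4755185046]
         else vector [0.4115295055, 0.3414919270, 0.2469785675])
      else if i = 2 then
        (if a = 0 then vector [0.0176113658, 0.9549690854, 0.0274195488]
         else vector [0.3574261643, 0.1754143753, 0.4671594604])
      else
        (if a = 0 then vector [0.6791060489, 0.0358694514, 0.2850244997]
         else vector [0.3221209528, 0.3803472570, 0.2975317902]))"

definition policy_trans :: "2 ^ 3 \<Rightarrow> real ^ 3 ^ 3" where
  "policy_trans \<mu> = (\<chi> i j. trans i (\<mu> $ i) $ j)"

definition policy_cost :: "2 ^ 3 \<Rightarrow> real ^ 3" where
  "policy_cost \<mu> = (\<chi> i. cost i (\<mu> $ i))"

definition cost_to_go :: "2 ^ 3 \<Rightarrow> real ^ 3" where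
  "cost_to_go \<mu> = matrix_inv (mat 1 - discount *\<^sub>R policy_trans \<mu>) *v policy_cost \<mu>"

definition q_factor :: "real ^ 3 \<Rightarrow> 3 \<Rightarrow> 2 \<Rightarrow> real" where
  "q_factor J i a = cost i a + discount * (\<Sum>j\<in>UNIV. trans i a $ j * J $ j)"

definition q_gap :: "real ^ 3 \<Rightarrow> 3 \<Rightarrow> real" where
  "q_gap J i = q_factor J i 1 - q_factor J i 0"

definition greedy :: "real ^ 3 \<Rightarrow> (2 ^ 3) set" where
  "greedy J = {\<mu>. \<forall>i a. q_factor J i (\<mu> $ i) \<le> q_factor J i a}"

definition tie_set :: "(real ^ 3) set" where
  "tie_set = {J. \<exists>i. q_gap J i = 0}"

definition diag :: "real ^ 3 \<Rightarrow> real ^ 3 ^ 3" where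
  "diag q = (\<chi> i j. if i = j then q $ i else 0)"


section \<open>The hybrid ODE\<close>

text \<open>Off the tie surfaces \<open>greedy J\<close> is a singleton, so \<open>the_elem\<close> selects its element.\<close>

definition hybrid_field :: "real ^ 3 \<Rightarrow> real ^ 3 \<Rightarrow> real ^ 3" where
  "hybrid_field q J = diag q *v (cost_to_go (the_elem (greedy J)) - J)"

text \<open>
  The time domain \<open>I\<close> is \<open>UNIV\<close> or \<open>{0..}\<close> below. Breakpoints of the derivative are
  finitely many on every compact interval. The domain being closed and the curve continuous, the
  set of switching times is closed in the reals, so its discreteness excludes accumulation.
\<close>

definition hybrid_solution :: "real ^ 3 \<Rightarrow> real set \<Rightarrow> (real \<Rightarrow> real ^ 3) \<Rightarrow> bool" where
  "hybrid_solution q I J \<longleftrightarrow>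
     (\<forall>a b. {a..b} \<subseteq> I \<longrightarrow> J piecewise_C1_differentiable_on {a..b}) \<and>
     (\<forall>t\<in>I. J t \<notin> tie_set \<longrightarrow> (J has_vector_derivative hybrid_field q (J t)) (at t within I)) \<and>
     discrete {t \<in> I. J t \<in> tie_set}"

definition follows_policies :: "(real \<Rightarrow> real ^ 3) \<Rightarrow> real \<Rightarrow> (2 ^ 3) list \<Rightarrow> bool" where
  "follows_policies J p \<nu>s \<longleftrightarrow>
     (\<exists>\<tau> :: nat \<Rightarrow> real.
        \<tau> (length \<nu>s) = \<tau> 0 + p \<and>
        (\<forall>k \<le> length \<nu>s. J (\<tau> k) \<in> tie_set) \<and>
        (\<forall>k < length \<nu>s. \<tau> k < \<tau> (Suc k) \<and>
           (\<forall>t \<in> {\<tau> k <..< \<tau> (Suc k)}. greedy (J t) = {\<nu>s ! k})))"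

definition hybrid_locally_attracting :: "real ^ 3 \<Rightarrow> (real ^ 3) set \<Rightarrow> bool" where
  "hybrid_locally_attracting q C \<longleftrightarrow>
     (\<exists>W. open W \<and> C \<subseteq> W \<and>
        (\<forall>J. hybrid_solution q {0..} J \<and> J 0 \<in> W \<longrightarrow> ((\<lambda>t. infdist (J t) C) \<longlongrightarrow> 0) at_top))"


section \<open>Differential inclusions\<close>

definition absolutely_continuous_on ::
    "real \<Rightarrow> real \<Rightarrow> (real \<Rightarrow> 'a::metric_space) \<Rightarrow> bool" where
  "absolutely_continuous_on a b f \<longleftrightarrow>
     (\<forall>\<epsilon>>0. \<exists>\<delta>>0. \<forall>(n::nat) u v.
        (\<forall>k<n. a \<le> u k \<and> u k \<le> v k \<and> v k \<le> b) \<and>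
        disjoint_family_on (\<lambda>k. {u k <..< v k}) {..<n} \<and>
        (\<Sum>k<n. v k - u k) < \<delta> \<longrightarrow>
        (\<Sum>k<n. dist (f (u k)) (f (v k))) < \<epsilon>)"

text \<open>Forward solutions; on the unbounded domain \<open>{0..}\<close> absolute continuity is local.\<close>

definition inclusion_solution ::
    "('a::euclidean_space \<Rightarrow> 'a set) \<Rightarrow> (real \<Rightarrow> 'a) \<Rightarrow> bool" where
  "inclusion_solution H J \<longleftrightarrow>
     (\<forall>T\<ge>0. absolutely_continuous_on 0 T J) \<and>
     (AE t in lebesgue. 0 \<le> t \<longrightarrow> (\<exists>v \<in> H (J t). (J has_vector_derivative v) (at t)))"

definition reachable :: "('a::euclidean_space \<Rightarrow> 'a set) \<Rightarrow> real \<Rightarrow> 'a set \<Rightarrow> 'a set" where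
  "reachable H t X = {J t | J. inclusion_solution H J \<and> J 0 \<in> X}"

definition invariant_set :: "('a::euclidean_space \<Rightarrow> 'a set) \<Rightarrow> 'a set \<Rightarrow> bool" where
  "invariant_set H C \<longleftrightarrow> (\<forall>t\<ge>0. reachable H t C = C)"

definition lyapunov_stable :: "('a::euclidean_space \<Rightarrow> 'a set) \<Rightarrow> 'a set \<Rightarrow> bool" where
  "lyapunov_stable H C \<longleftrightarrow>
     (\<forall>\<epsilon>>0. \<exists>\<delta>>0. \<forall>J. inclusion_solution H J \<and> infdist (J 0) C < \<delta> \<longrightarrow>
        (\<forall>t\<ge>0. infdist (J t) C < \<epsilon>))"

definition uniformly_attracting :: "('a::euclidean_space \<Rightarrow> 'a set) \<Rightarrow> 'a set \<Rightarrow> bool" where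
  "uniformly_attracting H C \<longleftrightarrow>
     (\<exists>W. open W \<and> C \<subseteq> W \<and>
        (\<forall>\<epsilon>>0. \<exists>T\<ge>0. \<forall>J. inclusion_solution H J \<and> J 0 \<in> W \<longrightarrow>
           (\<forall>t\<ge>T. infdist (J t) C < \<epsilon>)))"

text \<open>Nonemptiness is required because \<open>infdist x {} = 0\<close> by convention.\<close>

definition strict_local_attractor :: "('a::euclidean_space \<Rightarrow> 'a set) \<Rightarrow> 'a set \<Rightarrow> bool" where
  "strict_local_attractor H C \<longleftrightarrow>
     compact C \<and> C \<noteq> {} \<and> invariant_set H C \<and> lyapunov_stable H C \<and> uniformly_attracting H C"

definition filippov_field :: "real ^ 3 \<Rightarrow> real ^ 3 \<Rightarrow> (real ^ 3) set" where
  "filippov_field q J =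
     (\<lambda>x. diag q *v x) ` (convex hull ((\<lambda>\<mu>. cost_to_go \<mu> - J) ` greedy J))"

end

theory Submission
  imports Defs
begin

text \<open>
  Within one region of constant greedy policy the coordinates relax independently, and in the
  variable \<open>x = exp (- 0.02 * t)\<close> the flow is polynomial with exponents 1, 9 and 40. Around each
  of the six switching points of a numerically computed orbit take a small box in the tie plane,
  measured by two functionals that approximate left eigenvectors of the monodromy matrix. In the
  maximum of these two functionals each of the six arcs maps its box into the next one and contracts
  by a factor 0.92, so the return map has a fixed point, whose orbit is the cycle. Every tie plane is
  crossed in the same direction by both adjacent fields, hence by all velocities of the inclusion;
  therefore Filippov solutions near the cycle cannot slide, they follow the arcs, and the
  contraction of the boxes yields stability, attraction and invariance.
\<close>

section \<open>Absolutely continuous functions\<close>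

text \<open>The leading multiplier of the return map is about 0.508, but nothing makes a single arc
  contract in the Euclidean norm, and enclosing the composition of six arcs at once would accumulate
  their errors. Norms that change from section to section distribute the contraction, so that every
  arc is a separate finite check: an even split gives about 0.893 per arc, and 0.92 leaves room for
  the enclosures. Two inexactnesses remain: the rounded switching points lie slightly off their tie
  planes, and costs-to-go are known only up to a tolerance. Hence the certificate speaks about every
  nearby cost-to-go, and each arc has to land strictly inside the next box. The same spare room is
  what turns the arcs from the boxes into a full neighbourhood of the cycle. Solutions of the
  inclusion have a derivative only almost everywhere. Uniqueness along an arc and crossing in one
  direction both rest on monotonicity of absolutely continuous functions whose derivative is
  nonnegative almost everywhere. Hybrid solutions inherit attraction because they solve the
  inclusion.\<close>

definition fine_pieces :: "real \<Rightarrow> real \<Rightarrow> real \<Rightarrow> nat \<Rightarrow> (nat \<Rightarrow> real) \<Rightarrow> (nat \<Rightarrow> real) \<Rightarrow> bool" where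
  "fine_pieces a b \<delta> n u v \<longleftrightarrow> (\<forall>k<n. a \<le> u k \<and> u k \<le> v k \<and> v k \<le> b) \<and>
     disjoint_family_on (\<lambda>k. {u k <..< v k}) {..<n} \<and> (\<Sum>k<n. v k - u k) < \<delta>"

lemma absolutely_continuous_on_iff:
  "absolutely_continuous_on a b f \<longleftrightarrow>
    (\<forall>e>0. \<exists>\<delta>>0. \<forall>n u v. fine_pieces a b \<delta> n u v \<longrightarrow> (\<Sum>k<n. dist (f (u k)) (f (v k))) < e)"
  by (simp add: absolutely_continuous_on_def fine_pieces_def)

text \<open>The one closure property from which all others are drawn: components, linear
  functionals, sign changes and Lipschitz perturbations of an absolutely continuous curve are each
  dominated in this sense.\<close>

lemma absolutely_continuous_on_dominated:
  fixes f :: "real \<Rightarrow> 'a::metric_space" and g :: "real \<Rightarrow> 'b::metric_space"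
  assumes f: "absolutely_continuous_on a b f" and K: "K \<ge> 0" and L: "L \<ge> 0"
    and dom: "\<And>u v. a \<le> u \<Longrightarrow> u \<le> v \<Longrightarrow> v \<le> b \<Longrightarrow>
      dist (g u) (g v) \<le> K * dist (f u) (f v) + L * (v - u)"
  shows "absolutely_continuous_on a b g"
  unfolding absolutely_continuous_on_iff
proof (intro allI impI)
  fix e :: real assume "e > 0"
  define e1 where "e1 = e / (2 * (K + 1))"
  have e1: "e1 > 0" "K * e1 < e / 2"
    using \<open>e > 0\<close> K by (auto simp: e1_def field_simps)
  obtain d where d: "d > 0" and D: "\<And>n u v. fine_pieces a b d n u v \<Longrightarrow> (\<Sum>k<n. dist (f (u k)) (f (v k))) < e1"
    using f e1(1) unfolding absolutely_continuous_on_iff by metis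
  define d' where "d' = min d (e / (2 * (L + 1)))"
  have d': "d' > 0" "L * d' \<le> e / 2"
  proof -
    show "d' > 0" using d \<open>e > 0\<close> L by (auto simp: d'_def)
    have "L * d' \<le> L * (e / (2 * (L + 1)))"
      unfolding d'_def using L by (intro mult_left_mono) auto
    also have "\<dots> \<le> e / 2" using \<open>e > 0\<close> L by (auto simp: field_simps)
    finally show "L * d' \<le> e / 2" .
  qed
  have "(\<Sum>k<n. dist (g (u k)) (g (v k))) < e" if A: "fine_pieces a b d' n u v" for n u v
  proof -
    have "fine_pieces a b d n u v" using A by (auto simp: fine_pieces_def d'_def)
    then have F: "(\<Sum>k<n. dist (f (u k)) (f (v k))) < e1" by (rule D)
    have "(\<Sum>k<n. dist (g (u k)) (g (v k))) \<le>
        (\<Sum>k<n. K * dist (f (u k)) (f (v k)) + L * (v k - u k))"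
      using A by (intro sum_mono dom) (auto simp: fine_pieces_def)
    also have "\<dots> = K * (\<Sum>k<n. dist (f (u k)) (f (v k))) + L * (\<Sum>k<n. v k - u k)"
      by (simp add: sum.distrib sum_distrib_left)
    also have "\<dots> \<le> K * e1 + L * d'"
      using A F K L by (intro add_mono mult_left_mono) (auto simp: fine_pieces_def)
    also have "\<dots> < e" using e1 d' by linarith
    finally show ?thesis .
  qed
  then show "\<exists>\<delta>>0. \<forall>n u v. fine_pieces a b \<delta> n u v \<longrightarrow> (\<Sum>k<n. dist (g (u k)) (g (v k))) < e"
    using d'(1) by blast
qed

lemma absolutely_continuous_on_subset:
  assumes "absolutely_continuous_on a b f" "a \<le> c" "d \<le> b"
  shows "absolutely_continuous_on c d f"
proof -
  have "fine_pieces a b \<delta> n u v" if "fine_pieces c d \<delta> n u v" for \<delta> n u v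
    using that assms(2,3) unfolding fine_pieces_def by (meson order_trans)
  then show ?thesis using assms(1) unfolding absolutely_continuous_on_iff by metis
qed

lemma Lipschitz_imp_absolutely_continuous_on:
  fixes f :: "real \<Rightarrow> 'a::metric_space"
  assumes "\<And>u v. a \<le> u \<Longrightarrow> u \<le> v \<Longrightarrow> v \<le> b \<Longrightarrow> dist (f u) (f v) \<le> L * (v - u)" and "L \<ge> 0"
  shows "absolutely_continuous_on a b f"
proof -
  have "absolutely_continuous_on a b (\<lambda>_. 0 :: real)"
    unfolding absolutely_continuous_on_iff by (auto intro: exI[of _ 1])
  then show ?thesis
    by (rule absolutely_continuous_on_dominated[where K = 0 and L = L]) (use assms in auto)
qed

lemma absolutely_continuous_on_imp_continuous_on:
  fixes f :: "real \<Rightarrow> 'a::metric_space"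
  assumes "absolutely_continuous_on a b f"
  shows "continuous_on {a..b} f"
  unfolding continuous_on_iff
proof (intro ballI allI impI)
  fix x e :: real assume x: "x \<in> {a..b}" and "e > 0"
  then obtain \<delta> where \<delta>: "\<delta> > 0" and D: "\<And>n u v. fine_pieces a b \<delta> n u v \<Longrightarrow> (\<Sum>k<n. dist (f (u k)) (f (v k))) < e"
    using assms unfolding absolutely_continuous_on_iff by metis
  have "dist (f y) (f x) < e" if "y \<in> {a..b}" "dist y x < \<delta>" for y
    \<comment> \<open>A family consisting of the single interval between \<open>x\<close> and
      \<open>y\<close>.\<close>
    using D[of 1 "\<lambda>_. min x y" "\<lambda>_. max x y"] that x
    by (cases "x \<le> y") (auto simp: fine_pieces_def disjoint_family_on_def dist_real_def dist_commute)
  then show "\<exists>d>0. \<forall>x'\<in>{a..b}. dist x' x < d \<longrightarrow> dist (f x') (f x) < e"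
    using \<delta> by blast
qed

text \<open>Compare with a tagged division whose intervals tagged in the exceptional null set lie in an
  open set of small measure; absolute continuity bounds their contribution.\<close>

lemma absolutely_continuous_on_nondecreasing:
  fixes f :: "real \<Rightarrow> real"
  assumes ac: "absolutely_continuous_on a b f" and "a \<le> b" and N: "negligible N"
    and der: "\<And>t. t \<in> {a<..<b} - N \<Longrightarrow> \<exists>d\<ge>0. (f has_real_derivative d) (at t)"
  shows "f a \<le> f b"
proof (rule field_le_epsilon)
  fix e0 :: real assume "e0 > 0"
  \<comment> \<open>The loss will be \<open>e * (b - a)\<close> on the regular intervals plus
    \<open>e\<close> on the exceptional ones.\<close>
  define e where "e = e0 / (b - a + 1)"
  have e: "e > 0" using \<open>e0 > 0\<close> \<open>a \<le> b\<close> by (auto simp: e_def)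
  obtain \<delta> where \<delta>: "\<delta> > 0" and D: "\<And>n u v. fine_pieces a b \<delta> n u v \<Longrightarrow> (\<Sum>k<n. dist (f (u k)) (f (v k))) < e"
    using ac e unfolding absolutely_continuous_on_iff by metis
  \<comment> \<open>No derivative is assumed at the endpoints, so they join the exceptional
    set.\<close>
  define N' where "N' = N \<union> {a, b}"
  have N': "negligible N'" using N by (auto simp: N'_def)
  then have null: "N' \<in> null_sets lebesgue" by (simp add: negligible_iff_null_sets)
  obtain U where U: "open U" "N' \<subseteq> U" "U - N' \<in> lmeasurable" "emeasure lebesgue (U - N') < ennreal \<delta>"
    using sets_lebesgue_outer_open[of N' \<delta>] null \<delta> by auto
  have "U = (U - N') \<union> N'" using U by auto
  then have Um: "U \<in> lmeasurable" "emeasure lebesgue U < ennreal \<delta>"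
    using U null emeasure_Un_null_set[of "U - N'" lebesgue N']
    by (metis fmeasurable.Un fmeasurableD null_sets_def fmeasurableI_null_sets)+ 
  have Umeas: "measure lebesgue U < \<delta>"
    using Um by (metis \<delta> emeasure_eq_measure2 ennreal_less_iff measure_nonneg)
  \<comment> \<open>The gauge: the small open set \<open>U\<close> at exceptional points, elsewhere
    a ball in which every interval containing \<open>x\<close> satisfies the straddle estimate with
    slope at least \<open>- e\<close>.\<close>
  have "\<exists>G. open G \<and> x \<in> G \<and> (if x \<in> N' then G = U else
      \<forall>u v. u \<le> x \<longrightarrow> x \<le> v \<longrightarrow> {u..v} \<subseteq> G \<longrightarrow> {u..v} \<subseteq> {a..b} \<longrightarrow> f v - f u \<ge> - e * (v - u))" for x
  proof (cases "x \<in> N' \<or> x \<notin> {a..b}")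
    case True
    then show ?thesis using U by (cases "x \<in> N'") (auto intro!: exI[of _ UNIV])
  next
    case False
    then obtain d where d: "d \<ge> 0" "(f has_real_derivative d) (at x)"
      using der[of x] by (auto simp: N'_def less_le)
    from d(2) have "(f has_derivative (\<lambda>h. d * h)) (at x)"
      by (simp add: has_field_derivative_def)
    then obtain r where r: "r > 0" "\<And>y. norm (y - x) < r \<Longrightarrow> norm (f y - f x - d * (y - x)) \<le> e * norm (y - x)"
      using e unfolding has_derivative_at_alt by blast
    have "f v - f u \<ge> - e * (v - u)" if "u \<le> x" "x \<le> v" "{u..v} \<subseteq> ball x r" for u v
    proof -
      have "u \<in> {u..v}" "v \<in> {u..v}" using that(1,2) by simp_all
      then have "u \<in> ball x r" "v \<in> ball x r" using that(3) by blast+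
      then have "\<bar>f v - f x - d * (v - x)\<bar> \<le> e * (v - x)" "\<bar>f u - f x - d * (u - x)\<bar> \<le> e * (x - u)"
        using r(2)[of v] r(2)[of u] that(1,2) by (simp_all add: dist_real_def abs_minus_commute)
      then have "f v - f x - d * (v - x) \<ge> - (e * (v - x))" "f u - f x - d * (u - x) \<le> e * (x - u)"
        by linarith+
      moreover have "d * (v - x) \<ge> 0" "d * (u - x) \<le> 0" using d(1) that
        by (auto intro: mult_nonneg_nonneg mult_nonneg_nonpos)
      ultimately show ?thesis by (simp add: algebra_simps)
    qed
    then show ?thesis using False r(1) by (intro exI[of _ "ball x r"]) auto
  qed
  then obtain G where G: "\<And>x. open (G x)" "\<And>x. x \<in> G x" "\<And>x. x \<in> N' \<Longrightarrow> G x = U"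
    "\<And>x u v. x \<notin> N' \<Longrightarrow> u \<le> x \<Longrightarrow> x \<le> v \<Longrightarrow> {u..v} \<subseteq> G x \<Longrightarrow> {u..v} \<subseteq> {a..b} \<Longrightarrow> f v - f u \<ge> - e * (v - u)"
    by metis
  have "gauge G" using G by (auto simp: gauge_def)
  then obtain p where p: "p tagged_division_of {a..b}" "G fine p"
    using fine_division_exists_real by metis
  have fin: "finite p" using p(1) by blast
  have pK: "\<exists>u v. K = {u..v} \<and> u \<le> x \<and> x \<le> v \<and> a \<le> u \<and> v \<le> b \<and> K \<subseteq> G x" if xK: "(x, K) \<in> p" for x K
  proof -
    obtain u v where uv: "K = {u..v}"
      using tagged_division_ofD(4)[OF p(1) xK] by (auto simp: box_real)
    have "x \<in> K" "K \<subseteq> {a..b}" using tagged_division_ofD(2,3)[OF p(1) xK] by auto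
    moreover have "K \<subseteq> G x" using p(2) xK by (auto simp: fine_def)
    ultimately show ?thesis using uv by (intro exI[of _ u] exI[of _ v]) auto
  qed
  define p1 where "p1 = {xk \<in> p. fst xk \<in> N'}"
  have p1: "p1 \<subseteq> p" "finite p1" using fin by (auto simp: p1_def)
  have "p1 tagged_partial_division_of {a..b}"
    using p(1) p1 tagged_partial_division_subset tagged_division_of_def by blast
  then have p1d: "p1 tagged_division_of \<Union> (snd ` p1)"
    by (rule tagged_partial_division_of_Union_self)
  have "snd ` p1 division_of \<Union> (snd ` p1)" using p1d by (rule division_of_tagged_division)
  note div = this
  have "(\<Sum>K\<in>snd ` p1. measure lborel K) = (\<Sum>K\<in>snd ` p1. measure lebesgue K)"
    using div by (intro sum.cong) (auto dest: division_ofD(4))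
  also have "\<dots> = measure lebesgue (\<Union> (snd ` p1))"
    using div by (rule content_division)
  also have "\<dots> \<le> measure lebesgue U"
  proof (rule measure_mono_fmeasurable)
    show "\<Union> (snd ` p1) \<subseteq> U" using pK G(3) by (fastforce simp: p1_def)
    show "\<Union> (snd ` p1) \<in> sets lebesgue"
      using \<open>snd ` p1 division_of _\<close> by (metis fmeasurableD lmeasurable_division)
  qed (rule Um)
  also note Umeas
  finally have small: "(\<Sum>K\<in>snd ` p1. measure lborel K) < \<delta>" .
  \<comment> \<open>One interval can carry two tags only if its interior is empty; it then
    contributes nothing to either sum.\<close>
  have "(\<Sum>(x,K)\<in>p1. measure lborel K) = (\<Sum>K\<in>snd ` p1. measure lborel K)"
    by (rule sum.over_tagged_division_lemma[OF p1d]) (simp add: content_eq_0_interior)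
  with small have small: "(\<Sum>(x,K)\<in>p1. measure lborel K) < \<delta>" by simp
  obtain \<phi> where \<phi>: "bij_betw \<phi> {..<card p1} p1"
    using ex_bij_betw_nat_finite[OF p1(2)] by (auto simp: lessThan_atLeast0)
  define u v where "u = (\<lambda>k. Inf (snd (\<phi> k)))" and "v = (\<lambda>k. Sup (snd (\<phi> k)))"
  have \<phi>p: "\<phi> k \<in> p1" if "k < card p1" for k using \<phi> that by (auto simp: bij_betw_def)
  have uv: "snd (\<phi> k) = {u k..v k} \<and> a \<le> u k \<and> u k \<le> v k \<and> v k \<le> b" if "k < card p1" for k
  proof -
    obtain x K where xK: "\<phi> k = (x, K)" by (cases "\<phi> k")
    with \<phi>p[OF that] p1 have "(x, K) \<in> p" by auto
    from pK[OF this] show ?thesis by (auto simp: u_def v_def xK)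
  qed
  have "(\<Sum>k<card p1. dist (f (u k)) (f (v k))) < e"
  proof (rule D, unfold fine_pieces_def, intro conjI)
    show "\<forall>k<card p1. a \<le> u k \<and> u k \<le> v k \<and> v k \<le> b" using uv by auto
    have "(\<Sum>k<card p1. v k - u k) = (\<Sum>k<card p1. measure lborel (snd (\<phi> k)))"
      using uv by (intro sum.cong) auto
    also have "\<dots> = (\<Sum>xk\<in>p1. measure lborel (snd xk))" by (rule sum.reindex_bij_betw[OF \<phi>])
    also have "\<dots> = (\<Sum>(x,K)\<in>p1. measure lborel K)" by (simp add: case_prod_unfold)
    finally show "(\<Sum>k<card p1. v k - u k) < \<delta>" using small by simp
    show "disjoint_family_on (\<lambda>k. {u k <..< v k}) {..<card p1}"
      unfolding disjoint_family_on_def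
    proof (intro ballI impI)
      fix i j assume ij: "i \<in> {..<card p1}" "j \<in> {..<card p1}" "i \<noteq> j"
      then have "\<phi> i \<noteq> \<phi> j" using \<phi> by (auto simp: bij_betw_def inj_on_def)
      moreover have "(fst (\<phi> i), snd (\<phi> i)) \<in> p" "(fst (\<phi> j), snd (\<phi> j)) \<in> p"
        using \<phi>p ij p1 by auto
      ultimately have "interior (snd (\<phi> i)) \<inter> interior (snd (\<phi> j)) = {}"
        using tagged_division_ofD(5)[OF p(1), of "fst (\<phi> i)" "snd (\<phi> i)" "fst (\<phi> j)" "snd (\<phi> j)"]
        by simp
      then show "{u i<..<v i} \<inter> {u j<..<v j} = {}" using uv ij by auto
    qed
  qed
  moreover have "(\<Sum>k<card p1. dist (f (u k)) (f (v k))) = (\<Sum>k<card p1. dist (f (Inf (snd (\<phi> k)))) (f (Sup (snd (\<phi> k)))))"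
    by (simp add: u_def v_def)
  moreover have "\<dots> = (\<Sum>xk\<in>p1. dist (f (Inf (snd xk))) (f (Sup (snd xk))))"
    by (rule sum.reindex_bij_betw[OF \<phi>])
  moreover have "- (\<Sum>xk\<in>p1. dist (f (Inf (snd xk))) (f (Sup (snd xk)))) \<le> (\<Sum>xk\<in>p1. f (Sup (snd xk)) - f (Inf (snd xk)))"
    unfolding sum_negf[symmetric] by (intro sum_mono) (auto simp: dist_real_def)
  ultimately have b1: "(\<Sum>(x,K)\<in>p1. f (Sup K) - f (Inf K)) \<ge> - e"
    unfolding case_prod_unfold by linarith
  have "(\<Sum>(x,K)\<in>p - p1. f (Sup K) - f (Inf K)) \<ge> (\<Sum>(x,K)\<in>p - p1. - e * measure lborel K)"
  proof (intro sum_mono, clarify)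
    fix x K assume xK: "(x, K) \<in> p" "(x, K) \<notin> p1"
    from pK[OF xK(1)] obtain u v where "K = {u..v}" "u \<le> x" "x \<le> v" "a \<le> u" "v \<le> b" "K \<subseteq> G x" by blast
    moreover have "x \<notin> N'" using xK by (auto simp: p1_def)
    ultimately show "- e * measure lborel K \<le> f (Sup K) - f (Inf K)" using G(4)[of x u v] by auto
  qed
  moreover have "(\<Sum>(x,K)\<in>p - p1. - e * measure lborel K) \<ge> (\<Sum>(x,K)\<in>p. - e * measure lborel K)"
  proof -
    have "(\<Sum>(x,K)\<in>p. e * measure lborel K) \<ge> (\<Sum>(x,K)\<in>p - p1. e * measure lborel K)"
      using e fin by (intro sum_mono2) auto
    then show ?thesis by (simp add: case_prod_unfold sum_negf)
  qed
  moreover have "(\<Sum>(x,K)\<in>p. - e * measure lborel K) = - e * (b - a)"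
    using additive_content_tagged_division[of p a b] p(1) \<open>a \<le> b\<close>
    by (simp add: case_prod_unfold sum_negf sum_distrib_left[symmetric] box_real)
  moreover have "f b - f a = (\<Sum>(x,K)\<in>p. f (Sup K) - f (Inf K))"
    using additive_tagged_division_1[OF \<open>a \<le> b\<close> p(1), of f] by simp
  moreover have "(\<Sum>(x,K)\<in>p. f (Sup K) - f (Inf K)) =
      (\<Sum>(x,K)\<in>p1. f (Sup K) - f (Inf K)) + (\<Sum>(x,K)\<in>p - p1. f (Sup K) - f (Inf K))"
    using p1 fin by (metis (no_types, lifting) add.commute sum.subset_diff)
  ultimately have "f b - f a \<ge> - e * (b - a) - e" using b1 by linarith
  moreover have "e * (b - a + 1) = e0" using \<open>a \<le> b\<close> by (simp add: e_def)
  ultimately show "f a \<le> f b + e0" by (simp add: algebra_simps)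
qed

text \<open>The difference \<open>h\<close> from the explicit solution satisfies
  \<open>h' = - q * h\<close> almost everywhere and vanishes at \<open>a\<close>. Wherever
  \<open>h\<close> is positive it cannot increase, and symmetrically for \<open>- h\<close>, so it
  stays zero.\<close>

lemma absolutely_continuous_on_linear_ode:
  fixes f :: "real \<Rightarrow> real"
  assumes ac: "absolutely_continuous_on a b f" and N: "negligible N" and q: "q \<ge> 0"
    and der: "\<And>t. t \<in> {a<..<b} - N \<Longrightarrow> (f has_real_derivative q * (c - f t)) (at t)"
    and t: "t \<in> {a..b}"
  shows "f t = c + (f a - c) * exp (- (q * (t - a)))"
proof -
  define E where "E = (\<lambda>t. c + (f a - c) * exp (- (q * (t - a))))"
  define h where "h = (\<lambda>t. f t - E t)"
  have E': "(E has_real_derivative q * (c - E t)) (at t)" for t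
    unfolding E_def by (auto intro!: derivative_eq_intros)
  have E_Lip: "dist (E u) (E v) \<le> \<bar>f a - c\<bar> * q * (v - u)" if "a \<le> u" "u \<le> v" for u v
  proof -
    have *: "exp (- (q * (v - a))) = exp (- (q * (u - a))) * exp (- (q * (v - u)))"
      by (simp add: exp_add[symmetric] algebra_simps)
    have "E u - E v = (f a - c) * (exp (- (q * (u - a))) * (1 - exp (- (q * (v - u)))))"
      unfolding E_def * by (simp add: algebra_simps)
    moreover have "exp (- (q * (u - a))) * (1 - exp (- (q * (v - u)))) \<le> 1 * (q * (v - u))"
      using that q exp_ge_add_one_self[of "- (q * (v - u))"] by (intro mult_mono) auto
    moreover have "0 \<le> exp (- (q * (u - a))) * (1 - exp (- (q * (v - u))))"
      using that q by auto
    ultimately show ?thesis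
      by (simp add: dist_real_def abs_mult mult.assoc mult_left_mono)
  qed
  have h_ac: "absolutely_continuous_on a b h"
  proof (rule absolutely_continuous_on_dominated[OF ac, where K = 1 and L = "\<bar>f a - c\<bar> * q"])
    fix u v assume uv: "a \<le> u" "u \<le> v" "v \<le> b"
    show "dist (h u) (h v) \<le> 1 * dist (f u) (f v) + \<bar>f a - c\<bar> * q * (v - u)"
    proof -
      have "\<bar>h u - h v\<bar> \<le> \<bar>f u - f v\<bar> + \<bar>E u - E v\<bar>" unfolding h_def by linarith
      then show ?thesis using E_Lip[OF uv(1,2)] by (simp add: dist_real_def)
    qed
  qed (use q in auto)
  have h': "(h has_real_derivative - q * h t) (at t)" if "t \<in> {a<..<b} - N" for t
    unfolding h_def using DERIV_diff[OF der[OF that] E'] by (simp add: algebra_simps)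
  have h_cont: "continuous_on {a..b} h"
    using h_ac by (rule absolutely_continuous_on_imp_continuous_on)
  have ha: "h a = 0" by (simp add: h_def E_def)
  have sgn: "s * h t \<le> 0" if s: "s = 1 \<or> s = -1" and t: "t \<in> {a..b}" for s t
  proof (rule ccontr)
    assume pos: "\<not> s * h t \<le> 0"
    \<comment> \<open>\<open>Sup Z\<close> is the last time at which \<open>s * h\<close> is not
      positive; from there to \<open>t\<close> it is positive, hence nonincreasing, so it could
      never have become positive.\<close>
    define Z where "Z = {x \<in> {a..t}. s * h x \<le> 0}"
    have "closed Z"
      unfolding Z_def using t h_cont
      by (intro continuous_on_closed_Collect_le) (auto intro!: continuous_intros intro: continuous_on_subset)
    moreover have "bdd_above Z" "a \<in> Z" using t ha by (auto simp: Z_def)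
    ultimately have Sup: "Sup Z \<in> Z" by (intro closed_contains_Sup) auto
    then have t0: "a \<le> Sup Z" "Sup Z \<le> t" "s * h (Sup Z) \<le> 0" by (auto simp: Z_def)
    have after: "s * h x > 0" if "Sup Z < x" "x \<le> t" for x
    proof (rule ccontr)
      assume "\<not> s * h x > 0"
      then have "x \<in> Z" using that t0 by (auto simp: Z_def)
      then have "x \<le> Sup Z" using \<open>bdd_above Z\<close> by (rule cSup_upper)
      then show False using that by simp
    qed
    have "- s * h (Sup Z) \<le> - s * h t"
    proof (rule absolutely_continuous_on_nondecreasing[OF _ t0(2) N])
      show "absolutely_continuous_on (Sup Z) t (\<lambda>x. - s * h x)"
      proof (rule absolutely_continuous_on_dominated[where K = 1 and L = 0])
        show "absolutely_continuous_on (Sup Z) t h"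
          using h_ac by (rule absolutely_continuous_on_subset) (use t0 t in auto)
        show "dist (- s * h u) (- s * h v) \<le> 1 * dist (h u) (h v) + 0 * (v - u)" for u v
          using s by (auto simp: dist_real_def)
      qed auto
      fix x assume x: "x \<in> {Sup Z<..<t} - N"
      then have "((\<lambda>x. - s * h x) has_real_derivative - s * (- q * h x)) (at x)"
        by (intro DERIV_cmult h') (use t t0 in auto)
      moreover have "- s * (- q * h x) \<ge> 0"
        using after[of x] x q by (auto simp: mult.left_commute[of s])
      ultimately show "\<exists>d\<ge>0. ((\<lambda>x. - s * h x) has_real_derivative d) (at x)" by blast
    qed
    then show False using pos t0 by auto
  qed
  have "h t = 0" using sgn[of 1 t] sgn[of "-1" t] t by auto
  then show ?thesis by (simp add: h_def E_def)
qed

lemma norm_diff_le_if_derivative_bounded_off_finite: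
  fixes f :: "real \<Rightarrow> 'a::banach"
  assumes S: "finite S" and uv: "u \<le> v" and cont: "continuous_on {u..v} f" and B: "B \<ge> 0"
    and der: "\<And>t. t \<in> {u<..<v} - S \<Longrightarrow> \<exists>D. (f has_vector_derivative D) (at t) \<and> norm D \<le> B"
  shows "norm (f v - f u) \<le> B * (v - u)"
proof -
  obtain D where D: "\<And>t. t \<in> {u<..<v} - S \<Longrightarrow> (f has_vector_derivative D t) (at t) \<and> norm (D t) \<le> B"
    using der by metis
  have "(D has_integral (f v - f u)) {u..v}"
    using S uv _ cont by (rule fundamental_theorem_of_calculus_interior_strong) (use D in blast)
  then have "norm (f v - f u) \<le> B * measure lborel (cbox u v)"
    by (intro has_integral_bound_spike_finite[where S = "S \<union> {u, v}" and f = D])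
      (use B S D in \<open>auto simp: box_real\<close>)
  then show ?thesis using uv by simp
qed

section \<open>Relaxation towards a point\<close>

definition relax_field :: "real ^ 3 \<Rightarrow> real ^ 3 \<Rightarrow> real ^ 3 \<Rightarrow> real ^ 3" where
  "relax_field q c J = (\<chi> i. q $ i * (c $ i - J $ i))"

text \<open>The explicit flow of \<open>relax_field\<close>. It is defined for negative times as
  well, which allows points to be pulled back to a section.\<close>

definition relax :: "real ^ 3 \<Rightarrow> real ^ 3 \<Rightarrow> real \<Rightarrow> real ^ 3 \<Rightarrow> real ^ 3" where
  "relax q c t y = (\<chi> i. c $ i + (y $ i - c $ i) * exp (- (q $ i * t)))"

lemma relax_0 [simp]: "relax q c 0 y = y"
  by (simp add: relax_def vec_eq_iff)

lemma relax_add: "relax q c s (relax q c t y) = relax q c (s + t) y"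
  by (simp add: relax_def vec_eq_iff exp_add[symmetric] algebra_simps)

lemma has_vector_derivative_vec_iff:
  fixes f :: "real \<Rightarrow> real ^ 'n"
  shows "(f has_vector_derivative v) (at t within S) \<longleftrightarrow>
    (\<forall>i. ((\<lambda>t. f t $ i) has_real_derivative v $ i) (at t within S))"
  unfolding has_real_derivative_iff_has_vector_derivative has_vector_derivative_def
  by (subst has_derivative_componentwise_within) (auto simp: Basis_vec_def inner_axis)

lemma relax_deriv:
  "((\<lambda>t. relax q c t y) has_vector_derivative relax_field q c (relax q c t y)) (at t within S)"
  unfolding has_vector_derivative_vec_iff relax_def relax_field_def
  by (auto intro!: derivative_eq_intros simp: algebra_simps)

lemma continuous_relax [continuous_intros]:
  assumes "continuous_on A f" "continuous_on A g"
  shows "continuous_on A (\<lambda>x. relax q c (f x) (g x))"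
  unfolding relax_def using assms by (intro continuous_intros)

lemma continuous_relax_field [continuous_intros]:
  assumes "continuous_on A f"
  shows "continuous_on A (\<lambda>x. relax_field q c (f x))"
  unfolding relax_field_def using assms by (intro continuous_intros)

lemma relax_contracts:
  assumes "\<And>i. 0 \<le> q $ i" "0 \<le> t"
  shows "norm (relax q c t y - relax q c t y') \<le> norm (y - y')"
proof (rule norm_le_componentwise_cart)
  fix i
  have "exp (- (q $ i * t)) \<le> 1" using assms by simp
  then have "\<bar>y $ i - y' $ i\<bar> * exp (- (q $ i * t)) \<le> \<bar>y $ i - y' $ i\<bar>"
    by (intro mult_left_le) auto
  moreover have "relax q c t y $ i - relax q c t y' $ i = (y $ i - y' $ i) * exp (- (q $ i * t))"
    by (simp add: relax_def algebra_simps)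
  ultimately show "norm ((relax q c t y - relax q c t y') $ i) \<le> norm ((y - y') $ i)"
    by (simp add: abs_mult)
qed

text \<open>The exponential is 1-Lipschitz on the nonpositive axis; the factor 3 comes from bounding
  the norm by the sum over three coordinates.\<close>

lemma relax_speed:
  assumes q: "\<And>i. 0 \<le> q $ i" and t: "0 \<le> s" "0 \<le> t" and V: "\<And>i. q $ i * \<bar>y $ i - c $ i\<bar> \<le> V"
  shows "norm (relax q c s y - relax q c t y) \<le> 3 * V * \<bar>s - t\<bar>"
proof -
  have exp_diff: "\<bar>exp (- a) - exp (- b)\<bar> \<le> \<bar>a - b\<bar>" if "0 \<le> a" "a \<le> b" for a b :: real
  proof -
    have "exp (- a) - exp (- b) = exp (- a) * (1 - exp (- (b - a)))"
      by (simp add: exp_diff exp_minus field_simps)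
    also have "\<dots> \<le> 1 * (b - a)"
    proof (rule mult_mono)
      show "1 - exp (- (b - a)) \<le> b - a"
        using exp_ge_add_one_self[of "- (b - a)"] by linarith
    qed (use that in auto)
    finally show ?thesis using that by auto
  qed
  then have exp_diff: "\<bar>exp (- a) - exp (- b)\<bar> \<le> \<bar>a - b\<bar>" if "0 \<le> a" "0 \<le> b" for a b :: real
    using that by (metis abs_minus_commute linear)
  have "norm (relax q c s y - relax q c t y) \<le> (\<Sum>i\<in>UNIV. \<bar>(relax q c s y - relax q c t y) $ i\<bar>)"
    by (rule norm_le_l1_cart)
  also have "\<dots> \<le> (\<Sum>i\<in>(UNIV :: 3 set). V * \<bar>s - t\<bar>)"
  proof (rule sum_mono)
    fix i
    have "\<bar>(relax q c s y - relax q c t y) $ i\<bar> = \<bar>y $ i - c $ i\<bar> * \<bar>exp (- (q $ i * s)) - exp (- (q $ i * t))\<bar>"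
      by (simp add: relax_def abs_mult[symmetric] algebra_simps)
    also have "\<dots> \<le> \<bar>y $ i - c $ i\<bar> * \<bar>q $ i * s - q $ i * t\<bar>"
      using q t by (intro mult_left_mono exp_diff) auto
    also have "\<dots> = (q $ i * \<bar>y $ i - c $ i\<bar>) * \<bar>s - t\<bar>"
      using q[of i] by (simp add: abs_mult right_diff_distrib[symmetric])
    also have "\<dots> \<le> V * \<bar>s - t\<bar>" by (intro mult_right_mono V) auto
    finally show "\<bar>(relax q c s y - relax q c t y) $ i\<bar> \<le> V * \<bar>s - t\<bar>" .
  qed
  finally show ?thesis by simp
qed

lemma affine_growth_along_relax:
  assumes "a \<le> b" and "\<And>t. a \<le> t \<Longrightarrow> t \<le> b \<Longrightarrow> \<eta> \<le> G \<bullet> relax_field q c (relax q c t y)"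
  shows "G \<bullet> relax q c a y + \<eta> * (b - a) \<le> G \<bullet> relax q c b y"
proof -
  have "G \<bullet> relax q c a y - \<eta> * a \<le> G \<bullet> relax q c b y - \<eta> * b"
  proof (rule DERIV_nonneg_imp_nondecreasing[OF assms(1), where f = "\<lambda>t. G \<bullet> relax q c t y - \<eta> * t"])
    fix t assume t: "a \<le> t" "t \<le> b"
    have "((\<lambda>t. G \<bullet> relax q c t y) has_vector_derivative G \<bullet> relax_field q c (relax q c t y)) (at t)"
      by (rule bounded_linear.has_vector_derivative[OF bounded_linear_inner_right relax_deriv])
    then have "((\<lambda>t. G \<bullet> relax q c t y - \<eta> * t) has_real_derivative
        G \<bullet> relax_field q c (relax q c t y) - \<eta>) (at t)"
      unfolding has_real_derivative_iff_has_vector_derivative[symmetric]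
      by (auto intro!: derivative_eq_intros)
    then show "\<exists>d. ((\<lambda>t. G \<bullet> relax q c t y - \<eta> * t) has_real_derivative d) (at t) \<and> 0 \<le> d"
      using assms(2)[OF t] by auto
  qed
  then show ?thesis by (simp add: algebra_simps)
qed

section \<open>Solutions of the inclusion\<close>

lemma inclusion_solution_AE:
  assumes "inclusion_solution H J"
  obtains Z where "negligible Z"
    "\<And>t. 0 \<le> t \<Longrightarrow> t \<notin> Z \<Longrightarrow> \<exists>v\<in>H (J t). (J has_vector_derivative v) (at t)"
proof -
  have "AE t in lebesgue. 0 \<le> t \<longrightarrow> (\<exists>v\<in>H (J t). (J has_vector_derivative v) (at t))"
    using assms by (simp add: inclusion_solution_def)
  then obtain Z where "Z \<in> null_sets lebesgue"
    "{t. \<not> (0 \<le> t \<longrightarrow> (\<exists>v\<in>H (J t). (J has_vector_derivative v) (at t)))} \<subseteq> Z"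
    by (auto simp: eventually_ae_filter)
  then show ?thesis by (intro that[of Z]) (auto simp: negligible_iff_null_sets)
qed

lemma inclusion_solution_ac:
  assumes "inclusion_solution H J" "0 \<le> a" "a \<le> b"
  shows "absolutely_continuous_on a b J"
proof -
  have "absolutely_continuous_on 0 b J" using assms by (auto simp: inclusion_solution_def)
  then show ?thesis using assms(2) by (rule absolutely_continuous_on_subset) simp
qed

lemma inclusion_solution_continuous:
  assumes "inclusion_solution H J"
  shows "continuous_on {0..} J"
  unfolding continuous_on_eq_continuous_within
proof
  fix t :: real assume t: "t \<in> {0..}"
  have "continuous_on {0..t + 1} J"
    by (rule absolutely_continuous_on_imp_continuous_on[OF inclusion_solution_ac[OF assms]]) (use t in auto)
  then have "continuous (at t within {0..t + 1}) J"
    using t by (auto simp: continuous_on_eq_continuous_within)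
  moreover have "at t within {0..t + 1} = at t within {0..}"
    by (rule at_within_nhd[of _ "{..<t + 1}"]) auto
  ultimately show "continuous (at t within {0..}) J" by (simp add: continuous_within)
qed

text \<open>Inside a region the inclusion is single-valued and decouples, so each coordinate solves
  a scalar linear equation almost everywhere.\<close>

lemma inclusion_solution_region:
  assumes J: "inclusion_solution H J" and q: "\<And>i. 0 \<le> q $ i" and "0 \<le> a"
    and H: "\<And>t. a < t \<Longrightarrow> t < b \<Longrightarrow> H (J t) = {relax_field q c (J t)}"
    and t: "t \<in> {a..b}"
  shows "J t = relax q c (t - a) (J a)"
proof -
  obtain Z where Z: "negligible Z"
    "\<And>t. 0 \<le> t \<Longrightarrow> t \<notin> Z \<Longrightarrow> \<exists>v\<in>H (J t). (J has_vector_derivative v) (at t)"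
    using inclusion_solution_AE[OF J] by blast
  have "J t $ i = c $ i + (J a $ i - c $ i) * exp (- (q $ i * (t - a)))" for i
  proof (rule absolutely_continuous_on_linear_ode[OF _ Z(1) q _ t])
    show "absolutely_continuous_on a b (\<lambda>t. J t $ i)"
      by (rule absolutely_continuous_on_dominated[OF inclusion_solution_ac[OF J \<open>0 \<le> a\<close>], where K = 1 and L = 0])
        (use t in \<open>auto simp: dist_vec_nth_le\<close>)
    fix s assume "s \<in> {a<..<b} - Z"
    then have "(J has_vector_derivative relax_field q c (J s)) (at s)"
      using Z(2)[of s] H[of s] \<open>0 \<le> a\<close> by auto
    then show "((\<lambda>t. J t $ i) has_real_derivative q $ i * (c $ i - J s $ i)) (at s)"
      unfolding has_vector_derivative_vec_iff by (simp add: relax_field_def)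
  qed
  then show ?thesis by (simp add: vec_eq_iff relax_def)
qed

text \<open>The multivalued form of transversality: a lower bound on all admissible velocities in
  direction \<open>G\<close> integrates to growth, whatever selection the solution makes.\<close>

lemma inclusion_solution_growth:
  assumes J: "inclusion_solution H J" and "0 \<le> a" "a \<le> b"
    and H: "\<And>t v. a < t \<Longrightarrow> t < b \<Longrightarrow> v \<in> H (J t) \<Longrightarrow> \<eta> \<le> G \<bullet> v"
  shows "G \<bullet> J a + \<eta> * (b - a) \<le> G \<bullet> J b"
proof -
  obtain Z where Z: "negligible Z"
    "\<And>t. 0 \<le> t \<Longrightarrow> t \<notin> Z \<Longrightarrow> \<exists>v\<in>H (J t). (J has_vector_derivative v) (at t)"
    using inclusion_solution_AE[OF J] by blast
  have "G \<bullet> J a - \<eta> * a \<le> G \<bullet> J b - \<eta> * b"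
  proof (rule absolutely_continuous_on_nondecreasing[OF _ \<open>a \<le> b\<close> Z(1), where f = "\<lambda>t. G \<bullet> J t - \<eta> * t"])
    show "absolutely_continuous_on a b (\<lambda>t. G \<bullet> J t - \<eta> * t)"
    proof (rule absolutely_continuous_on_dominated[OF inclusion_solution_ac[OF J \<open>0 \<le> a\<close> \<open>a \<le> b\<close>],
          where K = "norm G" and L = "\<bar>\<eta>\<bar>"])
      fix u v assume uv: "a \<le> u" "u \<le> v" "v \<le> b"
      have "\<bar>G \<bullet> (J u - J v)\<bar> \<le> norm G * dist (J u) (J v)"
        unfolding dist_norm by (rule Cauchy_Schwarz_ineq2)
      moreover have "\<bar>\<eta> * (v - u)\<bar> = \<bar>\<eta>\<bar> * (v - u)" using uv by (simp add: abs_mult)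
      moreover have "(G \<bullet> J u - \<eta> * u) - (G \<bullet> J v - \<eta> * v) = G \<bullet> (J u - J v) + \<eta> * (v - u)"
        by (simp add: inner_diff_right algebra_simps)
      ultimately show "dist (G \<bullet> J u - \<eta> * u) (G \<bullet> J v - \<eta> * v) \<le> norm G * dist (J u) (J v) + \<bar>\<eta>\<bar> * (v - u)"
        unfolding dist_real_def by linarith
    qed auto
    fix t assume t: "t \<in> {a<..<b} - Z"
    then obtain v where v: "v \<in> H (J t)" "(J has_vector_derivative v) (at t)"
      using Z(2)[of t] \<open>0 \<le> a\<close> by auto
    have "((\<lambda>t. G \<bullet> J t) has_vector_derivative G \<bullet> v) (at t)"
      by (rule bounded_linear.has_vector_derivative[OF bounded_linear_inner_right v(2)])
    then have "((\<lambda>t. G \<bullet> J t - \<eta> * t) has_real_derivative G \<bullet> v - \<eta>) (at t)"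
      unfolding has_real_derivative_iff_has_vector_derivative[symmetric]
      by (auto intro!: derivative_eq_intros)
    then show "\<exists>d\<ge>0. ((\<lambda>t. G \<bullet> J t - \<eta> * t) has_real_derivative d) (at t)"
      using H[of t v] v t by (intro exI[of _ "G \<bullet> v - \<eta>"]) auto
  qed
  then show ?thesis by (simp add: algebra_simps)
qed

section \<open>Cycles of relaxations with contracting sections\<close>

lemma continuous_on_atLeastD:
  fixes J :: "real \<Rightarrow> 'a::metric_space"
  assumes "continuous_on {a..} J" "a \<le> b" "0 < r"
  obtains d where "0 < d" "\<And>s. a \<le> s \<Longrightarrow> dist s b < d \<Longrightarrow> dist (J s) (J b) < r"
proof -
  have "\<exists>d>0. \<forall>s\<in>{a..}. dist s b < d \<longrightarrow> dist (J s) (J b) < r"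
    using assms unfolding continuous_on_iff by (metis atLeast_iff)
  then show thesis using that by auto
qed

text \<open>
  On the open region \<open>R k\<close> solutions relax towards \<open>c k\<close>. Arc \<open>k\<close> starts on the section \<open>sec k\<close>, a
  closed piece of the plane \<open>h k + G k \<bullet> J = 0\<close> inside the tie set \<open>S\<close> with \<open>G k\<close> pointing into
  \<open>R k\<close>, and reaches the next section after the travel time \<open>T k\<close>. \<open>N k\<close> is the norm on section \<open>k\<close>
  in which the arcs contract; all data repeat after \<open>M\<close> arcs.
\<close>

locale relay_cycle =
  fixes q :: "real ^ 3" and c :: "nat \<Rightarrow> real ^ 3" and H :: "real ^ 3 \<Rightarrow> (real ^ 3) set"
    and R :: "nat \<Rightarrow> (real ^ 3) set" and S :: "(real ^ 3) set"
    and sec :: "nat \<Rightarrow> (real ^ 3) set" and G :: "nat \<Rightarrow> real ^ 3" and h :: "nat \<Rightarrow> real"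
    and N :: "nat \<Rightarrow> real ^ 3 \<Rightarrow> real" and T :: "nat \<Rightarrow> real ^ 3 \<Rightarrow> real"
    and M :: nat and \<theta> K L Tmin Tmax V \<eta> \<rho> \<epsilon>0 :: real
  assumes q: "\<And>i. 0 \<le> q $ i"
    and M: "0 < M"
    and periodic: "\<And>k. c (k + M) = c k" "\<And>k. R (k + M) = R k" "\<And>k. sec (k + M) = sec k"
      "\<And>k. G (k + M) = G k" "\<And>k. h (k + M) = h k" "\<And>k. N (k + M) = N k" "\<And>k. T (k + M) = T k"
    and open_R: "\<And>k. open (R k)"
    and H_R: "\<And>k J. J \<in> R k \<Longrightarrow> H J = {relax_field q (c k) J}"
    and R_S: "\<And>k. R k \<inter> S = {}" and sec_S: "\<And>k. sec k \<subseteq> S"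
    and sec_ne: "sec 0 \<noteq> {}" and sec_closed: "\<And>k. closed (sec k)"
    and sec_gap: "\<And>k y. y \<in> sec k \<Longrightarrow> h k + G k \<bullet> y = 0"
    and \<eta>: "0 < \<eta>" and \<rho>: "0 < \<rho>" and \<epsilon>0: "0 < \<epsilon>0"
    and crossing_pos: "\<And>k z J. z \<in> sec k \<Longrightarrow> dist J z < \<rho> \<Longrightarrow> h k + G k \<bullet> J > 0 \<Longrightarrow> J \<in> R k"
    and crossing_H: "\<And>k z J v. z \<in> sec k \<Longrightarrow> dist J z < \<rho> \<Longrightarrow> v \<in> H J \<Longrightarrow> \<eta> \<le> G k \<bullet> v"
    and crossing_fields: "\<And>k z J. z \<in> sec (Suc k) \<Longrightarrow> dist J z < \<rho> \<Longrightarrow>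
      \<eta> \<le> G (Suc k) \<bullet> relax_field q (c k) J \<and> \<eta> \<le> G (Suc k) \<bullet> relax_field q (c (Suc k)) J"
    and T: "\<And>k y. y \<in> sec k \<Longrightarrow> Tmin \<le> T k y \<and> T k y \<le> Tmax" and Tmin: "0 < Tmin"
    and arc_end: "\<And>k y. y \<in> sec k \<Longrightarrow> relax q (c k) (T k y) y \<in> sec (Suc k)"
    and arc_R: "\<And>k y t. y \<in> sec k \<Longrightarrow> 0 < t \<Longrightarrow> t < T k y \<Longrightarrow> relax q (c k) t y \<in> R k"
    and interior: "\<And>k y z. y \<in> sec k \<Longrightarrow> h (Suc k) + G (Suc k) \<bullet> z = 0 \<Longrightarrow>
      dist z (relax q (c k) (T k y) y) < \<epsilon>0 \<Longrightarrow> z \<in> sec (Suc k)"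
    and \<theta>: "0 \<le> \<theta>" "\<theta> < 1"
    and contract: "\<And>k y y'. y \<in> sec k \<Longrightarrow> y' \<in> sec k \<Longrightarrow>
      N (Suc k) (relax q (c k) (T k y') y' - relax q (c k) (T k y) y) \<le> \<theta> * N k (y' - y)"
    and T_Lipschitz: "\<And>k y y'. y \<in> sec k \<Longrightarrow> y' \<in> sec k \<Longrightarrow> \<bar>T k y' - T k y\<bar> \<le> L * N k (y' - y)"
    and N_nonneg: "\<And>k v. 0 \<le> N k v" and N_le: "\<And>k v. N k v \<le> K * norm v"
    and norm_le_N: "\<And>k y y'. y \<in> sec k \<Longrightarrow> y' \<in> sec k \<Longrightarrow> norm (y' - y) \<le> K * N k (y' - y)"
    and K: "0 < K" and L: "0 \<le> L"
    and speed: "\<And>k y i. y \<in> sec k \<Longrightarrow> q $ i * \<bar>y $ i - c k $ i\<bar> \<le> V" and V: "0 \<le> V"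
begin

section \<open>The return map and its fixed point\<close>

abbreviation flow where "flow k \<equiv> relax q (c k)"

definition P :: "nat \<Rightarrow> real ^ 3 \<Rightarrow> real ^ 3" where "P k y = flow k (T k y) y"

text \<open>The base index \<open>k\<close> lets a trajectory start on any of the sections;
  \<open>n\<close> counts the arcs completed since.\<close>

fun orb :: "nat \<Rightarrow> real ^ 3 \<Rightarrow> nat \<Rightarrow> real ^ 3" where
  "orb k y 0 = y"
| "orb k y (Suc n) = P (k + n) (orb k y n)"

fun time :: "nat \<Rightarrow> real ^ 3 \<Rightarrow> nat \<Rightarrow> real" where
  "time k y 0 = 0"
| "time k y (Suc n) = time k y n + T (k + n) (orb k y n)"

lemma P_sec: "y \<in> sec k \<Longrightarrow> P k y \<in> sec (Suc k)"
  by (simp add: P_def arc_end)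

lemma orb_sec: "y \<in> sec k \<Longrightarrow> orb k y n \<in> sec (k + n)"
  by (induction n) (auto simp: P_sec)

lemma orb_contract:
  assumes "y \<in> sec k" "y' \<in> sec k"
  shows "N (k + n) (orb k y' n - orb k y n) \<le> \<theta> ^ n * N k (y' - y)"
proof (induction n)
  case (Suc n)
  have "N (k + Suc n) (orb k y' (Suc n) - orb k y (Suc n)) \<le> \<theta> * N (k + n) (orb k y' n - orb k y n)"
    using contract[OF orb_sec[OF assms(1), of n] orb_sec[OF assms(2), of n]] by (simp add: P_def)
  also have "\<dots> \<le> \<theta> * (\<theta> ^ n * N k (y' - y))"
    using Suc \<theta> by (intro mult_left_mono) auto
  finally show ?case by simp
qed simp

lemma periodic_mult: "c (k + j * M) = c k" "R (k + j * M) = R k" "sec (k + j * M) = sec k"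
  "G (k + j * M) = G k" "h (k + j * M) = h k" "N (k + j * M) = N k" "T (k + j * M) = T k"
proof -
  have *: "f (k + j * M) = f k" if "\<And>k. f (k + M) = f k" for f :: "nat \<Rightarrow> 'b"
    by (induction j) (use that in \<open>auto simp: add.assoc[symmetric] add.commute[of M]\<close>)
  show "c (k + j * M) = c k" "R (k + j * M) = R k" "sec (k + j * M) = sec k"
    "G (k + j * M) = G k" "h (k + j * M) = h k" "N (k + j * M) = N k" "T (k + j * M) = T k"
    by (intro * periodic)+
qed

lemma P_periodic: "P (k + j * M) = P k"
  by (simp add: P_def fun_eq_iff periodic_mult)

lemma orb_add: "orb k y (m + n) = orb (k + m) (orb k y m) n"
  by (induction n) (auto simp: add.assoc)

lemma orb_periodic: "orb (k + j * M) y n = orb k y n"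
proof (induction n)
  case (Suc n)
  have "k + j * M + n = (k + n) + j * M" by simp
  then show ?case using Suc by (simp only: orb.simps P_periodic)
qed simp

text \<open>The arcs contract in the norms \<open>N k\<close>, which agree with the Euclidean norm
  only up to the factor \<open>K\<close>. Banach's theorem is therefore applied to a high iterate of
  the return map, with \<open>n\<close> so large that \<open>K * K * \<theta> ^ n\<close> is below
  one half.\<close>

lemma fixed_point: "\<exists>y\<in>sec 0. orb 0 y M = y"
proof -
  have "(\<lambda>n. K * K * \<theta> ^ n) \<longlonglongrightarrow> K * K * 0"
    using \<theta> by (intro tendsto_intros LIMSEQ_realpow_zero) auto
  then have "\<forall>\<^sub>F n in sequentially. K * K * \<theta> ^ n < 1 / 2"
    by (rule order_tendstoD) simp
  then obtain j where j: "\<And>n. j \<le> n \<Longrightarrow> K * K * \<theta> ^ n < 1 / 2"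
    by (auto simp: eventually_sequentially)
  define n where "n = j * M"
  have n: "K * K * \<theta> ^ n < 1 / 2" using M by (intro j) (simp add: n_def)
  have sec_n: "sec (0 + n) = sec 0" unfolding n_def by (rule periodic_mult)
  have self: "orb 0 y n \<in> sec 0" if "y \<in> sec 0" for y using orb_sec[OF that, of n] sec_n by simp
  have "\<exists>!y\<in>sec 0. orb 0 y n = y"
  proof (rule Banach_fix)
    show "complete (sec 0)" by (simp add: complete_eq_closed sec_closed)
    show "(\<lambda>y. orb 0 y n) ` sec 0 \<subseteq> sec 0" using self by auto
    show "dist (orb 0 y n) (orb 0 y' n) \<le> 1 / 2 * dist y y'" if "y \<in> sec 0" "y' \<in> sec 0" for y y'
    proof -
      have "norm (orb 0 y n - orb 0 y' n) \<le> K * N 0 (orb 0 y n - orb 0 y' n)"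
        by (rule norm_le_N) (use self that in auto)
      also have "N 0 = N (0 + n)" unfolding n_def by (rule periodic_mult[symmetric])
      also have "K * N (0 + n) (orb 0 y n - orb 0 y' n) \<le> K * (\<theta> ^ n * N 0 (y - y'))"
        using K by (intro mult_left_mono orb_contract that) auto
      also have "\<dots> \<le> K * (\<theta> ^ n * (K * norm (y - y')))"
        using K \<theta> N_le by (intro mult_left_mono) auto
      also have "\<dots> = K * K * \<theta> ^ n * norm (y - y')" by simp
      also have "\<dots> \<le> 1 / 2 * norm (y - y')" using n by (intro mult_right_mono) auto
      finally show ?thesis by (simp add: dist_norm)
    qed
  qed (use sec_ne in auto)
  then obtain y where y: "y \<in> sec 0" "orb 0 y n = y" and uniq: "\<And>y'. y' \<in> sec 0 \<Longrightarrow> orb 0 y' n = y' \<Longrightarrow> y' = y"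
    by blast
  have M_sec: "orb 0 y M \<in> sec 0" using orb_sec[OF y(1), of M] periodic(3)[of 0] by simp
  \<comment> \<open>The return map commutes with its iterate, so it maps the fixed point of the
    iterate to a fixed point of the iterate; uniqueness identifies the two.\<close>
  have "orb 0 (orb 0 y M) n = orb 0 y (M + n)" using orb_add[of 0 y M n] orb_periodic[of 0 1] by simp
  also have "\<dots> = orb 0 (orb 0 y n) M"
    using orb_add[of 0 y n M] orb_periodic[of 0 j] by (simp add: n_def add.commute)
  finally have "orb 0 y M = y" using uniq M_sec y by metis
  with y show ?thesis by blast
qed

definition x0 :: "real ^ 3" where "x0 = (SOME y. y \<in> sec 0 \<and> orb 0 y M = y)"

abbreviation x where "x \<equiv> orb 0 x0"

lemma x0: "x0 \<in> sec 0" "x M = x0"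
proof -
  have "\<exists>y. y \<in> sec 0 \<and> orb 0 y M = y" using fixed_point by blast
  from someI_ex[OF this] show "x0 \<in> sec 0" "x M = x0" by (auto simp: x0_def)
qed

lemma x_sec: "x n \<in> sec n"
  using orb_sec[OF x0(1), of n] by simp

lemma x_periodic: "x (n + j * M) = x n"
proof (induction j)
  case (Suc j)
  have "x (n + Suc j * M) = orb M (x M) (n + j * M)"
    using orb_add[of 0 x0 M "n + j * M"] by (simp add: algebra_simps)
  also have "\<dots> = x (n + j * M)" using orb_periodic[of 0 1 x0 "n + j * M"] x0 by simp
  finally show ?case using Suc by simp
qed simp

text \<open>Half-open arcs suffice, since the endpoint of an arc is the starting point of the
  next.\<close>

definition C :: "(real ^ 3) set" where "C = {flow k t (x k) | k t. 0 \<le> t \<and> t < T k (x k)}"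

lemma T_pos: "y \<in> sec k \<Longrightarrow> 0 < T k y"
  using T Tmin by (meson order_less_le_trans)

lemma flow_speed: "y \<in> sec k \<Longrightarrow> 0 \<le> s \<Longrightarrow> 0 \<le> t \<Longrightarrow> norm (flow k s y - flow k t y) \<le> 3 * V * \<bar>s - t\<bar>"
  by (rule relax_speed) (auto intro: q speed)

lemma x_in_C: "x k \<in> C"
  unfolding C_def using T_pos[OF x_sec] by (intro CollectI exI[of _ k] exI[of _ 0]) simp

subsection \<open>Solutions follow the arcs\<close>

text \<open>Consider the infimum \<open>m\<close> of the times at which the solution has left the
  arc. By continuity it still agrees with the arc at \<open>m\<close>, hence lies in the open
  region, where it has to agree a little longer. The hypothesis \<open>start\<close> covers an
  initial point on a tie plane, outside the region.\<close>

lemma solution_follows: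
  assumes J: "inclusion_solution H J" and a: "0 \<le> a" and e: "0 < e"
    and start: "\<And>t. a < t \<Longrightarrow> t < a + e \<Longrightarrow> J t \<in> R k"
    and arc: "\<And>t. 0 < t \<Longrightarrow> t < l \<Longrightarrow> flow k t (J a) \<in> R k"
    and t: "0 \<le> t" "t \<le> l"
  shows "J (a + t) = flow k t (J a)"
proof (rule ccontr)
  assume bad: "J (a + t) \<noteq> flow k t (J a)"
  define B where "B = {s. 0 \<le> s \<and> s \<le> l \<and> J (a + s) \<noteq> flow k s (J a)}"
  define m where "m = Inf B"
  have B: "t \<in> B" "bdd_below B" using bad t by (auto simp: B_def intro: bdd_belowI[of _ 0])
  have region: "J s = flow k (s - a) (J a)" if "a \<le> s" "s \<le> b" "\<And>u. a < u \<Longrightarrow> u < b \<Longrightarrow> J u \<in> R k" for s b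
    by (rule inclusion_solution_region[OF J q a, of b]) (use that H_R in auto)
  have m_le: "m \<le> s" if "s \<in> B" for s unfolding m_def using B that by (intro cInf_lower) auto
  have "e \<le> m" unfolding m_def
  proof (rule cInf_greatest)
    fix s assume s: "s \<in> B"
    show "e \<le> s"
    proof (rule ccontr)
      assume "\<not> e \<le> s"
      then have "J (a + s) = flow k (a + s - a) (J a)"
        using s by (intro region[of "a + s" "a + e"] start) (auto simp: B_def)
      then show False using s by (simp add: B_def)
    qed
  qed (use B in auto)
  then have m: "0 < m" "m \<le> t" using e m_le B by auto
  have before: "J (a + s) = flow k s (J a)" if "0 \<le> s" "s < m" for s
    using m_le[of s] that m t by (force simp: B_def)
  have contJ: "continuous_on {0..} J" by (rule inclusion_solution_continuous[OF J])
  have at_m: "J (a + m) = flow k m (J a)"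
  proof -
    have "continuous_on {0..m} (\<lambda>s. J (a + s) - flow k s (J a))"
      by (intro continuous_intros continuous_on_compose2[OF contJ]) (use a in auto)
    moreover have cl: "closure {0..<m} = {0..m}" using m by simp
    ultimately have "continuous_on (closure {0..<m}) (\<lambda>s. J (a + s) - flow k s (J a))" by simp
    then have "J (a + m) - flow k m (J a) = 0"
    proof (rule continuous_constant_on_closure)
      fix s assume "s \<in> {0..<m}"
      then have "J (a + s) = flow k s (J a)" by (intro before) auto
      then show "J (a + s) - flow k s (J a) = 0" by simp
    next
      show "m \<in> closure {0..<m}" unfolding cl using m(1) by simp
    qed
    then show ?thesis by simp
  qed
  have "m < l"
  proof (rule ccontr)
    assume "\<not> m < l"
    then have "t = m" using m t by auto
    then show False using bad at_m by simp
  qed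
  then have "J (a + m) \<in> R k" using arc[of m] m at_m by simp
  \<comment> \<open>Openness of the region keeps the solution inside it beyond \<open>m\<close>, so
    agreement extends past the infimum.\<close>
  then obtain r where r: "r > 0" "ball (J (a + m)) r \<subseteq> R k"
    using open_R open_contains_ball by metis
  have "continuous_on {a..} J" by (rule continuous_on_subset[OF contJ]) (use a in auto)
  then obtain d where d: "d > 0" "\<And>s. a \<le> s \<Longrightarrow> dist s (a + m) < d \<Longrightarrow> dist (J s) (J (a + m)) < r"
    using r(1) m by (elim continuous_on_atLeastD[where b = "a + m"]) auto
  have in_R: "J s \<in> R k" if "a < s" "s < a + m + d" for s
  proof (cases "s < a + m")
    case True
    then have "J s = flow k (s - a) (J a)" using before[of "s - a"] that by simp
    then show ?thesis using arc[of "s - a"] True that \<open>m < l\<close> by simp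
  next
    case False
    then have "dist (J s) (J (a + m)) < r" using that by (intro d) (auto simp: dist_real_def)
    then show ?thesis using r(2) by (auto simp: dist_commute)
  qed
  have "m + d \<le> s" if s: "s \<in> B" for s
  proof (rule ccontr)
    assume "\<not> m + d \<le> s"
    then have "J (a + s) = flow k (a + s - a) (J a)"
      using s by (intro region[of "a + s" "a + m + d"] in_R) (auto simp: B_def)
    then show False using s by (simp add: B_def)
  qed
  then have "m + d \<le> m" unfolding m_def using B by (intro cInf_greatest) auto
  then show False using d by simp
qed

text \<open>This excludes sliding: close to the section every admissible velocity raises the gap at
  rate at least \<open>\<eta>\<close>, so the gap is positive immediately after the start.\<close>

lemma solution_enters:
  assumes J: "inclusion_solution H J" and a: "0 \<le> a" and y: "J a \<in> sec k"
  obtains e where "0 < e" "\<And>t. a < t \<Longrightarrow> t < a + e \<Longrightarrow> J t \<in> R k"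
proof -
  have "continuous_on {a..} J"
    by (rule continuous_on_subset[OF inclusion_solution_continuous[OF J]]) (use a in auto)
  then obtain d where d: "d > 0" "\<And>s. a \<le> s \<Longrightarrow> dist s a < d \<Longrightarrow> dist (J s) (J a) < \<rho>"
    using \<rho> by (elim continuous_on_atLeastD[where b = a]) auto
  have "J t \<in> R k" if t: "a < t" "t < a + d" for t
  proof (rule crossing_pos[OF y])
    show "dist (J t) (J a) < \<rho>" using t by (intro d) (auto simp: dist_real_def)
    have "G k \<bullet> J a + \<eta> * (t - a) \<le> G k \<bullet> J t"
    proof (rule inclusion_solution_growth[OF J a])
      fix u v assume u: "a < u" "u < t" "v \<in> H (J u)"
      then have "dist (J u) (J a) < \<rho>" using t by (intro d) (auto simp: dist_real_def)
      then show "\<eta> \<le> G k \<bullet> v" using u by (intro crossing_H[OF y])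
    qed (use t in simp)
    moreover have "0 < \<eta> * (t - a)" using \<eta> t by simp
    ultimately show "0 < h k + G k \<bullet> J t" using sec_gap[OF y] by linarith
  qed
  with d(1) show thesis by (rule that)
qed

lemma solution_arc:
  assumes J: "inclusion_solution H J" and a: "0 \<le> a" and y: "J a \<in> sec k"
    and t: "0 \<le> t" "t \<le> T k (J a)"
  shows "J (a + t) = flow k t (J a)"
proof -
  obtain e where "0 < e" "\<And>t. a < t \<Longrightarrow> t < a + e \<Longrightarrow> J t \<in> R k"
    using solution_enters[OF J a y] by blast
  then show ?thesis using arc_R[OF y] t by (intro solution_follows[OF J a])
qed

text \<open>\<open>t\<close> is the phase of \<open>J 0\<close> on the first arc.\<close>

definition tracks :: "(real \<Rightarrow> real ^ 3) \<Rightarrow> nat \<Rightarrow> real ^ 3 \<Rightarrow> real \<Rightarrow> bool" where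
  "tracks J k y t \<longleftrightarrow> (\<forall>n s. time k y n \<le> s \<longrightarrow> s \<le> time k y (Suc n) \<longrightarrow> t \<le> s \<longrightarrow>
     J (s - t) = flow (k + n) (s - time k y n) (orb k y n))"

lemma time_mono: "y \<in> sec k \<Longrightarrow> time k y n + Tmin \<le> time k y (Suc n)"
  using T[OF orb_sec, of y k n] by simp

lemma time_bounds:
  assumes "y \<in> sec k"
  shows time_le: "time k y n \<le> n * Tmax" and time_ge: "n * Tmin \<le> time k y n"
proof (induction n)
  case (Suc n)
  have "T (k + n) (orb k y n) \<le> Tmax" "Tmin \<le> T (k + n) (orb k y n)"
    using T[OF orb_sec[OF assms, of n]] by auto
  then have "time k y (Suc n) \<le> n * Tmax + Tmax" "n * Tmin + Tmin \<le> time k y (Suc n)"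
    using Suc by simp_all
  then show "time k y (Suc n) \<le> Suc n * Tmax" "Suc n * Tmin \<le> time k y (Suc n)"
    by (simp_all add: algebra_simps)
qed simp_all

lemma time_less: "y \<in> sec k \<Longrightarrow> m < n \<Longrightarrow> time k y m < time k y n"
proof (induction n)
  case (Suc n)
  have "time k y n < time k y (Suc n)" using time_mono[OF Suc.prems(1), of n] Tmin by linarith
  then show ?case using Suc by (cases "m = n") auto
qed simp

lemma time_index:
  assumes y: "y \<in> sec k" and "0 \<le> s"
  obtains n where "time k y n \<le> s" "s < time k y (Suc n)"
proof -
  obtain m :: nat where m: "s < m * Tmin" using Tmin reals_Archimedean3 by blast
  define n where "n = (LEAST n. s < time k y (Suc n))"
  have ex: "s < time k y (Suc m)"
    using m time_ge[OF y, of m] time_mono[OF y, of m] Tmin by linarith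
  then have "s < time k y (Suc n)" unfolding n_def by (rule LeastI)
  moreover have "time k y n \<le> s"
  proof (cases n)
    case (Suc j)
    then have "\<not> s < time k y (Suc j)" unfolding n_def using not_less_Least[of j "\<lambda>n. s < time k y (Suc n)"] by simp
    then show ?thesis using Suc by simp
  qed (use assms in simp)
  ultimately show thesis using that by blast
qed

lemma solution_tracks:
  assumes J: "inclusion_solution H J" and y: "y \<in> sec k" and t: "0 \<le> t" "t < T k y"
    and start: "J 0 = flow k t y"
  shows "tracks J k y t"
proof -
  \<comment> \<open>Phase zero starts on the section and has to enter the region first; at a
    positive phase the solution is already inside it.\<close>
  have first: "J (s - t) = flow k s y" if s: "t \<le> s" "s \<le> T k y" for s
  proof (cases "t = 0")
    case True
    then show ?thesis using solution_arc[OF J, of 0 k s] y start s by simp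
  next
    case False
    then have J0: "J 0 \<in> R k" using arc_R[OF y, of t] t start by simp
    then obtain r where r: "r > 0" "ball (J 0) r \<subseteq> R k"
      using open_R open_contains_ball by metis
    obtain e where e: "e > 0" "\<And>s. 0 \<le> s \<Longrightarrow> dist s 0 < e \<Longrightarrow> dist (J s) (J 0) < r"
      using continuous_on_atLeastD[OF inclusion_solution_continuous[OF J] order_refl r(1)] by blast
    have "J (0 + (s - t)) = flow k (s - t) (J 0)"
    proof (rule solution_follows[OF J _ e(1), where l = "T k y - t"])
      fix u assume "0 < u" "u < 0 + e"
      then have "dist (J u) (J 0) < r" by (intro e) (auto simp: dist_real_def)
      then show "J u \<in> R k" using r(2) by (auto simp: dist_commute)
    next
      fix u assume "0 < u" "u < T k y - t"
      then show "flow k u (J 0) \<in> R k" using arc_R[OF y, of "u + t"] t by (simp add: start relax_add)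
    qed (use s in auto)
    then show ?thesis by (simp add: start relax_add)
  qed
  have T0: "0 < T k y" by (rule T_pos[OF y])
  have knots: "J (time k y (Suc n) - t) = orb k y (Suc n) \<and> t \<le> time k y (Suc n)" for n
  proof (induction n)
    case 0
    show ?case using first[of "T k y"] t by (simp add: P_def)
  next
    case (Suc n)
    let ?a = "time k y (Suc n) - t"
    have yn: "orb k y (Suc n) \<in> sec (k + Suc n)" by (rule orb_sec[OF y])
    have Ja: "J ?a = orb k y (Suc n)" using Suc by blast
    have "J (?a + T (k + Suc n) (J ?a)) = flow (k + Suc n) (T (k + Suc n) (J ?a)) (J ?a)"
      by (rule solution_arc[OF J]) (use Suc yn T_pos[OF yn] in auto)
    then have "J (?a + T (k + Suc n) (orb k y (Suc n))) = orb k y (Suc (Suc n))"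
      unfolding Ja by (simp only: orb.simps(2) P_def)
    moreover have "?a + T (k + Suc n) (orb k y (Suc n)) = time k y (Suc (Suc n)) - t" by simp
    ultimately have "J (time k y (Suc (Suc n)) - t) = orb k y (Suc (Suc n))"
      by (simp only:)
    moreover have "t \<le> time k y (Suc (Suc n))"
      using Suc time_mono[OF y, of "Suc n"] Tmin by linarith
    ultimately show ?case by simp
  qed
  show ?thesis
    unfolding tracks_def
  proof (intro allI impI)
    fix n s assume s: "time k y n \<le> s" "s \<le> time k y (Suc n)" "t \<le> s"
    show "J (s - t) = flow (k + n) (s - time k y n) (orb k y n)"
    proof (cases n)
      case 0
      then show ?thesis using first[of s] s by simp
    next
      case (Suc j)
      let ?a = "time k y n - t"
      have J_a: "J ?a = orb k y n" "0 \<le> ?a" using knots[of j] Suc by auto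
      have "orb k y n \<in> sec (k + n)" by (rule orb_sec[OF y])
      then have "J (?a + (s - time k y n)) = flow (k + n) (s - time k y n) (J ?a)"
        using s J_a by (intro solution_arc[OF J]) auto
      then show ?thesis by (simp add: J_a)
    qed
  qed
qed

text \<open>Compare with the point of the cycle at the same phase. If the arc of the cycle is
  shorter, compare with its endpoint instead; the overrun is at most the difference of travel times,
  covered with speed at most \<open>3 * V\<close>.\<close>

lemma infdist_arc:
  assumes y: "y \<in> sec k" and s: "0 \<le> s" "s \<le> T k y"
  shows "infdist (flow k s y) C \<le> (3 * V * L + K) * N k (y - x k)"
proof -
  have yx: "norm (y - x k) \<le> K * N k (y - x k)" by (rule norm_le_N[OF x_sec y])
  have close: "dist (flow k u y) (flow k u (x k)) \<le> K * N k (y - x k)" if "0 \<le> u" for u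
    unfolding dist_norm using relax_contracts[of q u "c k" y "x k"] q that yx by force
  have N0: "0 \<le> 3 * V * L * N k (y - x k)" using V L N_nonneg by simp
  show ?thesis
  proof (cases "s < T k (x k)")
    case True
    then have "flow k s (x k) \<in> C" using s by (auto simp: C_def)
    then have "infdist (flow k s y) C \<le> dist (flow k s y) (flow k s (x k))" by (rule infdist_le)
    then show ?thesis using close[OF s(1)] N0 by (simp add: algebra_simps)
  next
    case False
    let ?u = "T k (x k)"
    have u: "0 \<le> ?u" using T_pos[OF x_sec, of k] by simp
    have "flow k ?u (x k) = x (Suc k)" by (simp add: P_def)
    then have "infdist (flow k s y) C \<le> dist (flow k s y) (flow k ?u (x k))"
      using x_in_C[of "Suc k"] by (intro infdist_le) simp
    also have "\<dots> \<le> dist (flow k s y) (flow k ?u y) + dist (flow k ?u y) (flow k ?u (x k))"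
      by (rule dist_triangle)
    also have "dist (flow k s y) (flow k ?u y) \<le> 3 * V * \<bar>s - ?u\<bar>"
      unfolding dist_norm by (rule flow_speed[OF y s(1) u])
    also have "3 * V * \<bar>s - ?u\<bar> \<le> 3 * V * (L * N k (y - x k))"
      using T_Lipschitz[OF x_sec y] False s V by (intro mult_left_mono) auto
    also note close[OF u]
    finally show ?thesis by (simp add: algebra_simps)
  qed
qed

text \<open>By time \<open>n * Tmax\<close> at least \<open>n\<close> arcs are complete, each
  contributing a factor \<open>\<theta>\<close>.\<close>

lemma infdist_tracking:
  assumes J: "inclusion_solution H J" and y: "y \<in> sec k" and t: "0 \<le> t" "t < T k y"
    and start: "J 0 = flow k t y" and s: "real n * Tmax \<le> s" "0 \<le> s"
  shows "infdist (J s) C \<le> (3 * V * L + K) * (\<theta> ^ n * N k (y - x k))"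
proof -
  have "0 \<le> s + t" using s t by simp
  then obtain m where m: "time k y m \<le> s + t" "s + t < time k y (Suc m)"
    using time_index[OF y] by blast
  have "n \<le> m"
  proof (rule ccontr)
    assume "\<not> n \<le> m"
    then have "real (Suc m) \<le> real n" by (simp only: of_nat_le_iff)
    moreover have "0 \<le> Tmax" using T[OF y] Tmin by linarith
    ultimately have "real (Suc m) * Tmax \<le> real n * Tmax" by (intro mult_right_mono)
    then show False using time_le[OF y, of "Suc m"] m s t by linarith
  qed
  have ym: "orb k y m \<in> sec (k + m)" by (rule orb_sec[OF y])
  have "J (s + t - t) = flow (k + m) (s + t - time k y m) (orb k y m)"
    using solution_tracks[OF J y t start] m s unfolding tracks_def by (metis add.commute le_add_same_cancel1 less_imp_le)
  then have "infdist (J s) C \<le> (3 * V * L + K) * N (k + m) (orb k y m - x (k + m))"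
    using infdist_arc[OF ym, of "s + t - time k y m"] m by simp
  also have "x (k + m) = orb k (x k) m" using orb_add[of 0 x0 k m] by simp
  also have "N (k + m) (orb k y m - orb k (x k) m) \<le> \<theta> ^ m * N k (y - x k)"
    by (rule orb_contract[OF x_sec y])
  also have "\<dots> \<le> \<theta> ^ n * N k (y - x k)"
    using \<theta> \<open>n \<le> m\<close> N_nonneg by (intro mult_right_mono power_decreasing) auto
  finally show ?thesis using V L K by (simp add: mult_left_mono)
qed

end

context relay_cycle
begin

subsection \<open>A neighbourhood of the cycle\<close>

text \<open>Along the flow of arc \<open>Suc k\<close>, run forwards or backwards, the gap grows at
  rate \<open>\<eta>\<close>, so a nearby point meets the tie plane within a short time. The index
  is a successor because \<open>interior\<close> provides section points only around arrival points.
  The last conjunct says that points on the positive side are reached from the section forwards in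
  time.\<close>

lemma near_section:
  assumes "0 < e"
  obtains \<delta> where "0 < \<delta>" "\<And>w. dist w (x (Suc k)) < \<delta> \<Longrightarrow>
    \<exists>t. \<bar>t\<bar> < e \<and> flow (Suc k) t w \<in> sec (Suc k) \<and> N (Suc k) (flow (Suc k) t w - x (Suc k)) < e \<and>
      (0 \<le> h (Suc k) + G (Suc k) \<bullet> w \<longrightarrow> t \<le> 0)"
proof -
  let ?k = "Suc k" and ?x = "x (Suc k)"
  \<comment> \<open>Within \<open>r\<close> the gap grows, points of the tie plane belong to the
    section, and \<open>N\<close> is below \<open>e\<close>.\<close>
  define r where "r = min \<rho> (min \<epsilon>0 (e / K))"
  have r: "0 < r" "r \<le> \<rho>" "r \<le> \<epsilon>0" "K * r \<le> e"
  proof -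
    have "r \<le> e / K" by (simp add: r_def)
    then show "K * r \<le> e" using K by (simp add: field_simps)
  qed (use \<rho> \<epsilon>0 K assms in \<open>auto simp: r_def\<close>)
  have "continuous_on UNIV (\<lambda>p. flow ?k (fst p) (snd p))"
    by (intro continuous_intros)
  from this[unfolded continuous_on_iff, rule_format, OF UNIV_I r(1), of "(0, ?x)"]
  have "\<exists>d>0. \<forall>p. dist p (0, ?x) < d \<longrightarrow> dist (flow ?k (fst p) (snd p)) ?x < r"
    by simp
  then obtain d where d: "0 < d" "\<And>p. dist p (0, ?x) < d \<Longrightarrow> dist (flow ?k (fst p) (snd p)) ?x < r"
    by auto
  have d: "0 < d" "\<And>t w. \<bar>t\<bar> < d / 2 \<Longrightarrow> dist w ?x < d / 2 \<Longrightarrow> dist (flow ?k t w) ?x < r"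
  proof -
    fix t :: real and w assume "\<bar>t\<bar> < d / 2" "dist w ?x < d / 2"
    then have "dist (t, w) (0, ?x) < d"
      using sqrt_sum_squares_le_sum_abs[of "dist t 0" "dist w ?x"] by (simp add: dist_Pair_Pair)
    from d(2)[OF this] show "dist (flow ?k t w) ?x < r" by simp
  qed (rule d)
  define b where "b = min (d / 4) (e / 2)"
  have b: "0 < b" "b < d / 2" "b < e" using d(1) assms by (auto simp: b_def)
  \<comment> \<open>This keeps the initial gap below \<open>\<eta> * b\<close>, which growth at rate
    \<open>\<eta>\<close> compensates within time \<open>b\<close>.\<close>
  define \<delta> where "\<delta> = min (d / 2) (\<eta> * b / (norm (G ?k) + 1))"
  have "0 < norm (G ?k) + 1" by (smt (verit) norm_ge_zero)
  then have \<delta>: "0 < \<delta>" "\<delta> \<le> d / 2" "norm (G ?k) * \<delta> < \<eta> * b"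
  proof -
    show "0 < \<delta>" using d(1) \<eta> b \<open>0 < norm (G ?k) + 1\<close> by (auto simp: \<delta>_def)
    have "norm (G ?k) * \<delta> \<le> norm (G ?k) * (\<eta> * b / (norm (G ?k) + 1))"
      by (intro mult_left_mono) (auto simp: \<delta>_def)
    also have "\<dots> < \<eta> * b"
      using \<open>0 < norm (G ?k) + 1\<close> \<eta> b by (simp add: field_simps)
    finally show "norm (G ?k) * \<delta> < \<eta> * b" .
    show "\<delta> \<le> d / 2" unfolding \<delta>_def by (rule min.cobounded1)
  qed
  have "\<exists>t. \<bar>t\<bar> < e \<and> flow ?k t w \<in> sec ?k \<and> N ?k (flow ?k t w - ?x) < e \<and>
      (0 \<le> h ?k + G ?k \<bullet> w \<longrightarrow> t \<le> 0)" if w: "dist w ?x < \<delta>" for w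
  proof -
    let ?g = "\<lambda>t. h ?k + G ?k \<bullet> flow ?k t w"
    have in_ball: "dist (flow ?k t w) ?x < r" if "- b \<le> t" "t \<le> b" for t
      using that b w \<delta> by (intro d) auto
    have growth: "?g s + \<eta> * (t - s) \<le> ?g t" if "- b \<le> s" "s \<le> t" "t \<le> b" for s t
    proof -
      have "G ?k \<bullet> flow ?k s w + \<eta> * (t - s) \<le> G ?k \<bullet> flow ?k t w"
      proof (rule affine_growth_along_relax)
        fix u assume "s \<le> u" "u \<le> t"
        then have "dist (flow ?k u w) ?x < \<rho>" using in_ball[of u] that r by auto
        then show "\<eta> \<le> G ?k \<bullet> relax_field q (c ?k) (flow ?k u w)"
          using crossing_fields[OF x_sec[of ?k]] by blast
      qed (use that in auto)
      then show ?thesis by simp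
    qed
    have "h ?k + G ?k \<bullet> w = G ?k \<bullet> (w - ?x)"
      using sec_gap[OF x_sec[of ?k]] by (simp add: inner_diff_right)
    also have "\<bar>\<dots>\<bar> \<le> norm (G ?k) * norm (w - ?x)" by (rule Cauchy_Schwarz_ineq2)
    also have "\<dots> \<le> norm (G ?k) * \<delta>" using w by (intro mult_left_mono) (auto simp: dist_norm)
    finally have small: "\<bar>?g 0\<bar> < \<eta> * b" using \<delta>(3) by simp
    have "?g (- b) \<le> 0" "0 \<le> ?g b"
      using growth[of "- b" 0] growth[of 0 b] b small by auto
    moreover have "continuous_on {- b..b} ?g" by (intro continuous_intros)
    ultimately obtain t where t: "- b \<le> t" "t \<le> b" "?g t = 0"
      using IVT'[of ?g "- b" 0 b] b by auto
    have near: "dist (flow ?k t w) ?x < r" using in_ball t by simp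
    have "flow k (T k (x k)) (x k) = ?x" by (simp add: P_def)
    then have "flow ?k t w \<in> sec ?k"
      using near r t by (intro interior[OF x_sec[of k]]) auto
    moreover have "N ?k (flow ?k t w - ?x) < e"
    proof -
      have "N ?k (flow ?k t w - ?x) \<le> K * dist (flow ?k t w) ?x" unfolding dist_norm by (rule N_le)
      also have "\<dots> < K * r" using near K by simp
      finally show ?thesis using r by simp
    qed
    moreover have "t \<le> 0" if "0 \<le> h ?k + G ?k \<bullet> w"
    proof (rule ccontr)
      assume "\<not> t \<le> 0"
      then have "?g 0 + \<eta> * (t - 0) \<le> ?g t" using t b by (intro growth) auto
      moreover have "0 < \<eta> * t" using \<eta> \<open>\<not> t \<le> 0\<close> by simp
      ultimately show False using that t by simp
    qed
    ultimately show ?thesis using t b by (intro exI[of _ t]) auto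
  qed
  with \<delta>(1) show thesis by (rule that)
qed

text \<open>The flow is invertible, so running it back by time \<open>s\<close> reduces points near
  any point of the arc to points near its start.\<close>

lemma pull_back:
  assumes "0 < e"
  obtains \<delta> where "0 < \<delta>" "\<And>w. dist w (flow (Suc k) s (x (Suc k))) < \<delta> \<Longrightarrow>
    \<exists>t y. \<bar>t\<bar> < e \<and> y \<in> sec (Suc k) \<and> N (Suc k) (y - x (Suc k)) < e \<and> w = flow (Suc k) (s - t) y"
proof -
  let ?k = "Suc k" and ?x = "x (Suc k)"
  obtain \<delta>1 where \<delta>1: "0 < \<delta>1" "\<And>w. dist w ?x < \<delta>1 \<Longrightarrow>
    \<exists>t. \<bar>t\<bar> < e \<and> flow ?k t w \<in> sec ?k \<and> N ?k (flow ?k t w - ?x) < e \<and> (0 \<le> h ?k + G ?k \<bullet> w \<longrightarrow> t \<le> 0)"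
    using near_section[OF assms, of k] by blast
  have "continuous_on UNIV (\<lambda>w. flow ?k (- s) w)" by (intro continuous_intros)
  then have "\<exists>\<delta>>0. \<forall>w\<in>UNIV. dist w (flow ?k s ?x) < \<delta> \<longrightarrow> dist (flow ?k (- s) w) (flow ?k (- s) (flow ?k s ?x)) < \<delta>1"
    using \<delta>1(1) unfolding continuous_on_iff by blast
  then obtain \<delta> where \<delta>: "0 < \<delta>" "\<And>w. dist w (flow ?k s ?x) < \<delta> \<Longrightarrow> dist (flow ?k (- s) w) ?x < \<delta>1"
    by (auto simp: relax_add)
  show thesis
  proof (rule that[OF \<delta>(1)])
    fix w assume "dist w (flow ?k s ?x) < \<delta>"
    then obtain t where t: "\<bar>t\<bar> < e" "flow ?k t (flow ?k (- s) w) \<in> sec ?k"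
      "N ?k (flow ?k t (flow ?k (- s) w) - ?x) < e"
      using \<delta>1(2) \<delta>(2) by blast
    have "w = flow ?k (s - t) (flow ?k t (flow ?k (- s) w))" by (simp add: relax_add)
    with t show "\<exists>t y. \<bar>t\<bar> < e \<and> y \<in> sec ?k \<and> N ?k (y - ?x) < e \<and> w = flow ?k (s - t) y" by blast
  qed
qed

text \<open>The union of all arcs that start \<open>e\<close>-close to the cycle on some section;
  contraction bounds later distances for solutions starting here.\<close>

definition tube :: "real \<Rightarrow> (real ^ 3) set" where
  "tube e = {flow k t y | k t y. y \<in> sec k \<and> N k (y - x k) < e \<and> 0 \<le> t \<and> t < T k y}"

lemma tubeI: "y \<in> sec k \<Longrightarrow> N k (y - x k) < e \<Longrightarrow> 0 \<le> t \<Longrightarrow> t < T k y \<Longrightarrow> flow k t y \<in> tube e"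
  unfolding tube_def by blast

text \<open>Adding two full periods to the index makes it a double successor, so that both this arc
  and its predecessor have the form required by \<open>pull_back\<close>.\<close>

lemma C_cases:
  assumes "z \<in> C"
  obtains k t where "z = flow (Suc (Suc k)) t (x (Suc (Suc k)))" "0 \<le> t" "t < T (Suc (Suc k)) (x (Suc (Suc k)))"
proof -
  obtain k t where k: "z = flow k t (x k)" "0 \<le> t" "t < T k (x k)" using assms by (auto simp: C_def)
  have "2 \<le> 2 * M" using M by simp
  then obtain j where j: "k + 2 * M = Suc (Suc j)" using le_Suc_ex[of 2 "k + 2 * M"] by auto
  show thesis
    using that[of j t] k periodic_mult(1,7)[of k 2] x_periodic[of k 2] by (simp add: j)
qed

text \<open>At a point inside an arc, pulling back to the section suffices. At a switching point the
  two sides of the tie plane are treated separately: the positive side belongs to the arc that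
  starts there, the negative side to the arc that ends there.\<close>

lemma C_interior_tube:
  assumes e: "0 < e"
  shows "C \<subseteq> interior (tube e)"
proof
  fix z assume "z \<in> C"
  then obtain j s where z: "z = flow (Suc (Suc j)) s (x (Suc (Suc j)))"
    and s: "0 \<le> s" "s < T (Suc (Suc j)) (x (Suc (Suc j)))"
    by (rule C_cases)
  let ?k = "Suc j" and ?l = "Suc (Suc j)"
  have "\<exists>\<delta>>0. ball z \<delta> \<subseteq> tube e"
  proof (cases "s = 0")
    case False
    \<comment> \<open>The time shift is less than \<open>a\<close> and the travel time changes by at
      most \<open>L * a\<close>; together they fit into the remaining time, and
      \<open>a \<le> s\<close> keeps the phase nonnegative.\<close>
    define a where "a = min e (min s ((T ?l (x ?l) - s) / (1 + L)))"
    have a: "0 < a" "a \<le> e" "a \<le> s" "(1 + L) * a \<le> T ?l (x ?l) - s"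
    proof -
      have "a \<le> (T ?l (x ?l) - s) / (1 + L)" by (simp add: a_def)
      then show "(1 + L) * a \<le> T ?l (x ?l) - s" using L by (simp add: field_simps)
    qed (use e False s L in \<open>auto simp: a_def\<close>)
    obtain \<delta> where \<delta>: "0 < \<delta>" "\<And>w. dist w (flow ?l s (x ?l)) < \<delta> \<Longrightarrow>
        \<exists>t y. \<bar>t\<bar> < a \<and> y \<in> sec ?l \<and> N ?l (y - x ?l) < a \<and> w = flow ?l (s - t) y"
      using pull_back[OF a(1), of ?k s] by blast
    have "w \<in> tube e" if w: "w \<in> ball z \<delta>" for w
    proof -
      obtain t y where ty: "\<bar>t\<bar> < a" "y \<in> sec ?l" "N ?l (y - x ?l) < a" "w = flow ?l (s - t) y"
        using \<delta>(2)[of w] w z by (auto simp: dist_commute)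
      have "\<bar>T ?l y - T ?l (x ?l)\<bar> \<le> L * N ?l (y - x ?l)" by (rule T_Lipschitz[OF x_sec ty(2)])
      also have "\<dots> \<le> L * a" using L ty by (intro mult_left_mono) auto
      finally have "s - t < T ?l y" using ty a by (simp add: algebra_simps)
      then show ?thesis unfolding ty(4) using ty a by (intro tubeI) auto
    qed
    with \<delta>(1) show ?thesis by blast
  next
    case True
    then have z: "z = x ?l" using z by simp
    define A where "A = 3 * V * (1 + L)"
    have A: "0 \<le> A" using V L by (simp add: A_def)
    \<comment> \<open>An overrun of the arrival time is at most \<open>(1 + L) * a\<close>; at speed
      \<open>3 * V\<close> this stays within \<open>\<rho>\<close> of the next section.\<close>
    define a where "a = min e (min Tmin (\<rho> / (A + 1)))"
    have a: "0 < a" "a \<le> e" "a \<le> Tmin" "A * a < \<rho>"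
    proof -
      show pos: "0 < a" using e Tmin \<rho> A by (simp add: a_def)
      have "a \<le> \<rho> / (A + 1)" by (simp add: a_def)
      then have "(A + 1) * a \<le> \<rho>" using A by (simp add: field_simps)
      then show "A * a < \<rho>" using pos by (simp add: algebra_simps)
    qed (auto simp: a_def)
    obtain \<delta>1 where \<delta>1: "0 < \<delta>1" "\<And>w. dist w (x ?l) < \<delta>1 \<Longrightarrow>
      \<exists>t. \<bar>t\<bar> < a \<and> flow ?l t w \<in> sec ?l \<and> N ?l (flow ?l t w - x ?l) < a \<and> (0 \<le> h ?l + G ?l \<bullet> w \<longrightarrow> t \<le> 0)"
      using near_section[OF a(1), of ?k] by blast
    define \<tau> where "\<tau> = T ?k (x ?k)"
    have \<tau>: "flow ?k \<tau> (x ?k) = x ?l" by (simp add: \<tau>_def P_def)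
    obtain \<delta>2 where \<delta>2: "0 < \<delta>2" "\<And>w. dist w (flow ?k \<tau> (x ?k)) < \<delta>2 \<Longrightarrow>
        \<exists>t y. \<bar>t\<bar> < a \<and> y \<in> sec ?k \<and> N ?k (y - x ?k) < a \<and> w = flow ?k (\<tau> - t) y"
      using pull_back[OF a(1), of j \<tau>] by blast
    have "w \<in> tube e" if w: "w \<in> ball z (min \<delta>1 \<delta>2)" for w
    proof (cases "0 \<le> h ?l + G ?l \<bullet> w")
      case True
      then obtain t where t: "\<bar>t\<bar> < a" "flow ?l t w \<in> sec ?l" "N ?l (flow ?l t w - x ?l) < a" "t \<le> 0"
        using \<delta>1(2)[of w] w z by (auto simp: dist_commute)
      have "- t < T ?l (flow ?l t w)" using t a T[OF t(2)] by linarith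
      then have "flow ?l (- t) (flow ?l t w) \<in> tube e" using t a by (intro tubeI) auto
      then show ?thesis by (simp add: relax_add)
    next
      case False
      obtain t y where ty: "\<bar>t\<bar> < a" "y \<in> sec ?k" "N ?k (y - x ?k) < a" "w = flow ?k (\<tau> - t) y"
        using \<delta>2(2)[of w] w z \<tau> by (auto simp: dist_commute)
      have "\<bar>T ?k y - \<tau>\<bar> \<le> L * N ?k (y - x ?k)" unfolding \<tau>_def by (rule T_Lipschitz[OF x_sec ty(2)])
      also have "\<dots> \<le> L * a" using L ty by (intro mult_left_mono) auto
      finally have Ty: "\<bar>T ?k y - \<tau>\<bar> \<le> L * a" .
      have "\<tau> - t < T ?k y"
      proof (rule ccontr)
        assume neg: "\<not> \<tau> - t < T ?k y"
        \<comment> \<open>If the previous arc had already ended, the gap would have grown from zero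
          for time \<open>u\<close> and could not be negative.\<close>
        define u where "u = \<tau> - t - T ?k y"
        have u: "0 \<le> u" "u \<le> (1 + L) * a" using neg Ty ty by (auto simp: u_def algebra_simps)
        have "G ?l \<bullet> relax q (c ?k) 0 (P ?k y) + \<eta> * (u - 0) \<le> G ?l \<bullet> flow ?k u (P ?k y)"
        proof (rule affine_growth_along_relax[OF u(1)])
          fix v assume v: "0 \<le> v" "v \<le> u"
          have "flow ?k v (P ?k y) = flow ?k (v + T ?k y) y" by (simp add: P_def relax_add)
          then have "dist (flow ?k v (P ?k y)) (P ?k y) \<le> 3 * V * \<bar>v + T ?k y - T ?k y\<bar>"
            unfolding dist_norm P_def using v T_pos[OF ty(2)]
            by (metis add_nonneg_nonneg flow_speed less_imp_le ty(2))
          also have "\<dots> \<le> 3 * V * ((1 + L) * a)" using v u V by (intro mult_left_mono) auto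
          also have "\<dots> < \<rho>" using a by (simp add: A_def mult.assoc)
          finally show "\<eta> \<le> G ?l \<bullet> relax_field q (c ?k) (flow ?k v (P ?k y))"
            using crossing_fields[OF P_sec[OF ty(2)]] by blast
        qed
        moreover have "flow ?k u (P ?k y) = w" by (simp add: P_def relax_add u_def ty(4))
        moreover have "0 \<le> \<eta> * u" using \<eta> u by simp
        ultimately show False using sec_gap[OF P_sec[OF ty(2)]] False by simp
      qed
      moreover have "0 \<le> \<tau> - t" using ty a T[OF x_sec[of ?k]] by (auto simp: \<tau>_def)
      ultimately show ?thesis unfolding ty(4) using ty a by (intro tubeI) auto
    qed
    with \<delta>1(1) \<delta>2(1) show ?thesis by (intro exI[of _ "min \<delta>1 \<delta>2"]) auto
  qed
  then show "z \<in> interior (tube e)" by (simp add: mem_interior)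
qed

text \<open>One period of closed arcs already covers the cycle: indices reduce modulo
  \<open>M\<close>, and the added endpoints are starting points of later arcs.\<close>

lemma compact_C: "compact C"
proof -
  have "C = (\<Union>k<M. (\<lambda>t. flow k t (x k)) ` {0..T k (x k)})"
  proof (intro equalityI subsetI)
    fix z assume "z \<in> C"
    then obtain k t where k: "z = flow k t (x k)" "0 \<le> t" "t < T k (x k)" by (auto simp: C_def)
    have "k mod M < M" "c (k mod M) = c k" "T (k mod M) = T k" "x (k mod M) = x k"
      using M periodic_mult(1,7)[of "k mod M" "k div M"] x_periodic[of "k mod M" "k div M"]
      by (simp_all add: mult.commute[of _ M])
    then show "z \<in> (\<Union>k<M. (\<lambda>t. flow k t (x k)) ` {0..T k (x k)})"
      using k by (intro UN_I[of "k mod M"]) auto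
  next
    fix z assume "z \<in> (\<Union>k<M. (\<lambda>t. flow k t (x k)) ` {0..T k (x k)})"
    then obtain k t where k: "z = flow k t (x k)" "0 \<le> t" "t \<le> T k (x k)" by auto
    show "z \<in> C"
    proof (cases "t = T k (x k)")
      case True
      then have "z = x (Suc k)" using k by (simp add: P_def)
      then show ?thesis using x_in_C[of "Suc k"] by simp
    next
      case False
      then show ?thesis
        unfolding C_def k(1) by (intro CollectI exI[of _ k] exI[of _ t]) (use k in auto)
    qed
  qed
  then show ?thesis by (auto intro!: compact_UN compact_continuous_image continuous_intros)
qed

lemma infdist_from_tube:
  assumes J: "inclusion_solution H J" and "J 0 \<in> tube e" and s: "real n * Tmax \<le> s" "0 \<le> s"
  shows "infdist (J s) C \<le> (3 * V * L + K) * (\<theta> ^ n * e)"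
proof -
  obtain k t y where kty: "y \<in> sec k" "N k (y - x k) < e" "0 \<le> t" "t < T k y" "J 0 = flow k t y"
    using assms(2) by (auto simp: tube_def)
  have "infdist (J s) C \<le> (3 * V * L + K) * (\<theta> ^ n * N k (y - x k))"
    by (rule infdist_tracking[OF J kty(1,3,4,5) s])
  also have "\<dots> \<le> (3 * V * L + K) * (\<theta> ^ n * e)"
    using V L K \<theta> kty by (intro mult_left_mono) auto
  finally show ?thesis .
qed

text \<open>By compactness some uniform neighbourhood of the cycle lies in a thin tube, and
  solutions from that tube stay within a fixed multiple of its width.\<close>

lemma lyapunov: "lyapunov_stable H C"
  unfolding lyapunov_stable_def
proof (intro allI impI)
  fix e :: real assume "0 < e"
  define D where "D = 3 * V * L + K"
  have D: "0 < D" using V L K by (simp add: D_def add_nonneg_pos)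
  define a where "a = e / (2 * D)"
  have a: "0 < a" "D * a < e" using \<open>0 < e\<close> D by (auto simp: a_def)
  obtain \<delta> where \<delta>: "0 < \<delta>" "(\<Union>z\<in>C. ball z \<delta>) \<subseteq> interior (tube a)"
    using compact_subset_open_imp_ball_epsilon_subset[OF compact_C open_interior C_interior_tube[OF a(1)]]
    by blast
  show "\<exists>\<delta>>0. \<forall>J. inclusion_solution H J \<and> infdist (J 0) C < \<delta> \<longrightarrow> (\<forall>t\<ge>0. infdist (J t) C < e)"
  proof (intro exI[of _ \<delta>] conjI allI impI \<delta>(1))
    fix J t assume J: "inclusion_solution H J \<and> infdist (J 0) C < \<delta>" and t: "(0::real) \<le> t"
    obtain z where z: "z \<in> C" "infdist (J 0) C = dist (J 0) z"
      using infdist_attains_inf[OF compact_imp_closed[OF compact_C]] x_in_C by blast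
    then have "J 0 \<in> ball z \<delta>" using J by (simp add: dist_commute)
    then have "J 0 \<in> tube a" using \<delta>(2) z interior_subset by blast
    then have "infdist (J t) C \<le> D * (\<theta> ^ 0 * a)"
      unfolding D_def using J t by (intro infdist_from_tube) auto
    then show "infdist (J t) C < e" using a by simp
  qed
qed

lemma attracting: "uniformly_attracting H C"
  unfolding uniformly_attracting_def
proof (intro exI[of _ "interior (tube 1)"] conjI allI impI)
  show "C \<subseteq> interior (tube 1)" by (rule C_interior_tube) simp
  fix e :: real assume "0 < e"
  have "(\<lambda>n. (3 * V * L + K) * (\<theta> ^ n * 1)) \<longlonglongrightarrow> (3 * V * L + K) * (0 * 1)"
    using \<theta> by (intro tendsto_intros LIMSEQ_realpow_zero) auto
  then have "\<forall>\<^sub>F n in sequentially. (3 * V * L + K) * (\<theta> ^ n * 1) < e"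
    using \<open>0 < e\<close> by (intro order_tendstoD(2)) auto
  then obtain n where n: "(3 * V * L + K) * (\<theta> ^ n * 1) < e"
    by (auto simp: eventually_sequentially)
  have "0 \<le> Tmax" using T[OF x_sec, of 0] Tmin by linarith
  show "\<exists>T\<ge>0. \<forall>J. inclusion_solution H J \<and> J 0 \<in> interior (tube 1) \<longrightarrow> (\<forall>t\<ge>T. infdist (J t) C < e)"
  proof (intro exI[of _ "real n * Tmax"] conjI allI impI)
    show T0: "0 \<le> real n * Tmax" using \<open>0 \<le> Tmax\<close> by simp
    fix J t assume J: "inclusion_solution H J \<and> J 0 \<in> interior (tube 1)" and t: "real n * Tmax \<le> t"
    have "infdist (J t) C \<le> (3 * V * L + K) * (\<theta> ^ n * 1)"
      using J t T0 interior_subset by (intro infdist_from_tube) auto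
    then show "infdist (J t) C < e" using n by simp
  qed
qed simp

subsection \<open>The periodic solution\<close>

abbreviation \<tau> where "\<tau> \<equiv> time 0 x0"

definition p :: real where "p = \<tau> M"

text \<open>\<open>LEAST\<close> selects the arc that is being traversed at time \<open>s\<close>.
  The gluing is meaningful for \<open>s \<ge> 0\<close> only; \<open>\<gamma>\<close> extends it to
  all times by reduction modulo \<open>p\<close>.\<close>

definition \<gamma>0 :: "real \<Rightarrow> real ^ 3" where
  "\<gamma>0 s = (let n = (LEAST n. s < \<tau> (Suc n)) in flow n (s - \<tau> n) (x n))"

definition \<gamma> :: "real \<Rightarrow> real ^ 3" where
  "\<gamma> t = \<gamma>0 (t - p * of_int \<lfloor>t / p\<rfloor>)"

lemma \<gamma>0_eq:
  assumes "\<tau> n \<le> s" "s \<le> \<tau> (Suc n)"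
  shows "\<gamma>0 s = flow n (s - \<tau> n) (x n)"
proof -
  have least: "(LEAST m. s < \<tau> (Suc m)) = n" if "\<tau> n \<le> s" "s < \<tau> (Suc n)" for n
  proof (rule Least_equality)
    show "s < \<tau> (Suc n)" by (rule that)
    show "n \<le> m" if "s < \<tau> (Suc m)" for m
    proof (rule ccontr)
      assume "\<not> n \<le> m"
      then have "\<tau> (Suc m) \<le> \<tau> n"
        using time_less[OF x0(1), of "Suc m" n] by (cases "Suc m = n") auto
      then show False using that \<open>\<tau> n \<le> s\<close> by linarith
    qed
  qed
  show ?thesis
  proof (cases "s < \<tau> (Suc n)")
    case True
    then show ?thesis using least[OF assms(1) True] by (simp add: \<gamma>0_def Let_def)
  next
    case False
    then have s: "s = \<tau> (Suc n)" using assms by simp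
    then have "s < \<tau> (Suc (Suc n))" using time_less[OF x0(1), of "Suc n" "Suc (Suc n)"] by simp
    then have "(LEAST m. s < \<tau> (Suc m)) = Suc n" using s by (intro least) auto
    then have "\<gamma>0 s = x (Suc n)" unfolding \<gamma>0_def Let_def using s by simp
    then show ?thesis using s by (simp add: P_def)
  qed
qed

lemma \<tau>_nonneg: "0 \<le> \<tau> n"
  using time_ge[OF x0(1), of n] Tmin by (meson mult_nonneg_nonneg less_imp_le of_nat_0_le_iff order_trans)

lemma p_pos: "0 < p"
  using time_less[OF x0(1) M] by (simp add: p_def)

lemma \<tau>_periodic: "\<tau> (n + j * M) = \<tau> n + j * p"
proof -
  have step: "\<tau> (n + M) = \<tau> n + p" for n
  proof (induction n)
    case (Suc n)
    have "\<tau> (Suc n + M) = \<tau> (n + M) + T (n + M) (x (n + M))" by simp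
    also have "T (n + M) (x (n + M)) = T n (x n)"
      using periodic(7)[of n] x_periodic[of n 1] by simp
    finally show ?case using Suc by simp
  qed (simp add: p_def)
  show ?thesis
  proof (induction j)
    case (Suc j)
    have "\<tau> (n + Suc j * M) = \<tau> (n + j * M + M)" by (simp add: algebra_simps)
    also have "\<dots> = \<tau> n + j * p + p" unfolding step Suc ..
    finally show ?case by (simp add: algebra_simps)
  qed simp
qed

lemma \<gamma>0_periodic:
  assumes "0 \<le> s"
  shows "\<gamma>0 (s + real j * p) = \<gamma>0 s"
proof -
  obtain n where n: "\<tau> n \<le> s" "s < \<tau> (Suc n)" using time_index[OF x0(1) assms] by blast
  have "\<gamma>0 (s + real j * p) = flow (n + j * M) (s + real j * p - \<tau> (n + j * M)) (x (n + j * M))"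
    using n \<tau>_periodic[of n j] \<tau>_periodic[of "Suc n" j] by (intro \<gamma>0_eq) auto
  also have "\<dots> = flow n (s - \<tau> n) (x n)"
    by (simp add: \<tau>_periodic x_periodic periodic_mult)
  also have "\<dots> = \<gamma>0 s" using n by (intro \<gamma>0_eq[symmetric]) auto
  finally show ?thesis .
qed

text \<open>Replaces the floor by any number of periods large enough to reach nonnegative time,
  which is the form used from here on.\<close>

lemma \<gamma>_eq:
  assumes "0 \<le> t + real m * p"
  shows "\<gamma> t = \<gamma>0 (t + real m * p)"
proof -
  define s where "s = t - p * of_int \<lfloor>t / p\<rfloor>"
  have s: "0 \<le> s"
  proof -
    have "p * of_int \<lfloor>t / p\<rfloor> \<le> p * (t / p)" using p_pos by (intro mult_left_mono) auto
    also have "\<dots> = t" using p_pos by simp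
    finally show ?thesis by (simp add: s_def)
  qed
  have "of_int (- int m) \<le> t / p" using assms p_pos by (simp add: field_simps)
  then have nn: "0 \<le> \<lfloor>t / p\<rfloor> + int m" unfolding le_floor_iff[symmetric] by simp
  define j where "j = nat (\<lfloor>t / p\<rfloor> + int m)"
  have j: "real j = of_int \<lfloor>t / p\<rfloor> + real m" using nn by (simp add: j_def)
  have eq: "t + real m * p = s + real j * p" unfolding j s_def by (simp add: algebra_simps)
  show ?thesis unfolding eq \<gamma>0_periodic[OF s] by (simp add: \<gamma>_def s_def)
qed

lemma shift_nonneg: "\<exists>m. 0 \<le> t + real m * p"
proof -
  obtain m :: nat where "- t < real m * p" using reals_Archimedean3[OF p_pos] by blast
  then show ?thesis by (intro exI[of _ m]) linarith
qed

lemma \<gamma>_periodic: "\<gamma> (t + p) = \<gamma> t"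
proof -
  obtain m where m: "0 \<le> t + real m * p" using shift_nonneg by blast
  have "\<gamma> (t + p) = \<gamma>0 (t + p + real m * p)" using m p_pos by (intro \<gamma>_eq) simp
  also have "\<dots> = \<gamma>0 (t + real (Suc m) * p)" by (simp add: algebra_simps)
  also have "\<dots> = \<gamma> t" using m p_pos by (intro \<gamma>_eq[symmetric]) (simp add: algebra_simps)
  finally show ?thesis .
qed

lemma \<gamma>_knots:
  assumes "\<tau> n \<le> t" "t \<le> \<tau> (Suc n)"
  shows "\<gamma> t = flow n (t - \<tau> n) (x n)"
  using \<gamma>_eq[of t 0] \<gamma>0_eq[OF assms] assms \<tau>_nonneg[of n] by simp

lemma \<gamma>_arc:
  "\<exists>n a. a \<le> t \<and> t < a + T n (x n) \<and> (\<forall>s\<in>{a..a + T n (x n)}. \<gamma> s = flow n (s - a) (x n))"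
proof -
  obtain m where m: "0 \<le> t + real m * p" using shift_nonneg by blast
  obtain n where n: "\<tau> n \<le> t + real m * p" "t + real m * p < \<tau> (Suc n)"
    using time_index[OF x0(1) m] by blast
  show ?thesis
  proof (intro exI[of _ n] exI[of _ "\<tau> n - real m * p"] conjI ballI)
    fix s assume s: "s \<in> {\<tau> n - real m * p..\<tau> n - real m * p + T n (x n)}"
    then have "\<tau> n \<le> s + real m * p" "s + real m * p \<le> \<tau> (Suc n)" by auto
    moreover have "0 \<le> s + real m * p" using s \<tau>_nonneg[of n] by auto
    ultimately show "\<gamma> s = flow n (s - (\<tau> n - real m * p)) (x n)"
      using \<gamma>_eq \<gamma>0_eq by (simp add: algebra_simps)
  qed (use n in auto)
qed

lemma range_\<gamma>: "range \<gamma> = C"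
proof (intro equalityI subsetI)
  fix z assume "z \<in> range \<gamma>"
  then obtain t where t: "z = \<gamma> t" by blast
  obtain n a where "a \<le> t" "t < a + T n (x n)"
    "\<forall>s\<in>{a..a + T n (x n)}. \<gamma> s = flow n (s - a) (x n)"
    using \<gamma>_arc[of t] by blast
  then show "z \<in> C" unfolding C_def t by (intro CollectI exI[of _ n] exI[of _ "t - a"]) auto
next
  fix z assume "z \<in> C"
  then obtain k t where k: "z = flow k t (x k)" "0 \<le> t" "t < T k (x k)" by (auto simp: C_def)
  then have "\<gamma> (\<tau> k + t) = z" using \<gamma>_knots[of k "\<tau> k + t"] by simp
  then show "z \<in> range \<gamma>" by blast
qed

text \<open>Induction on the arc that contains the later time: the interval is split at the last
  knot, and the speed bound of single arcs adds up.\<close>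

lemma \<gamma>0_Lipschitz:
  assumes "0 \<le> u" "u \<le> v" "\<tau> n \<le> v" "v \<le> \<tau> (Suc n)"
  shows "norm (\<gamma>0 v - \<gamma>0 u) \<le> 3 * V * (v - u)"
  using assms
proof (induction n arbitrary: v)
  case 0
  then have "\<gamma>0 v = flow 0 v x0" "\<gamma>0 u = flow 0 u x0" using \<gamma>0_eq[of 0 v] \<gamma>0_eq[of 0 u] by auto
  then show ?case using flow_speed[OF x0(1), of v u] 0 by simp
next
  case (Suc n)
  have same: "norm (\<gamma>0 v - \<gamma>0 u) \<le> 3 * V * (v - u)" if "\<tau> (Suc n) \<le> u" "u \<le> v" for u
  proof -
    have "\<gamma>0 v = flow (Suc n) (v - \<tau> (Suc n)) (x (Suc n))" "\<gamma>0 u = flow (Suc n) (u - \<tau> (Suc n)) (x (Suc n))"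
      using that Suc.prems by (intro \<gamma>0_eq; linarith)+
    then show ?thesis
      using flow_speed[OF x_sec[of "Suc n"], of "v - \<tau> (Suc n)" "u - \<tau> (Suc n)"] that Suc.prems by auto
  qed
  show ?case
  proof (cases "\<tau> (Suc n) \<le> u")
    case True
    then show ?thesis using same Suc.prems by simp
  next
    case False
    let ?w = "\<tau> (Suc n)"
    have "norm (\<gamma>0 ?w - \<gamma>0 u) \<le> 3 * V * (?w - u)"
      using False Suc.prems time_less[OF x0(1), of n "Suc n"] by (intro Suc.IH) auto
    moreover have "norm (\<gamma>0 v - \<gamma>0 ?w) \<le> 3 * V * (v - ?w)" using Suc.prems by (intro same) auto
    moreover have "norm (\<gamma>0 v - \<gamma>0 u) \<le> norm (\<gamma>0 v - \<gamma>0 ?w) + norm (\<gamma>0 ?w - \<gamma>0 u)"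
      using norm_triangle_ineq[of "\<gamma>0 v - \<gamma>0 ?w" "\<gamma>0 ?w - \<gamma>0 u"] by simp
    ultimately have "norm (\<gamma>0 v - \<gamma>0 u) \<le> 3 * V * (v - ?w) + 3 * V * (?w - u)" by linarith
    then show ?thesis by (simp add: algebra_simps)
  qed
qed

lemma \<gamma>_Lipschitz:
  assumes "u \<le> v"
  shows "norm (\<gamma> v - \<gamma> u) \<le> 3 * V * (v - u)"
proof -
  obtain m where m: "0 \<le> u + real m * p" using shift_nonneg by blast
  then have m': "0 \<le> v + real m * p" using assms by simp
  then obtain n where "\<tau> n \<le> v + real m * p" "v + real m * p < \<tau> (Suc n)"
    using time_index[OF x0(1)] by blast
  then have "norm (\<gamma>0 (v + real m * p) - \<gamma>0 (u + real m * p)) \<le> 3 * V * (v + real m * p - (u + real m * p))"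
    using m assms by (intro \<gamma>0_Lipschitz) auto
  then show ?thesis using \<gamma>_eq[OF m] \<gamma>_eq[OF m'] by simp
qed

lemma continuous_\<gamma>: "continuous_on A \<gamma>"
proof -
  have "dist (\<gamma> s) (\<gamma> t) \<le> (3 * V) * dist s t" for s t
    using \<gamma>_Lipschitz[of s t] \<gamma>_Lipschitz[of t s]
    by (cases "s \<le> t") (auto simp: dist_norm norm_minus_commute abs_if)
  then have "(3 * V)-lipschitz_on A \<gamma>" using V by (intro lipschitz_onI) auto
  then show ?thesis by (rule lipschitz_on_continuous_on)
qed

lemma \<gamma>_off_ties:
  assumes "\<gamma> t \<notin> S"
  obtains n where "\<gamma> t \<in> R n" "(\<gamma> has_vector_derivative relax_field q (c n) (\<gamma> t)) (at t)"
proof -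
  obtain n a where a: "a \<le> t" "t < a + T n (x n)"
    "\<forall>s\<in>{a..a + T n (x n)}. \<gamma> s = flow n (s - a) (x n)"
    using \<gamma>_arc[of t] by blast
  have "\<gamma> a = x n" using a by simp
  then have "a \<noteq> t" using assms sec_S[of n] x_sec[of n] by auto
  then have at: "a < t" using a by simp
  have \<gamma>t: "\<gamma> t = flow n (t - a) (x n)" using a by simp
  then have "\<gamma> t \<in> R n" using arc_R[OF x_sec[of n], of "t - a"] at a by simp
  moreover have "((\<lambda>s. flow n (s - a) (x n)) has_vector_derivative relax_field q (c n) (\<gamma> t)) (at t)"
  proof -
    have "((\<lambda>s. flow n s (x n)) \<circ> (\<lambda>s. s - a) has_vector_derivative 1 *\<^sub>R relax_field q (c n) (flow n (t - a) (x n))) (at t)"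
      by (rule vector_diff_chain_at) (auto intro!: derivative_eq_intros relax_deriv)
    then show ?thesis by (simp add: o_def \<gamma>t)
  qed
  then have "(\<gamma> has_vector_derivative relax_field q (c n) (\<gamma> t)) (at t)"
    by (rule has_vector_derivative_transform_within_open[where S = "{a<..<a + T n (x n)}"])
      (use at a in auto)
  ultimately show thesis by (rule that)
qed

text \<open>Between two knots the curve runs through a region, which is disjoint from
  \<open>S\<close>, and knots are at least \<open>Tmin\<close> apart.\<close>

lemma ties_separated:
  assumes "\<gamma> u \<in> S" "\<gamma> v \<in> S" "\<bar>u - v\<bar> < Tmin"
  shows "u = v"
proof -
  have no: False if uv: "u < v" "\<gamma> u \<in> S" "\<gamma> v \<in> S" "v - u < Tmin" for u v
  proof -
    obtain n a where a: "a \<le> u" "u < a + T n (x n)"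
      "\<forall>s\<in>{a..a + T n (x n)}. \<gamma> s = flow n (s - a) (x n)"
      using \<gamma>_arc[of u] by blast
    have in_R: "\<gamma> s \<notin> S" if "a < s" "s < a + T n (x n)" for s
      using bspec[OF a(3), of s] that arc_R[OF x_sec[of n], of "s - a"] R_S[of n] by auto
    then have "a = u" using uv a by force
    then have "v < a + T n (x n)" using uv T[OF x_sec[of n]] by linarith
    then show False using in_R[of v] uv \<open>a = u\<close> by simp
  qed
  show ?thesis using no[of u v] no[of v u] assms by (cases u v rule: linorder_cases) auto
qed

lemma ties_uniform_discrete: "uniform_discrete {t. \<gamma> t \<in> S}"
  unfolding uniform_discrete_def
  by (intro exI[of _ Tmin]) (use Tmin ties_separated in \<open>auto simp: dist_real_def\<close>)

lemma finite_ties: "finite {t \<in> {a..b}. \<gamma> t \<in> S}"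
proof -
  have "uniform_discrete {t \<in> {a..b}. \<gamma> t \<in> S}"
    by (rule uniform_discrete_subset[OF ties_uniform_discrete]) auto
  moreover have "bounded {t \<in> {a..b}. \<gamma> t \<in> S}" by (rule bounded_subset[of "{a..b}"]) auto
  ultimately show ?thesis using uniform_discrete_finite_iff by blast
qed

lemma \<gamma>_piecewise_C1: "\<gamma> piecewise_C1_differentiable_on {a..b}"
proof -
  \<comment> \<open>One formula for the derivative off the ties; near each such time it coincides
    with a single continuous relaxation field.\<close>
  define D where "D = (\<lambda>t. the_elem (H (\<gamma> t)))"
  have D: "(\<gamma> has_vector_derivative D t) (at t)" "isCont D t" if t: "\<gamma> t \<notin> S" for t
  proof -
    obtain n where n: "\<gamma> t \<in> R n" "(\<gamma> has_vector_derivative relax_field q (c n) (\<gamma> t)) (at t)"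
      using \<gamma>_off_ties[OF t] by blast
    have D_eq: "D s = relax_field q (c n) (\<gamma> s)" if "\<gamma> s \<in> R n" for s
      using H_R[OF that] by (simp add: D_def)
    show "(\<gamma> has_vector_derivative D t) (at t)" using n D_eq by simp
    have cont: "continuous_on UNIV (\<lambda>s. relax_field q (c n) (\<gamma> s))"
      by (intro continuous_intros continuous_\<gamma>)
    have "open (\<gamma> -` R n)" using open_R by (rule open_vimage) (rule continuous_\<gamma>)
    then have "\<forall>\<^sub>F s in nhds t. s \<in> \<gamma> -` R n" using n by (intro eventually_nhds_in_open) auto
    then have "\<forall>\<^sub>F s in nhds t. D s = relax_field q (c n) (\<gamma> s)"
      by eventually_elim (simp add: D_eq)
    moreover have "isCont (\<lambda>s. relax_field q (c n) (\<gamma> s)) t"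
      using cont by (simp add: continuous_on_eq_continuous_at)
    ultimately show "isCont D t" by (simp add: isCont_cong)
  qed
  have "\<gamma> C1_differentiable_on ({a..b} - {t \<in> {a..b}. \<gamma> t \<in> S})"
    unfolding C1_differentiable_on_def
    by (intro exI[of _ D] conjI ballI continuous_at_imp_continuous_on) (auto intro: D)
  then show ?thesis
    unfolding piecewise_C1_differentiable_on_def using continuous_\<gamma> finite_ties by blast
qed

lemma negligible_ties: "negligible {t. \<gamma> (t + a) \<in> S}"
proof -
  have "{t. \<gamma> (t + a) \<in> S} \<subseteq> (\<Union>n::nat. (\<lambda>t. t - a) ` {t \<in> {- real n..real n}. \<gamma> t \<in> S})"
  proof
    fix t assume "t \<in> {t. \<gamma> (t + a) \<in> S}"
    moreover obtain n :: nat where "\<bar>t + a\<bar> \<le> real n" using real_arch_simple by blast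
    ultimately show "t \<in> (\<Union>n::nat. (\<lambda>t. t - a) ` {t \<in> {- real n..real n}. \<gamma> t \<in> S})"
      by (intro UN_I[of n] image_eqI[of _ _ "t + a"]) auto
  qed
  moreover have "negligible (\<Union>n::nat. (\<lambda>t. t - a) ` {t \<in> {- real n..real n}. \<gamma> t \<in> S})"
    by (rule negligible_countable_Union) (auto intro!: negligible_finite finite_imageI finite_ties simp del: atLeastAtMost_iff)
  ultimately show ?thesis by (rule negligible_subset[rotated])
qed

text \<open>The shift \<open>a\<close> makes every point of the cycle an initial point, so that each
  point is also reached from the cycle after any given time.\<close>

lemma \<gamma>_solution: "inclusion_solution H (\<lambda>t. \<gamma> (t + a))"
  unfolding inclusion_solution_def
proof (intro conjI allI impI)
  fix b :: real
  show "absolutely_continuous_on 0 b (\<lambda>t. \<gamma> (t + a))"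
  proof (rule Lipschitz_imp_absolutely_continuous_on)
    fix u v :: real assume "u \<le> v"
    then show "dist (\<gamma> (u + a)) (\<gamma> (v + a)) \<le> 3 * V * (v - u)"
      using \<gamma>_Lipschitz[of "u + a" "v + a"] by (simp add: dist_norm norm_minus_commute)
  qed (use V in simp)
next
  have "AE t in lebesgue. t \<notin> {t. \<gamma> (t + a) \<in> S}"
    using negligible_ties[of a] by (intro AE_not_in) (simp add: negligible_iff_null_sets)
  then show "AE t in lebesgue. 0 \<le> t \<longrightarrow>
      (\<exists>v\<in>H (\<gamma> (t + a)). ((\<lambda>t. \<gamma> (t + a)) has_vector_derivative v) (at t))"
  proof eventually_elim
    case (elim t)
    then obtain n where n: "\<gamma> (t + a) \<in> R n"
      "(\<gamma> has_vector_derivative relax_field q (c n) (\<gamma> (t + a))) (at (t + a))"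
      using \<gamma>_off_ties[of "t + a"] by auto
    have "(\<gamma> \<circ> (\<lambda>t. t + a) has_vector_derivative 1 *\<^sub>R relax_field q (c n) (\<gamma> (t + a))) (at t)"
      by (rule vector_diff_chain_at) (auto intro!: derivative_eq_intros n)
    then show ?case using H_R[OF n(1)] by (simp add: o_def)
  qed
qed

text \<open>A solution that starts on the cycle stays arbitrarily close to it by Lyapunov stability,
  hence on it by closedness. Conversely the periodic solution, started \<open>t\<close> earlier,
  ends at the prescribed point.\<close>

lemma invariant: "invariant_set H C"
  unfolding invariant_set_def
proof (intro allI impI equalityI subsetI)
  fix t :: real and z assume t: "0 \<le> t" and "z \<in> reachable H t C"
  then obtain J where J: "inclusion_solution H J" "J 0 \<in> C" "z = J t" by (auto simp: reachable_def)
  have "infdist z C \<le> 0 + e" if "0 < e" for e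
  proof -
    obtain \<delta> where "0 < \<delta>" "\<And>J. inclusion_solution H J \<and> infdist (J 0) C < \<delta> \<Longrightarrow> \<forall>t\<ge>0. infdist (J t) C < e"
      using lyapunov \<open>0 < e\<close> unfolding lyapunov_stable_def by metis
    then show ?thesis using J t by force
  qed
  then have "infdist z C = 0" using infdist_nonneg[of z C] by (meson field_le_epsilon order_antisym)
  then show "z \<in> C"
    using in_closed_iff_infdist_zero[OF compact_imp_closed[OF compact_C]] x_in_C by blast
next
  fix t :: real and z assume t: "0 \<le> t" and "z \<in> C"
  then obtain s where "z = \<gamma> s" using range_\<gamma> by blast
  then have "z = \<gamma> (t + (s - t))" "\<gamma> (0 + (s - t)) \<in> C" using range_\<gamma> by auto
  then show "z \<in> reachable H t C"
    unfolding reachable_def using \<gamma>_solution[of "s - t"]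
    by (intro CollectI exI[of _ "\<lambda>u. \<gamma> (u + (s - t))"]) auto
qed

lemma strict_attractor: "strict_local_attractor H C"
  unfolding strict_local_attractor_def
  using compact_C x_in_C invariant lyapunov attracting by blast

theorem attracting_cycle:
  "\<exists>J p. 0 < p \<and> (\<forall>t. J (t + p) = J t) \<and> \<not> J constant_on UNIV \<and>
     (\<exists>\<tau> :: nat \<Rightarrow> real. \<tau> M = \<tau> 0 + p \<and> (\<forall>k\<le>M. J (\<tau> k) \<in> S) \<and>
        (\<forall>k<M. \<tau> k < \<tau> (Suc k) \<and> (\<forall>t\<in>{\<tau> k<..<\<tau> (Suc k)}. J t \<in> R k))) \<and>
     (\<forall>a b. J piecewise_C1_differentiable_on {a..b}) \<and>
     (\<forall>t. J t \<notin> S \<longrightarrow> (\<exists>n. J t \<in> R n \<and> (J has_vector_derivative relax_field q (c n) (J t)) (at t))) \<and>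
     discrete {t. J t \<in> S} \<and> strict_local_attractor H (range J)"
proof (intro exI[of _ \<gamma>] exI[of _ p] conjI allI impI)
  have knot: "\<gamma> (\<tau> k) \<in> S" for k
    using \<gamma>_knots[of k "\<tau> k"] time_less[OF x0(1), of k "Suc k"] x_sec[of k] sec_S[of k] by auto
  have between: "\<gamma> t \<in> R k" if "\<tau> k < t" "t < \<tau> (Suc k)" for k t
    using \<gamma>_knots[of k t] arc_R[OF x_sec[of k], of "t - \<tau> k"] that by simp
  show "\<exists>\<tau> :: nat \<Rightarrow> real. \<tau> M = \<tau> 0 + p \<and> (\<forall>k\<le>M. \<gamma> (\<tau> k) \<in> S) \<and>
      (\<forall>k<M. \<tau> k < \<tau> (Suc k) \<and> (\<forall>t\<in>{\<tau> k<..<\<tau> (Suc k)}. \<gamma> t \<in> R k))"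
    by (intro exI[of _ \<tau>]) (use knot between time_less[OF x0(1)] in \<open>auto simp: p_def simp del: time.simps(2)\<close>)
  show "\<not> \<gamma> constant_on UNIV"
  proof
    assume "\<gamma> constant_on UNIV"
    then have "\<gamma> (\<tau> 0) = \<gamma> (\<tau> 1 / 2)" by (auto simp: constant_on_def)
    moreover have "\<tau> 0 < \<tau> 1" using time_less[OF x0(1), of 0 1] by simp
    then have "\<gamma> (\<tau> 1 / 2) \<in> R 0" by (intro between) auto
    ultimately show False using knot[of 0] R_S[of 0] by auto
  qed
  show "\<exists>n. \<gamma> t \<in> R n \<and> (\<gamma> has_vector_derivative relax_field q (c n) (\<gamma> t)) (at t)" if "\<gamma> t \<notin> S" for t
    using \<gamma>_off_ties[OF that] by blast
  show "discrete {t. \<gamma> t \<in> S}" by (rule uniform_discrete_imp_discrete[OF ties_uniform_discrete])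
  show "strict_local_attractor H (range \<gamma>)" unfolding range_\<gamma> by (rule strict_attractor)
qed (use p_pos \<gamma>_periodic \<gamma>_piecewise_C1 in auto)

end

section \<open>A certificate for one arc\<close>

definition normal :: "3 \<Rightarrow> real ^ 3" where
  "normal i = discount *\<^sub>R (trans i 1 - trans i 0)"

definition offset :: "3 \<Rightarrow> real" where
  "offset i = cost i 1 - cost i 0"

lemma q_gap_eq: "q_gap J i = offset i + normal i \<bullet> J"
  by (simp add: q_gap_def q_factor_def offset_def normal_def inner_vec_def sum_subtractf
      algebra_simps sum_distrib_left)

lemma q_gap_diff: "q_gap y i - q_gap z i = normal i \<bullet> (y - z)"
  by (simp add: q_gap_eq inner_diff_right)

text \<open>With \<open>x = exp (- 0.02 * t)\<close> the three coordinates relax by the factors \<open>x\<close>, \<open>x ^ 9\<close>,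
  \<open>x ^ 40\<close>, since the update rates are \<open>0.02\<close>, \<open>0.18\<close>, \<open>0.80\<close>.\<close>

definition expo :: "3 \<Rightarrow> nat" where
  "expo j = (if j = 1 then 1 else if j = 2 then 9 else 40)"

definition pflow :: "real ^ 3 \<Rightarrow> real ^ 3 \<Rightarrow> real \<Rightarrow> real ^ 3" where
  "pflow c y x = (\<chi> j. c $ j + (y $ j - c $ j) * x ^ expo j)"

lemma pflow_1 [simp]: "pflow c y 1 = y"
  by (simp add: pflow_def vec_eq_iff)

section \<open>Componentwise enclosures of the flow\<close>

definition near :: "real ^ 3 \<Rightarrow> real ^ 3 \<Rightarrow> real ^ 3 \<Rightarrow> bool" where
  "near \<epsilon> a b \<longleftrightarrow> (\<forall>j. \<bar>b $ j - a $ j\<bar> \<le> \<epsilon> $ j)"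

definition abs_inner :: "real ^ 3 \<Rightarrow> real ^ 3 \<Rightarrow> real" where
  "abs_inner a b = (\<Sum>j\<in>UNIV. \<bar>a $ j\<bar> * b $ j)"

lemma near_inner:
  assumes "near \<epsilon> a b"
  shows "\<bar>p \<bullet> b - p \<bullet> a\<bar> \<le> abs_inner p \<epsilon>"
proof -
  have "\<bar>p \<bullet> (b - a)\<bar> \<le> (\<Sum>j\<in>UNIV. \<bar>p $ j * (b $ j - a $ j)\<bar>)"
    unfolding inner_vec_def by (simp add: sum_abs)
  also have "\<dots> \<le> abs_inner p \<epsilon>"
    unfolding abs_inner_def using assms by (intro sum_mono) (auto simp: abs_mult near_def mult_left_mono)
  finally show ?thesis by (simp add: inner_diff_right)
qed

lemma near_pflow:
  assumes y: "near \<epsilon> Y y" and c: "near \<epsilon> C c" and x: "0 \<le> x" "x \<le> 1"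
  shows "near \<epsilon> (pflow C Y x) (pflow c y x)"
  unfolding near_def
proof
  fix j
  define p where "p = x ^ expo j"
  have p: "0 \<le> p" "p \<le> 1" using x by (auto simp: p_def power_le_one)
  have "pflow c y x $ j - pflow C Y x $ j = (c $ j - C $ j) * (1 - p) + (y $ j - Y $ j) * p"
    by (simp add: pflow_def p_def algebra_simps)
  also have "\<bar>\<dots>\<bar> \<le> \<epsilon> $ j * (1 - p) + \<epsilon> $ j * p"
    using y c p unfolding near_def
    by (intro order.trans[OF abs_triangle_ineq] add_mono) (auto simp: abs_mult mult_right_mono)
  finally show "\<bar>pflow c y x $ j - pflow C Y x $ j\<bar> \<le> \<epsilon> $ j" by (simp add: algebra_simps)
qed

text \<open>The slope is the polynomial quotient of \<open>u ^ m - v ^ m\<close> by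
  \<open>u - v\<close>, a sum of \<open>m\<close> monomials of degree \<open>m - 1\<close>; in this
  form \<open>u = v\<close> is no special case.\<close>

lemma power_secant:
  fixes u v lo hi :: real
  assumes "0 \<le> lo" "lo \<le> u" "u \<le> hi" "lo \<le> v" "v \<le> hi"
  shows "\<exists>\<sigma>. real m * lo ^ (m - 1) \<le> \<sigma> \<and> \<sigma> \<le> real m * hi ^ (m - 1) \<and> u ^ m - v ^ m = (u - v) * \<sigma>"
proof (intro exI conjI)
  let ?\<sigma> = "\<Sum>i<m. v ^ (m - Suc i) * u ^ i"
  show "u ^ m - v ^ m = (u - v) * ?\<sigma>" by (rule power_diff_sumr2)
  have *: "lo ^ (m - 1) \<le> v ^ (m - Suc i) * u ^ i" "v ^ (m - Suc i) * u ^ i \<le> hi ^ (m - 1)" if "i < m" for i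
  proof -
    have m: "m - 1 = (m - Suc i) + i" using that by simp
    show "lo ^ (m - 1) \<le> v ^ (m - Suc i) * u ^ i" "v ^ (m - Suc i) * u ^ i \<le> hi ^ (m - 1)"
      unfolding m power_add using assms by (intro mult_mono power_mono; force)+
  qed
  show "real m * lo ^ (m - 1) \<le> ?\<sigma>"
    using sum_bounded_below[of "{..<m}" "lo ^ (m - 1)" "\<lambda>i. v ^ (m - Suc i) * u ^ i"] * by auto
  show "?\<sigma> \<le> real m * hi ^ (m - 1)"
    using sum_bounded_above[of "{..<m}" "\<lambda>i. v ^ (m - Suc i) * u ^ i" "hi ^ (m - 1)"] * by auto
qed

text \<open>Fixed-point arithmetic with 36 binary digits; \<open>r\<close> is \<open>0\<close> for rounding down and \<open>1\<close> for rounding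
  up. Rounding keeps the numerals short, and \<open>drop_bit\<close> avoids the division of numerals.\<close>

definition fx :: "int \<Rightarrow> real" where "fx m = of_int m / 2 ^ 36"

fun ipow :: "int \<Rightarrow> int \<Rightarrow> nat \<Rightarrow> int" where
  "ipow r m n = (if n = 0 then 68719476736 else if even n then drop_bit 36 ((ipow r m (n div 2))\<^sup>2) + r
     else drop_bit 36 (m * ipow r m (n - 1)) + r)"

declare ipow.simps [simp del]

definition pow_dn :: "int \<Rightarrow> nat \<Rightarrow> real" where "pow_dn m n = fx (ipow 0 m n)"
definition pow_up :: "int \<Rightarrow> nat \<Rightarrow> real" where "pow_up m n = fx (ipow 1 m n)"

lemma fx_le_iff [simp]: "fx a \<le> fx b \<longleftrightarrow> a \<le> b" and fx_less_iff [simp]: "fx a < fx b \<longleftrightarrow> a < b"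
  by (simp_all add: fx_def divide_le_cancel divide_less_cancel)

lemma fx_nonneg [simp]: "0 \<le> fx a \<longleftrightarrow> 0 \<le> a"
  by (simp add: fx_def zero_le_divide_iff)

lemma fx_one [simp]: "fx 68719476736 = 1"
  by (simp add: fx_def)

text \<open>Dropping 36 bits is the floor of division by \<open>2 ^ 36\<close>, so one more unit
  gives an upper bound.\<close>

lemma fx_drop_bit_mult:
  "fx (drop_bit 36 (a * b)) \<le> fx a * fx b" "fx a * fx b \<le> fx (drop_bit 36 (a * b) + 1)"
proof -
  have d: "drop_bit 36 (a * b) = a * b div 2 ^ 36" by (simp add: drop_bit_eq_div)
  have "real_of_int (a * b div 2 ^ 36) \<le> real_of_int (a * b) / real_of_int (2 ^ 36)"
    by (rule real_of_int_div4)
  then show "fx (drop_bit 36 (a * b)) \<le> fx a * fx b"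
    unfolding d fx_def by (simp add: field_simps)
  have "real_of_int (a * b) / real_of_int (2 ^ 36) - real_of_int (a * b div 2 ^ 36) \<le> 1"
    by (rule real_of_int_div3)
  then show "fx a * fx b \<le> fx (drop_bit 36 (a * b) + 1)"
    unfolding d fx_def by (simp add: field_simps)
qed

lemma even_power_half: "even n \<Longrightarrow> ((x :: real) ^ (n div 2))\<^sup>2 = x ^ n"
  by (simp flip: power_mult)

lemma ipow_bounds:
  assumes "0 \<le> m"
  shows "0 \<le> ipow 0 m n \<and> fx (ipow 0 m n) \<le> fx m ^ n \<and> fx m ^ n \<le> fx (ipow 1 m n)"
proof (induction n rule: less_induct)
  case (less n)
  consider "n = 0" | "n \<noteq> 0" "even n" | "odd n" by auto
  then show ?case
  proof cases
    case 1 then show ?thesis by (simp add: ipow.simps)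
  next
    case 2
    define w where "w = (\<lambda>r. ipow r m (n div 2))"
    have IH: "0 \<le> w 0" "fx (w 0) \<le> fx m ^ (n div 2)" "fx m ^ (n div 2) \<le> fx (w 1)"
      using less.IH[of "n div 2"] 2 by (auto simp: w_def)
    have "ipow r m n = drop_bit 36 (w r * w r) + r" for r
      using 2 by (subst ipow.simps) (simp add: w_def power2_eq_square)
    moreover have "(fx (w 0))\<^sup>2 \<le> fx m ^ n" "fx m ^ n \<le> (fx (w 1))\<^sup>2"
      using power_mono[OF IH(2), of 2] power_mono[OF IH(3), of 2] IH(1) 2 assms
      by (simp_all add: even_power_half)
    ultimately show ?thesis
      using IH(1) fx_drop_bit_mult(1)[of "w 0" "w 0"] fx_drop_bit_mult(2)[of "w 1" "w 1"]
      by (simp add: power2_eq_square)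
  next
    case 3
    define w where "w = (\<lambda>r. ipow r m (n - 1))"
    have IH: "0 \<le> w 0" "fx (w 0) \<le> fx m ^ (n - 1)" "fx m ^ (n - 1) \<le> fx (w 1)"
      using less.IH[of "n - 1"] 3 by (auto simp: w_def elim: oddE)
    have "ipow r m n = drop_bit 36 (m * w r) + r" for r
      using 3 by (subst ipow.simps) (auto simp: w_def elim: oddE)
    moreover have "fx m * fx m ^ (n - 1) = fx m ^ n" using 3 by (auto elim: oddE)
    then have "fx m * fx (w 0) \<le> fx m ^ n" "fx m ^ n \<le> fx m * fx (w 1)"
      using mult_left_mono[OF IH(2), of "fx m"] mult_left_mono[OF IH(3), of "fx m"] assms by simp_all
    ultimately show ?thesis
      using IH(1) assms fx_drop_bit_mult(1)[of m "w 0"] fx_drop_bit_mult(2)[of m "w 1"] by simp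
  qed
qed

lemma pow_dn_le: "0 \<le> m \<Longrightarrow> 0 \<le> pow_dn m n \<and> pow_dn m n \<le> fx m ^ n"
  and pow_up_ge: "0 \<le> m \<Longrightarrow> fx m ^ n \<le> pow_up m n"
  using ipow_bounds[of m n] by (auto simp: pow_dn_def pow_up_def)

text \<open>Enclosure, as midpoint and radius, of the secant slopes in \<open>x\<close> of the flow.\<close>

definition slope_mid :: "real ^ 3 \<Rightarrow> real ^ 3 \<Rightarrow> int \<Rightarrow> int \<Rightarrow> real ^ 3" where
  "slope_mid C Y lo hi =
     (\<chi> j. (Y $ j - C $ j) * (real (expo j) * (pow_dn lo (expo j - 1) + pow_up hi (expo j - 1)) / 2))"

definition slope_rad :: "real ^ 3 \<Rightarrow> real ^ 3 \<Rightarrow> real ^ 3 \<Rightarrow> int \<Rightarrow> int \<Rightarrow> real ^ 3" where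
  "slope_rad \<epsilon> C Y lo hi =
     (\<chi> j. \<bar>Y $ j - C $ j\<bar> * (real (expo j) * (pow_up hi (expo j - 1) - pow_dn lo (expo j - 1)) / 2)
        + 2 * \<epsilon> $ j * (real (expo j) * pow_up hi (expo j - 1)))"

text \<open>The radius has two parts: the spread of the power slopes over the window, weighted by
  \<open>Y - C\<close>, and the largest slope times \<open>2 * \<epsilon>\<close>, since both
  \<open>y\<close> and \<open>c\<close> may be off by \<open>\<epsilon>\<close>.\<close>

lemma pflow_secant:
  assumes y: "near \<epsilon> Y y" and c: "near \<epsilon> C c"
    and lo: "0 \<le> lo" and uv: "fx lo \<le> u" "u \<le> fx hi" "fx lo \<le> v" "v \<le> fx hi"
  shows "\<exists>w. near (slope_rad \<epsilon> C Y lo hi) (slope_mid C Y lo hi) w \<and>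
    pflow c y u - pflow c y v = (u - v) *\<^sub>R w"
proof -
  have "lo \<le> hi" using order.trans[OF uv(1,2)] by simp
  with lo have hi: "0 \<le> hi" by simp
  have "\<forall>j. \<exists>\<sigma>. real (expo j) * fx lo ^ (expo j - 1) \<le> \<sigma> \<and> \<sigma> \<le> real (expo j) * fx hi ^ (expo j - 1) \<and>
      u ^ expo j - v ^ expo j = (u - v) * \<sigma>"
    using power_secant[of "fx lo"] lo uv by simp
  then obtain \<sigma> where \<sigma>: "\<And>j. real (expo j) * fx lo ^ (expo j - 1) \<le> \<sigma> j"
    "\<And>j. \<sigma> j \<le> real (expo j) * fx hi ^ (expo j - 1)" "\<And>j. u ^ expo j - v ^ expo j = (u - v) * \<sigma> j"
    by metis
  define w :: "real ^ 3" where "w = (\<chi> j. (y $ j - c $ j) * \<sigma> j)"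
  have "near (slope_rad \<epsilon> C Y lo hi) (slope_mid C Y lo hi) w"
    unfolding near_def
  proof
    fix j
    define a b where "a = real (expo j) * pow_dn lo (expo j - 1)" and "b = real (expo j) * pow_up hi (expo j - 1)"
    have "a \<le> real (expo j) * fx lo ^ (expo j - 1)" "real (expo j) * fx hi ^ (expo j - 1) \<le> b"
      using pow_dn_le[OF lo, of "expo j - 1"] pow_up_ge[OF hi, of "expo j - 1"]
      by (auto simp: a_def b_def intro!: mult_left_mono)
    then have "a \<le> \<sigma> j" "\<sigma> j \<le> b" using \<sigma>(1,2)[of j] by linarith+
    moreover have "0 \<le> a" using pow_dn_le[OF lo, of "expo j - 1"] by (auto simp: a_def)
    ultimately have ab: "a \<le> \<sigma> j" "\<sigma> j \<le> b" "0 \<le> a" .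
    have "w $ j - slope_mid C Y lo hi $ j =
        (Y $ j - C $ j) * (\<sigma> j - (a + b) / 2) + ((y $ j - Y $ j) - (c $ j - C $ j)) * \<sigma> j"
      by (simp add: w_def slope_mid_def a_def b_def algebra_simps add_divide_distrib)
    also have "\<bar>\<dots>\<bar> \<le> \<bar>Y $ j - C $ j\<bar> * ((b - a) / 2) + 2 * \<epsilon> $ j * b"
    proof (rule order.trans[OF abs_triangle_ineq], rule add_mono)
      have "\<bar>\<sigma> j - (a + b) / 2\<bar> \<le> (b - a) / 2"
        using ab by (auto simp: abs_if field_simps)
      then show "\<bar>(Y $ j - C $ j) * (\<sigma> j - (a + b) / 2)\<bar> \<le> \<bar>Y $ j - C $ j\<bar> * ((b - a) / 2)"
        unfolding abs_mult by (rule mult_left_mono) simp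
      have 1: "\<bar>(y $ j - Y $ j) - (c $ j - C $ j)\<bar> \<le> 2 * \<epsilon> $ j"
        using y c unfolding near_def by (smt (verit))
      have "\<bar>((y $ j - Y $ j) - (c $ j - C $ j)) * \<sigma> j\<bar> = \<bar>(y $ j - Y $ j) - (c $ j - C $ j)\<bar> * \<sigma> j"
        using ab by (simp add: abs_mult)
      also have "\<dots> \<le> 2 * \<epsilon> $ j * b"
        using 1 ab by (intro mult_mono) auto
      finally show "\<bar>((y $ j - Y $ j) - (c $ j - C $ j)) * \<sigma> j\<bar> \<le> 2 * \<epsilon> $ j * b" .
    qed
    also have "\<dots> = slope_rad \<epsilon> C Y lo hi $ j"
      by (simp add: slope_rad_def a_def b_def algebra_simps)
    finally show "\<bar>w $ j - slope_mid C Y lo hi $ j\<bar> \<le> slope_rad \<epsilon> C Y lo hi $ j" .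
  qed
  moreover have "pflow c y u - pflow c y v = (u - v) *\<^sub>R w"
  proof -
    have "(y $ j - c $ j) * u ^ expo j - (y $ j - c $ j) * v ^ expo j = (u - v) * ((y $ j - c $ j) * \<sigma> j)" for j
      using \<sigma>(3)[of j] by (metis mult.left_commute right_diff_distrib)
    then show ?thesis by (simp add: vec_eq_iff pflow_def w_def)
  qed
  ultimately show ?thesis by blast
qed

text \<open>By Cramer's rule a row vector is a combination of \<open>la\<close>, \<open>lb\<close> and \<open>n\<close>; \<open>row_gain\<close> and
  \<open>row_defect\<close> are the absolute sums of its coefficients.\<close>

definition row_gain :: "real ^ 3 \<Rightarrow> real ^ 3 \<Rightarrow> real ^ 3 \<Rightarrow> real ^ 3 \<Rightarrow> real" where
  "row_gain la lb n p = (\<bar>p \<bullet> cross3 lb n\<bar> + \<bar>p \<bullet> cross3 n la\<bar>) / \<bar>la \<bullet> cross3 lb n\<bar>"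

definition row_defect :: "real ^ 3 \<Rightarrow> real ^ 3 \<Rightarrow> real ^ 3 \<Rightarrow> real ^ 3 \<Rightarrow> real" where
  "row_defect la lb n p = \<bar>p \<bullet> cross3 la lb\<bar> / \<bar>la \<bullet> cross3 lb n\<bar>"

lemma cramer3:
  fixes la lb n d p :: "real ^ 3"
  shows "(la \<bullet> cross3 lb n) * (p \<bullet> d) =
    (p \<bullet> cross3 lb n) * (la \<bullet> d) + (p \<bullet> cross3 n la) * (lb \<bullet> d) + (p \<bullet> cross3 la lb) * (n \<bullet> d)"
  by (simp add: cross3_def inner_vec_def sum_3 vector_3 algebra_simps)

lemma row_bound:
  assumes det: "la \<bullet> cross3 lb n \<noteq> 0"
    and "\<bar>la \<bullet> d\<bar> \<le> N" "\<bar>lb \<bullet> d\<bar> \<le> N" "\<bar>n \<bullet> d\<bar> \<le> e"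
  shows "\<bar>p \<bullet> d\<bar> \<le> row_gain la lb n p * N + row_defect la lb n p * e"
proof -
  have "\<bar>la \<bullet> cross3 lb n\<bar> * \<bar>p \<bullet> d\<bar> = \<bar>(la \<bullet> cross3 lb n) * (p \<bullet> d)\<bar>"
    by (simp add: abs_mult)
  also have "\<dots> \<le> \<bar>(p \<bullet> cross3 lb n) * (la \<bullet> d)\<bar> + \<bar>(p \<bullet> cross3 n la) * (lb \<bullet> d)\<bar> + \<bar>(p \<bullet> cross3 la lb) * (n \<bullet> d)\<bar>"
    using cramer3[of la lb n p d] by linarith
  also have "\<dots> \<le> \<bar>p \<bullet> cross3 lb n\<bar> * N + \<bar>p \<bullet> cross3 n la\<bar> * N + \<bar>p \<bullet> cross3 la lb\<bar> * e"
    using assms unfolding abs_mult by (intro add_mono mult_left_mono) auto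
  finally show ?thesis using det
    by (simp add: row_gain_def row_defect_def field_simps)
qed

definition diag_gain :: "real ^ 3 \<Rightarrow> real ^ 3 \<Rightarrow> real ^ 3 \<Rightarrow> real ^ 3 \<Rightarrow> real ^ 3 \<Rightarrow> real ^ 3 \<Rightarrow> real ^ 3 \<Rightarrow> real" where
  "diag_gain la lb n em er k p = row_gain la lb n (\<chi> j. p $ j * em $ j) + abs_inner p (\<chi> j. er $ j * k $ j)"

definition diag_defect :: "real ^ 3 \<Rightarrow> real ^ 3 \<Rightarrow> real ^ 3 \<Rightarrow> real ^ 3 \<Rightarrow> real ^ 3 \<Rightarrow> real ^ 3 \<Rightarrow> real ^ 3 \<Rightarrow> real" where
  "diag_defect la lb n em er k p = row_defect la lb n (\<chi> j. p $ j * em $ j) + abs_inner p (\<chi> j. er $ j * k $ j)"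

text \<open>With the midpoints \<open>em\<close> in place of the decay factors, the functional
  becomes one fixed row, which Cramer's rule bounds without splitting it into coordinates. Only the
  small radii \<open>er\<close> are paid for by the cruder coordinate bounds.\<close>

lemma diag_bound:
  assumes det: "la \<bullet> cross3 lb n \<noteq> 0"
    and d: "\<bar>la \<bullet> d\<bar> \<le> N" "\<bar>lb \<bullet> d\<bar> \<le> N" "\<bar>n \<bullet> d\<bar> \<le> e"
    and x: "\<And>j. \<bar>x $ j - em $ j\<bar> \<le> er $ j"
    and k: "\<And>j. row_gain la lb n (axis j 1) \<le> kg $ j" "\<And>j. row_defect la lb n (axis j 1) \<le> kd $ j"
  shows "\<bar>p \<bullet> (\<chi> j. x $ j * d $ j)\<bar> \<le>
    diag_gain la lb n em er kg p * N + diag_defect la lb n em er kd p * e"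
proof -
  define pm :: "real ^ 3" where "pm = (\<chi> j. p $ j * em $ j)"
  have N: "N \<ge> 0" and e: "e \<ge> 0" using d by linarith+
  have row: "\<bar>q \<bullet> d\<bar> \<le> row_gain la lb n q * N + row_defect la lb n q * e" for q
    by (rule row_bound[OF det d])
  have d_le: "\<bar>d $ j\<bar> \<le> kg $ j * N + kd $ j * e" for j
    using row[of "axis j 1"] mult_right_mono[OF k(1)[of j] N] mult_right_mono[OF k(2)[of j] e]
    by (simp add: inner_axis')
  have "near (\<chi> j. er $ j * kg $ j * N + er $ j * kd $ j * e)
       (\<chi> j. em $ j * d $ j) (\<chi> j. x $ j * d $ j)"
    unfolding near_def
  proof
    fix j
    have "\<bar>x $ j * d $ j - em $ j * d $ j\<bar> = \<bar>x $ j - em $ j\<bar> * \<bar>d $ j\<bar>"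
      by (simp add: abs_mult[symmetric] algebra_simps)
    also have "\<dots> \<le> er $ j * (kg $ j * N + kd $ j * e)"
      using x[of j] d_le[of j] by (intro mult_mono) auto
    finally show "\<bar>(\<chi> j. x $ j * d $ j) $ j - (\<chi> j. em $ j * d $ j) $ j\<bar>
       \<le> (\<chi> j. er $ j * kg $ j * N + er $ j * kd $ j * e) $ j"
      by (simp add: algebra_simps)
  qed
  from near_inner[OF this, of p]
  have "\<bar>p \<bullet> (\<chi> j. x $ j * d $ j)\<bar> \<le> \<bar>p \<bullet> (\<chi> j. em $ j * d $ j)\<bar> +
     abs_inner p (\<chi> j. er $ j * kg $ j * N + er $ j * kd $ j * e)"
    by linarith
  also have "p \<bullet> (\<chi> j. em $ j * d $ j) = pm \<bullet> d"
    by (simp add: pm_def inner_vec_def algebra_simps)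
  also have "abs_inner p (\<chi> j. er $ j * kg $ j * N + er $ j * kd $ j * e) =
     abs_inner p (\<chi> j. er $ j * kg $ j) * N + abs_inner p (\<chi> j. er $ j * kd $ j) * e"
    unfolding abs_inner_def sum_distrib_right sum.distrib[symmetric]
    by (intro sum.cong) (auto simp: algebra_simps)
  also note row[of pm]
  finally show ?thesis
    unfolding diag_gain_def diag_defect_def pm_def[symmetric] by (simp add: algebra_simps)
qed

text \<open>With coefficients scaled by \<open>2 ^ 20\<close>, a lower bound for \<open>\<sigma>\<close> times a gap along the flow on an
  interval of \<open>x\<close>: each monomial is monotone, hence minimal at an endpoint.\<close>

definition gap_coeffs :: "real ^ 3 \<Rightarrow> real ^ 3 \<Rightarrow> real \<Rightarrow> 3 \<Rightarrow> int \<Rightarrow> int ^ 3 \<Rightarrow> bool" where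
  "gap_coeffs C Y \<sigma> i a b \<longleftrightarrow> \<bar>\<sigma> * (offset i + normal i \<bullet> C) * 2 ^ 20 - of_int a\<bar> \<le> 1 \<and>
     (\<forall>j. \<bar>\<sigma> * normal i $ j * (Y $ j - C $ j) * 2 ^ 20 - of_int (b $ j)\<bar> \<le> 1)"

definition gap_cell :: "int \<Rightarrow> int ^ 3 \<Rightarrow> int \<Rightarrow> int \<Rightarrow> int" where
  "gap_cell a b l u = a * 68719476736 +
     (\<Sum>j\<in>UNIV. b $ j * (if b $ j \<ge> 0 then ipow 0 l (expo j) else ipow 1 u (expo j)))"

text \<open>The scale \<open>2 ^ 56\<close> combines 20 bits of the coefficients with 36 bits of the
  powers. Four coefficients are rounded, each by at most one unit \<open>1 / 2 ^ 20\<close>, and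
  every power of \<open>x\<close> is at most 1.\<close>

lemma gap_cell_le:
  assumes ab: "gap_coeffs C Y \<sigma> i a b" and x: "0 \<le> l" "fx l \<le> x" "x \<le> fx u" "x \<le> 1"
  shows "of_int (gap_cell a b l u) / 2 ^ 56 - 4 / 2 ^ 20 \<le> \<sigma> * q_gap (pflow C Y x) i"
proof -
  have x0: "0 \<le> x" using order.trans[of 0 "fx l" x] x by simp
  then have u: "0 \<le> u" using order.trans[OF x0 x(3)] by simp
  have mono: "of_int (b $ j * (if b $ j \<ge> 0 then ipow 0 l (expo j) else ipow 1 u (expo j))) / 2 ^ 56
      - 1 / 2 ^ 20 \<le> \<sigma> * normal i $ j * (Y $ j - C $ j) * x ^ expo j" for j
  proof -
    define p where "p = (if b $ j \<ge> 0 then pow_dn l (expo j) else pow_up u (expo j))"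
    have "of_int (b $ j) * p \<le> of_int (b $ j) * x ^ expo j"
    proof (cases "b $ j \<ge> 0")
      case True
      have "pow_dn l (expo j) \<le> x ^ expo j"
        using pow_dn_le[OF x(1), of "expo j"] power_mono[OF x(2), of "expo j"] x(1) by simp
      then show ?thesis using True by (simp add: p_def mult_left_mono)
    next
      case False
      have "x ^ expo j \<le> pow_up u (expo j)"
        using pow_up_ge[OF u, of "expo j"] power_mono[OF x(3) x0, of "expo j"] by linarith
      then show ?thesis using False by (simp add: p_def mult_left_mono_neg)
    qed
    moreover have "\<bar>(of_int (b $ j) - \<sigma> * normal i $ j * (Y $ j - C $ j) * 2 ^ 20) * x ^ expo j\<bar> \<le> 1 * 1"
      unfolding abs_mult using ab x x0 
      by (intro mult_mono) (auto simp: gap_coeffs_def abs_minus_commute power_le_one)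
    ultimately have "of_int (b $ j) * p - 1 \<le> \<sigma> * normal i $ j * (Y $ j - C $ j) * x ^ expo j * 2 ^ 20"
      by (simp add: algebra_simps abs_le_iff)
    then show ?thesis by (simp add: p_def pow_dn_def pow_up_def fx_def field_simps split: if_splits)
  qed
  define p where "p = (\<lambda>j. b $ j * (if b $ j \<ge> 0 then ipow 0 l (expo j) else ipow 1 u (expo j)))"
  have "real_of_int (gap_cell a b l u) / 2 ^ 56 - 4 / 2 ^ 20 =
     (of_int a - 1) / 2 ^ 20 + (\<Sum>j\<in>UNIV. of_int (p j) / 2 ^ 56 - 1 / 2 ^ 20)"
    unfolding gap_cell_def p_def[symmetric] by (simp add: sum_3 add_divide_distrib diff_divide_distrib)
  also have "\<dots> \<le> \<sigma> * (offset i + normal i \<bullet> C) +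
     (\<Sum>j\<in>UNIV. \<sigma> * normal i $ j * (Y $ j - C $ j) * x ^ expo j)"
    unfolding p_def using ab by (intro add_mono sum_mono mono) (simp add: gap_coeffs_def abs_le_iff field_simps)
  also have "\<dots> = \<sigma> * q_gap (pflow C Y x) i"
    by (simp add: q_gap_eq pflow_def inner_vec_def algebra_simps sum.distrib sum_subtractf sum_distrib_left)
  finally show ?thesis .
qed

text \<open>Consecutive breakpoints bound the cells, and \<open>m\<close> is a common
  margin.\<close>

fun cells :: "int \<Rightarrow> int ^ 3 \<Rightarrow> int \<Rightarrow> int list \<Rightarrow> bool" where
  "cells a b m (l # u # us) \<longleftrightarrow> 0 \<le> l \<and> m < gap_cell a b l u \<and> cells a b m (u # us)"
| "cells a b m _ \<longleftrightarrow> True"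

lemma cells_imp:
  assumes "cells a b m ls" "ls \<noteq> []" "fx (hd ls) \<le> x" "x < fx (last ls)" "x \<le> 1"
    and "gap_coeffs C Y \<sigma> i a b"
  shows "of_int m / 2 ^ 56 - 4 / 2 ^ 20 < \<sigma> * q_gap (pflow C Y x) i"
  using assms
proof (induction a b m ls rule: cells.induct)
  case (1 a b m l u us)
  show ?case
  proof (cases "x \<le> fx u")
    case True
    then have "of_int (gap_cell a b l u) / 2 ^ 56 - 4 / 2 ^ 20 \<le> \<sigma> * q_gap (pflow C Y x) i"
      using 1 by (intro gap_cell_le) auto
    moreover have "real_of_int m < real_of_int (gap_cell a b l u)" using 1 by simp
    ultimately show ?thesis by (simp add: field_simps)
  qed (use 1 in auto)
qed auto

definition section_box :: "3 \<Rightarrow> real ^ 3 \<Rightarrow> real ^ 3 \<Rightarrow> real ^ 3 \<Rightarrow> real \<Rightarrow> (real ^ 3) set" where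
  "section_box i Y la lb r =
     {y. q_gap y i = 0 \<and> \<bar>la \<bullet> (y - Y)\<bar> \<le> r \<and> \<bar>lb \<bullet> (y - Y)\<bar> \<le> r}"

text \<open>\<open>cost_tol\<close> is 20 times the Bellman residual \<open>1 / 2000000\<close>
  verified for the rounded costs-to-go. \<open>radius\<close> is the half-width of every box,
  measured by both functionals.\<close>

definition cost_tol :: real where "cost_tol = 1 / 100000"
definition defect :: real where "defect = 4 / 100000"
definition radius :: real where "radius = 1 / 100"

text \<open>
  An arc runs from a box on the tie plane \<open>i0\<close> around \<open>Y\<close> to a box on the tie plane \<open>i1\<close> around
  \<open>Y'\<close>, with cost-to-go near \<open>C\<close>; \<open>i2\<close> is the third state, \<open>\<sigma> i\<close> the sign of the gap at \<open>i\<close> inside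
  the arc, and \<open>[lo, hi]\<close> encloses the arrival value of \<open>x\<close>, approximated by \<open>xm\<close>. On this window
  \<open>em \<plusminus> er\<close> encloses the decay factors and \<open>wm \<plusminus> wr\<close> the slopes of the flow. Up to \<open>xs\<close> the gap at
  \<open>i0\<close> is bounded by cells, from there to the start \<open>x = 1\<close> by its slope. \<open>defect\<close> is the distance
  of the rounded centres from their tie planes.
\<close>

locale certified_arc =
  fixes \<sigma> :: "3 \<Rightarrow> real" and i0 i1 i2 :: 3 and C Y Y' \<epsilon> la lb la' lb' :: "real ^ 3"
    and em er wm wr kg kd :: "real ^ 3" and \<eta> g gd :: real
    and lo hi xs xm :: int and av mv :: "int ^ 3" and bv :: "int ^ 3 ^ 3" and cs1 cs2 :: "int list"
  assumes all_states: "\<forall>i. i = i0 \<or> i = i1 \<or> i = i2"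
    and all_sign: "\<forall>i. \<sigma> i = 1 \<or> \<sigma> i = -1"
    and order: "0 < lo" "lo \<le> xm" "xm \<le> hi" "lo < hi" "hi < 68719476736" "lo \<le> xs" "xs \<le> 68719476736"
    and det: "la \<bullet> cross3 lb (normal i0) \<noteq> 0"
    and all_coord: "\<forall>j. row_gain la lb (normal i0) (axis j 1) \<le> kg $ j"
      "\<forall>j. row_defect la lb (normal i0) (axis j 1) \<le> kd $ j"
    and all_eps: "\<forall>j. kg $ j * radius + kd $ j * defect \<le> \<epsilon> $ j"
    and all_eps_tol: "\<forall>j. cost_tol \<le> \<epsilon> $ j"
    and start: "\<bar>q_gap Y i0\<bar> \<le> defect"
    and all_coeffs: "\<forall>i. gap_coeffs C Y (\<sigma> i) i (av $ i) (bv $ i) \<and>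
      abs_inner (normal i) \<epsilon> \<le> of_int (mv $ i) / 2 ^ 56 - 4 / 2 ^ 20"
    and cells0: "cells (av $ i0) (bv $ i0) (mv $ i0) [lo, xs]"
    and cells1: "cells (av $ i1) (bv $ i1) (mv $ i1) (hi # cs1 @ [68719476736])"
    and cells2: "cells (av $ i2) (bv $ i2) (mv $ i2) (lo # cs2 @ [68719476736])"
    and lo_neg: "mv $ i1 < gap_cell (- (av $ i1)) (- (bv $ i1)) lo lo"
    and start_slope: "\<sigma> i0 * (normal i0 \<bullet> slope_mid C Y xs 68719476736) +
      abs_inner (normal i0) (slope_rad \<epsilon> C Y xs 68719476736) < 0"
    and all_slope: "\<forall>j. \<bar>slope_mid C Y lo hi $ j - wm $ j\<bar> + slope_rad \<epsilon> C Y lo hi $ j \<le> wr $ j"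
    and all_decay: "\<forall>j. em $ j - er $ j \<le> pow_dn lo (expo j) \<and> pow_up hi (expo j) \<le> em $ j + er $ j"
    and end_slope: "\<sigma> i1 * (normal i1 \<bullet> wm) - abs_inner (normal i1) wr \<ge> \<eta>" "\<eta> > 0"
    and shift_gain: "diag_gain la lb (normal i0) em er kg (normal i1) \<le> g * \<eta>" "g \<le> 1 / 10"
    and shift_defect: "diag_defect la lb (normal i0) em er kd (normal i1) + 1 \<le> gd * \<eta>" "gd \<le> 1"
    and all_contract: "\<forall>l\<in>{la', lb'}. diag_gain la lb (normal i0) em er kg l +
      (\<bar>l \<bullet> wm\<bar> + abs_inner l wr) * g \<le> 92 / 100"
    and all_contract_defect: "\<forall>l\<in>{la', lb'}. diag_defect la lb (normal i0) em er kd l +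
      (\<bar>l \<bullet> wm\<bar> + abs_inner l wr) * gd \<le> 4"
    and all_arrival: "\<forall>j. \<bar>C $ j + (Y $ j - C $ j) * pow_dn xm (expo j) - Y' $ j\<bar> +
      \<bar>Y $ j - C $ j\<bar> * (pow_up xm (expo j) - pow_dn xm (expo j)) \<le> cost_tol"
    and arrival_gap: "\<bar>q_gap Y' i1\<bar> + abs_inner (normal i1) (\<chi> j. 2 * cost_tol) \<le> defect"
    and all_arrival_centre: "\<forall>l\<in>{la', lb'}. abs_inner l (\<chi> j. 2 * cost_tol) \<le> 1 / 10000"
begin

lemmas states = all_states[rule_format]
  and sign = all_sign[rule_format]
  and coeffs = all_coeffs[rule_format]
  and coord = all_coord[rule_format]
  and slope = all_slope[rule_format]
  and decay = all_decay[rule_format]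
  and eps = all_eps[rule_format]
  and eps_tol = all_eps_tol[rule_format]
  and arrival = all_arrival[rule_format]
  and contract = all_contract[rule_format]
  and contract_defect = all_contract_defect[rule_format]
  and arrival_centre = all_arrival_centre[rule_format]

section \<open>Consequences of a certificate for every cost-to-go within the tolerance\<close>

context
  fixes c :: "real ^ 3"
  assumes c: "near (\<chi> j. cost_tol) C c"
begin

lemma window_pos: "0 < fx lo" "fx lo < fx hi" "fx hi < 1" "fx lo \<le> fx xm" "fx xm \<le> fx hi" "fx xm \<le> 1"
proof -
  show "0 < fx lo" using order(1) by (simp add: fx_def)
  show "fx hi < 1" using order fx_less_iff[of hi 68719476736] by simp
  moreover have "fx xm \<le> fx hi" using order by simp
  ultimately show "fx xm \<le> 1" by linarith
qed (use order in simp_all)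

lemma near_c: "near \<epsilon> C c"
  using c order.trans[OF _ eps_tol] by (auto simp: near_def)

lemma near_section:
  assumes "y \<in> section_box i0 Y la lb radius"
  shows "near \<epsilon> Y y"
  unfolding near_def
proof
  fix j
  have "\<bar>normal i0 \<bullet> (y - Y)\<bar> \<le> defect"
    using assms start by (simp add: section_box_def q_gap_diff[symmetric])
  then have "\<bar>axis j 1 \<bullet> (y - Y)\<bar> \<le> row_gain la lb (normal i0) (axis j 1) * radius +
      row_defect la lb (normal i0) (axis j 1) * defect"
    using assms by (intro row_bound det) (auto simp: section_box_def)
  moreover have "row_gain la lb (normal i0) (axis j 1) * radius \<le> kg $ j * radius"
    "row_defect la lb (normal i0) (axis j 1) * defect \<le> kd $ j * defect"
    using coord by (auto simp: radius_def defect_def)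
  ultimately show "\<bar>y $ j - Y $ j\<bar> \<le> \<epsilon> $ j"
    using eps[of j] by (simp add: inner_axis')
qed

lemma near_centre: "near \<epsilon> Y Y"
  using order.trans[OF _ eps_tol, of 0] by (auto simp: near_def cost_tol_def)

lemma gap_pflow_near:
  assumes "near \<epsilon> Y y" "0 \<le> x" "x \<le> 1"
  shows "\<bar>q_gap (pflow c y x) i - q_gap (pflow C Y x) i\<bar> \<le> abs_inner (normal i) \<epsilon>"
  using near_inner[OF near_pflow[OF assms(1) near_c assms(2,3)], of "normal i"]
  by (simp add: q_gap_eq)

text \<open>The cells bound the gap along the arc of the rounded centre; the margin absorbs its
  variation over the box and over the admissible costs-to-go.\<close>

lemma cells_pos:
  assumes y: "near \<epsilon> Y y" and cells: "cells (av $ i) (bv $ i) (mv $ i) ls"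
    and ls: "ls \<noteq> []" "fx (hd ls) \<le> x" "x < fx (last ls)" and x: "0 \<le> x" "x \<le> 1"
  shows "0 < \<sigma> i * q_gap (pflow c y x) i"
proof -
  have "of_int (mv $ i) / 2 ^ 56 - 4 / 2 ^ 20 < \<sigma> i * q_gap (pflow C Y x) i"
    using cells_imp[OF cells ls x(2)] coeffs by blast
  moreover have "\<bar>q_gap (pflow c y x) i - q_gap (pflow C Y x) i\<bar> \<le> abs_inner (normal i) \<epsilon>"
    using y x by (rule gap_pflow_near)
  ultimately show ?thesis using sign[of i] coeffs[of i] by auto
qed

lemma gap_secant:
  assumes "near \<epsilon> Y y" "0 \<le> l" "fx l \<le> u" "u \<le> fx h" "fx l \<le> v" "v \<le> fx h"
  shows "\<exists>s. \<bar>s - normal i \<bullet> slope_mid C Y l h\<bar> \<le> abs_inner (normal i) (slope_rad \<epsilon> C Y l h) \<and>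
    q_gap (pflow c y u) i - q_gap (pflow c y v) i = (u - v) * s"
proof -
  obtain w where w: "near (slope_rad \<epsilon> C Y l h) (slope_mid C Y l h) w"
    "pflow c y u - pflow c y v = (u - v) *\<^sub>R w"
    using pflow_secant[OF assms(1) near_c assms(2-)] by blast
  show ?thesis
    using near_inner[OF w(1), of "normal i"] by (intro exI[of _ "normal i \<bullet> w"]) (simp add: q_gap_diff w(2))
qed

lemma continuous_gap: "continuous_on A (\<lambda>x. q_gap (pflow c y x) i)"
  unfolding q_gap_eq pflow_def by (intro continuous_intros)

lemma window_secant:
  assumes "near \<epsilon> Y y" "fx lo \<le> u" "u \<le> fx hi" "fx lo \<le> v" "v \<le> fx hi"
  shows "\<exists>w. near wr wm w \<and> pflow c y u - pflow c y v = (u - v) *\<^sub>R w"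
proof -
  obtain w where w: "near (slope_rad \<epsilon> C Y lo hi) (slope_mid C Y lo hi) w"
    "pflow c y u - pflow c y v = (u - v) *\<^sub>R w"
    using pflow_secant[OF assms(1) near_c, of lo u hi v] assms order by auto
  have "near wr wm w"
    unfolding near_def
  proof
    fix j
    have "\<bar>w $ j - slope_mid C Y lo hi $ j\<bar> \<le> slope_rad \<epsilon> C Y lo hi $ j"
      using w(1) by (simp add: near_def)
    then show "\<bar>w $ j - wm $ j\<bar> \<le> wr $ j" using slope[of j] by linarith
  qed
  with w(2) show ?thesis by blast
qed

lemma window_mono:
  assumes "near \<epsilon> Y y" "fx lo \<le> v" "v < u" "u \<le> fx hi"
  shows "\<sigma> i1 * q_gap (pflow c y v) i1 < \<sigma> i1 * q_gap (pflow c y u) i1"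
proof -
  obtain w where w: "near wr wm w" "pflow c y u - pflow c y v = (u - v) *\<^sub>R w"
    using window_secant[OF assms(1), of u v] assms by auto
  define s where "s = normal i1 \<bullet> w"
  have s: "\<bar>s - normal i1 \<bullet> wm\<bar> \<le> abs_inner (normal i1) wr"
    "q_gap (pflow c y u) i1 - q_gap (pflow c y v) i1 = (u - v) * s"
    using near_inner[OF w(1), of "normal i1"] by (simp_all add: s_def q_gap_diff w(2))
  have "\<sigma> i1 * s > 0"
    using s(1) end_slope sign[of i1] by auto
  then have "0 < (u - v) * (\<sigma> i1 * s)" using assms by auto
  also have "\<dots> = \<sigma> i1 * (q_gap (pflow c y u) i1 - q_gap (pflow c y v) i1)"
    unfolding s(2) by (simp add: algebra_simps)
  finally show ?thesis by (simp add: right_diff_distrib)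
qed

text \<open>The gap at \<open>i0\<close> vanishes at \<open>x = 1\<close>, so no cell can separate
  it from zero there; its sign near the start comes from its slope.\<close>

lemma start_pos:
  assumes y: "near \<epsilon> Y y" "q_gap y i0 = 0" and x: "fx lo \<le> x" "x < 1"
  shows "0 < \<sigma> i0 * q_gap (pflow c y x) i0"
proof (cases "x < fx xs")
  case True
  then show ?thesis using cells_pos[OF y(1) cells0, of x] x window_pos by auto
next
  case False
  obtain s where s: "\<bar>s - normal i0 \<bullet> slope_mid C Y xs 68719476736\<bar> \<le> abs_inner (normal i0) (slope_rad \<epsilon> C Y xs 68719476736)"
    "q_gap (pflow c y x) i0 - q_gap (pflow c y 1) i0 = (x - 1) * s"
    using gap_secant[OF y(1), of xs x 68719476736 1 i0] False x order fx_le_iff[of xs 68719476736] by auto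
  have "\<sigma> i0 * s < 0"
    using s(1) start_slope sign[of i0] by auto
  then have "0 < (x - 1) * (\<sigma> i0 * s)" using x by (intro mult_neg_neg) auto
  also have "\<dots> = \<sigma> i0 * (q_gap (pflow c y x) i0 - q_gap (pflow c y 1) i0)"
    unfolding s(2) by (simp add: algebra_simps)
  also have "\<dots> = \<sigma> i0 * q_gap (pflow c y x) i0" using y(2) by simp
  finally show ?thesis .
qed

text \<open>The endpoints differ by the decayed initial difference \<open>E\<close> and a correction
  for the different arrival values of \<open>x\<close>. The slack \<open>e\<close> lets one
  statement serve two purposes: it is zero for points exactly on the tie planes, and
  \<open>defect\<close> for a comparison with the rounded centre.\<close>

lemma contraction:
  fixes e N :: real
  assumes y: "near \<epsilon> Y y" "near \<epsilon> Y y'" and x: "fx lo \<le> x" "x \<le> fx hi" "fx lo \<le> x'" "x' \<le> fx hi"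
    and d: "\<bar>la \<bullet> (y' - y)\<bar> \<le> N" "\<bar>lb \<bullet> (y' - y)\<bar> \<le> N" "\<bar>normal i0 \<bullet> (y' - y)\<bar> \<le> e"
    and D: "\<bar>normal i1 \<bullet> (pflow c y' x' - pflow c y x)\<bar> \<le> e"
  shows "\<bar>x' - x\<bar> \<le> N / 10 + e"
    and "l \<in> {la', lb'} \<Longrightarrow> \<bar>l \<bullet> (pflow c y' x' - pflow c y x)\<bar> \<le> 92 / 100 * N + 4 * e"
proof -
  have N: "N \<ge> 0" and e: "e \<ge> 0" using d by linarith+
  define \<delta> where "\<delta> = y' - y"
  define E :: "real ^ 3" where "E = (\<chi> j. x ^ expo j * \<delta> $ j)"
  obtain w where w: "near wr wm w" "pflow c y' x' - pflow c y' x = (x' - x) *\<^sub>R w"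
    using window_secant[OF y(2), of x' x] x by auto
  have split: "pflow c y' x' - pflow c y x = E + (x' - x) *\<^sub>R w"
    using w(2) by (simp add: E_def \<delta>_def pflow_def vec_eq_iff algebra_simps)
  let ?G = "diag_gain la lb (normal i0) em er kg" and ?F = "diag_defect la lb (normal i0) em er kd"
  define xp :: "real ^ 3" where "xp = (\<chi> j. x ^ expo j)"
  have xp: "\<bar>xp $ j - em $ j\<bar> \<le> er $ j" for j
  proof -
    have "fx lo ^ expo j \<le> x ^ expo j" "x ^ expo j \<le> fx hi ^ expo j"
      using x window_pos order by (auto intro!: power_mono)
    then show ?thesis
      using pow_dn_le[of lo "expo j"] pow_up_ge[of hi "expo j"] decay[of j] order
      by (auto simp: xp_def)
  qed
  have E_eq: "E = (\<chi> j. xp $ j * \<delta> $ j)" by (simp add: E_def xp_def)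
  have E_le: "\<bar>p \<bullet> E\<bar> \<le> ?G p * N + ?F p * e" for p
    unfolding E_eq using d by (intro diag_bound det xp coord) (auto simp: \<delta>_def)
  have "\<bar>normal i1 \<bullet> w - normal i1 \<bullet> wm\<bar> \<le> abs_inner (normal i1) wr"
    by (rule near_inner[OF w(1)])
  then have \<eta>: "\<eta> \<le> \<bar>normal i1 \<bullet> w\<bar>"
    using end_slope sign[of i1] by auto
  \<comment> \<open>Both endpoints lie almost on the same tie plane, so the component along its
    normal determines \<open>x' - x\<close>, with slope at least \<open>\<eta>\<close>.\<close>
  have "normal i1 \<bullet> (pflow c y' x' - pflow c y x) = normal i1 \<bullet> E + (x' - x) * (normal i1 \<bullet> w)"
    by (simp add: split inner_add_right)
  then have "\<bar>(x' - x) * (normal i1 \<bullet> w)\<bar> \<le> ?G (normal i1) * N + ?F (normal i1) * e + e"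
    using D E_le[of "normal i1"] by linarith
  then have "\<bar>x' - x\<bar> * \<eta> \<le> ?G (normal i1) * N + (?F (normal i1) + 1) * e"
    using mult_left_mono[OF \<eta>, of "\<bar>x' - x\<bar>"] unfolding abs_mult distrib_right by linarith
  also have "\<dots> \<le> g * \<eta> * N + gd * \<eta> * e"
    using shift_gain shift_defect N e by (intro add_mono mult_right_mono) auto
  also have "\<dots> = (g * N + gd * e) * \<eta>" by (simp add: algebra_simps)
  finally have shift: "\<bar>x' - x\<bar> \<le> g * N + gd * e"
    using end_slope by simp
  also have "\<dots> \<le> 1 / 10 * N + 1 * e"
    using shift_gain shift_defect N e by (intro add_mono mult_right_mono) auto
  finally show "\<bar>x' - x\<bar> \<le> N / 10 + e" by simp
  assume l: "l \<in> {la', lb'}"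
  define \<kappa> where "\<kappa> = \<bar>l \<bullet> wm\<bar> + abs_inner l wr"
  have \<kappa>: "\<bar>l \<bullet> w\<bar> \<le> \<kappa>" using near_inner[OF w(1), of l] by (simp add: \<kappa>_def)
  have "\<bar>l \<bullet> (pflow c y' x' - pflow c y x)\<bar> \<le> \<bar>l \<bullet> E\<bar> + \<bar>x' - x\<bar> * \<bar>l \<bullet> w\<bar>"
    by (simp add: split inner_add_right abs_mult[symmetric] abs_triangle_ineq)
  also have "\<dots> \<le> (?G l * N + ?F l * e) + (g * N + gd * e) * \<kappa>"
    using shift \<kappa> E_le[of l] by (intro add_mono mult_mono) auto
  also have "\<dots> = (?G l + \<kappa> * g) * N + (?F l + \<kappa> * gd) * e"
    by (simp add: algebra_simps)
  also have "\<dots> \<le> 92 / 100 * N + 4 * e"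
    using contract[OF l] contract_defect[OF l] N e unfolding \<kappa>_def by (intro add_mono mult_right_mono) auto
  finally show "\<bar>l \<bullet> (pflow c y' x' - pflow c y x)\<bar> \<le> 92 / 100 * N + 4 * e" .
qed

text \<open>Across the window the gap at \<open>i1\<close> changes sign, so the intermediate value
  theorem gives the arrival; comparison with the arc of the centre places it in the next
  box.\<close>

lemma arc_hits:
  assumes y: "y \<in> section_box i0 Y la lb radius"
  obtains x where "fx lo < x" "x < fx hi" "pflow c y x \<in> section_box i1 Y' la' lb' (95 / 100 * radius)"
    "\<And>u i. x < u \<Longrightarrow> u < 1 \<Longrightarrow> 0 < \<sigma> i * q_gap (pflow c y u) i"
proof -
  note w = window_pos
  have ny: "near \<epsilon> Y y" by (rule near_section[OF y])
  have hi: "0 < \<sigma> i1 * q_gap (pflow c y (fx hi)) i1"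
    using cells_pos[OF ny cells1, of "fx hi"] w order by auto
  \<comment> \<open>An upper bound at \<open>lo\<close> is a lower bound for the negated gap on a
    degenerate cell.\<close>
  have "gap_coeffs C Y (- \<sigma> i1) i1 (- (av $ i1)) (- (bv $ i1))"
    using coeffs[of i1] by (simp add: gap_coeffs_def abs_minus_commute)
  moreover have lo1: "fx lo \<le> 1" using w(2,3) by linarith
  ultimately have "of_int (gap_cell (- (av $ i1)) (- (bv $ i1)) lo lo) / 2 ^ 56 - 4 / 2 ^ 20 \<le>
      - \<sigma> i1 * q_gap (pflow C Y (fx lo)) i1"
    using order by (intro gap_cell_le) auto
  moreover have "real_of_int (mv $ i1) < of_int (gap_cell (- (av $ i1)) (- (bv $ i1)) lo lo)"
    using lo_neg by simp
  ultimately have "abs_inner (normal i1) \<epsilon> < - \<sigma> i1 * q_gap (pflow C Y (fx lo)) i1"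
    using coeffs[of i1] by (simp add: field_simps)
  then have lo: "\<sigma> i1 * q_gap (pflow c y (fx lo)) i1 < 0"
    using gap_pflow_near[OF ny _ lo1, of i1] sign[of i1] order by auto
  have "continuous_on {fx lo..fx hi} (\<lambda>x. \<sigma> i1 * q_gap (pflow c y x) i1)"
    by (intro continuous_intros continuous_gap)
  then obtain x where x: "fx lo \<le> x" "x \<le> fx hi" "\<sigma> i1 * q_gap (pflow c y x) i1 = 0"
    using IVT'[of "\<lambda>x. \<sigma> i1 * q_gap (pflow c y x) i1" "fx lo" 0 "fx hi"] lo hi w by auto
  have x0: "q_gap (pflow c y x) i1 = 0" using x(3) sign[of i1] by auto
  have strict: "fx lo < x" "x < fx hi" using x lo hi by (auto simp: less_le)
  have pos: "0 < \<sigma> i * q_gap (pflow c y u) i" if u: "x < u" "u < 1" for u i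
  proof -
    consider "i = i0" | "i = i1" "u < fx hi" | "i = i1" "fx hi \<le> u" | "i = i2" using states[of i] by linarith
    then show ?thesis
    proof cases
      case 1 then show ?thesis using start_pos[OF ny, of u] y u strict by (auto simp: section_box_def)
    next
      case 2 then show ?thesis using window_mono[OF ny, of x u] u strict x by auto
    next
      case 3 then show ?thesis using cells_pos[OF ny cells1, of u] u strict w by auto
    next
      case 4 then show ?thesis using cells_pos[OF ny cells2, of u] u strict w by auto
    qed
  qed
  have "pflow c y x \<in> section_box i1 Y' la' lb' (95 / 100 * radius)"
  proof -
    \<comment> \<open>The arc of the centre is stopped at the fixed value \<open>xm\<close> rather
      than at its exact arrival; the error is part of \<open>defect\<close>.\<close>
    have "near (\<chi> j. cost_tol) (pflow C Y (fx xm)) (pflow c Y (fx xm))"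
      using w order by (intro near_pflow c) (auto simp: near_def cost_tol_def)
    then have nz: "near (\<chi> j. 2 * cost_tol) Y' (pflow c Y (fx xm))"
      unfolding near_def
    proof (intro allI, elim allE)
      fix j assume A: "\<bar>pflow c Y (fx xm) $ j - pflow C Y (fx xm) $ j\<bar> \<le> (\<chi> j. cost_tol) $ j"
      define p where "p = fx xm ^ expo j - pow_dn xm (expo j)"
      have p: "0 \<le> p" "p \<le> pow_up xm (expo j) - pow_dn xm (expo j)"
        using pow_dn_le[of xm "expo j"] pow_up_ge[of xm "expo j"] order by (auto simp: p_def)
      have "pflow C Y (fx xm) $ j - Y' $ j =
          (C $ j + (Y $ j - C $ j) * pow_dn xm (expo j) - Y' $ j) + (Y $ j - C $ j) * p"
        by (simp add: pflow_def p_def algebra_simps)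
      also have "\<bar>\<dots>\<bar> \<le> \<bar>C $ j + (Y $ j - C $ j) * pow_dn xm (expo j) - Y' $ j\<bar> +
          \<bar>Y $ j - C $ j\<bar> * (pow_up xm (expo j) - pow_dn xm (expo j))"
        using p by (intro order.trans[OF abs_triangle_ineq] add_mono) (auto simp: abs_mult mult_left_mono)
      also note arrival[of j]
      finally show "\<bar>pflow c Y (fx xm) $ j - Y' $ j\<bar> \<le> (\<chi> j. 2 * cost_tol) $ j" using A by simp
    qed
    have "\<bar>normal i1 \<bullet> (pflow c y x - pflow c Y (fx xm))\<bar> \<le> defect"
      using near_inner[OF nz, of "normal i1"] arrival_gap x0
      unfolding q_gap_diff[symmetric] by (simp add: q_gap_eq)
    moreover have "\<bar>normal i0 \<bullet> (y - Y)\<bar> \<le> defect"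
      using y start by (simp add: section_box_def q_gap_diff[symmetric])
    ultimately have l: "\<bar>l \<bullet> (pflow c y x - pflow c Y (fx xm))\<bar> \<le> 92 / 100 * radius + 4 * defect"
      if "l \<in> {la', lb'}" for l
      using y that w strict by (intro contraction(2)[OF near_centre ny]) (auto simp: section_box_def)
    have "\<bar>l \<bullet> (pflow c y x - Y')\<bar> \<le> 95 / 100 * radius" if "l \<in> {la', lb'}" for l
    proof -
      have "l \<bullet> (pflow c y x - Y') = l \<bullet> (pflow c y x - pflow c Y (fx xm)) + (l \<bullet> pflow c Y (fx xm) - l \<bullet> Y')"
        by (simp add: inner_diff_right)
      then have "\<bar>l \<bullet> (pflow c y x - Y')\<bar> \<le> 92 / 100 * radius + 4 * defect + 1 / 10000"
        using l[OF that] near_inner[OF nz, of l] arrival_centre[OF that] by linarith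
      \<comment> \<open>Numerically \<open>0.0092 + 0.00016 + 0.0001 = 0.00946\<close>, below
        \<open>0.0095\<close>.\<close>
      then show ?thesis by (simp add: radius_def defect_def)
    qed
    then show ?thesis using x0 by (simp add: section_box_def)
  qed
  then show thesis using that strict pos by blast
qed

end

end

section \<open>The data of the six arcs\<close>

text \<open>
  All numbers were computed outside the logic and are validated by \<open>certified\<close> below.
  \<open>centre\<close> lists the switching points of the numerically integrated orbit and \<open>target\<close> the
  rounded costs-to-go. The functionals \<open>la\<close> and \<open>lb\<close> approximate left eigenvectors of the monodromy
  matrices for the Floquet multipliers \<open>0.508\<close> and \<open>3.4e-11\<close>; \<open>la\<close> is scaled so that every
  arc shrinks it by the same factor \<open>0.508 powr (1 / 6) \<approx> 0.893\<close>.
\<close>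

lemma expo_simps: "expo 1 = 1" "expo 2 = 9" "expo 3 = 40"
  by (simp_all add: expo_def)

lemma normal_simps:
  "normal 1 = vector [0.38302794184, -0.165915001595, -0.217112940245]"
  "normal 2 = vector [0.322824058575, -0.740576974595, 0.41775291602]"
  "normal 3 = vector [-0.339135841295, 0.32725391532, 0.011881925975]"
  by (simp_all add: vec_eq_iff forall_3 normal_def trans_def discount_def vector_3)

lemma offset_simps: "offset 1 = 3.3959491559" "offset 2 = -15.540993609" "offset 3 = -3.0605959696"
  by (simp_all add: offset_def cost_def vector_3)

definition cycle :: "nat \<Rightarrow> 2 ^ 3" where
  "cycle k = [
     vector [0, 1, 1],
     vector [0, 0, 1],
     vector [1, 0, 1],
     vector [1, 0, 0],
     vector [1, 1, 0],
     vector [1, 1, 1]] ! (k mod 6)"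

definition tie_state :: "nat \<Rightarrow> 3" where
  "tie_state k = [1, 2, 1, 3, 2, 3] ! (k mod 6)"

definition other_state :: "nat \<Rightarrow> 3" where
  "other_state k = [3, 3, 2, 1, 1, 2] ! (k mod 6)"

definition gap_sign :: "nat \<Rightarrow> real ^ 3" where
  "gap_sign k = [
     vector [1, -1, -1],
     vector [1, 1, -1],
     vector [-1, 1, -1],
     vector [-1, 1, 1],
     vector [-1, -1, 1],
     vector [-1, -1, -1]] ! (k mod 6)"

definition centre :: "nat \<Rightarrow> real ^ 3" where
  "centre k = [
     vector [-8.593655, -0.017829, 0.494199],
     vector [-28.093604, -86.202546, -93.905595],
     vector [-25.423916, -53.300321, 11.520281],
     vector [-21.806576, -16.172373, 80.599465],
     vector [-14.729179, 40.344713, 120.105188],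
     vector [-8.569442, 0.385602, 2.373463]] ! (k mod 6)"

definition target :: "nat \<Rightarrow> real ^ 3" where
  "target k = [
     vector [-85.82695488, -92.97729513, -93.90642626],
     vector [137.98734504, 156.24244459, 127.10452146],
     vector [145.69356632, 158.93598988, 131.74869956],
     vector [143.73411203, 157.65276526, 128.43667387],
     vector [9.71474812, -2.77538412, 2.37239825],
     vector [-35.17408333, -49.04702654, -50.17034145]] ! (k mod 6)"

definition la :: "nat \<Rightarrow> real ^ 3" where
  "la k = [
     vector [1, -0.08863, 0.00618],
     vector [1.20797, -1.14413, 0.60725],
     vector [0.67405, -0.0788, 0.00832],
     vector [0.6164, -0.08599, 0.01577],
     vector [0.57367, -0.11173, 0.08118],
     vector [0.61016, 0.39211, 0.02448]] ! (k mod 6)"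

definition lb :: "nat \<Rightarrow> real ^ 3" where
  "lb k = [
     vector [1, -0.97234, 0.1986],
     vector [0.00006, -0.0006, 1],
     vector [-0.38296, 1, -0.39437],
     vector [-0.33352, 1, -0.74298],
     vector [-0.06629, 0.3256, -1],
     vector [0.00007, -0.00145, 1]] ! (k mod 6)"

definition box_eps :: "nat \<Rightarrow> real ^ 3" where
  "box_eps k = [
     vector [0.013, 0.024, 0.016],
     vector [0.016, 0.013, 0.011],
     vector [0.018, 0.023, 0.024],
     vector [0.02, 0.02, 0.03],
     vector [0.02, 0.017, 0.015],
     vector [0.011, 0.012, 0.011]] ! (k mod 6)"

definition decay_mid :: "nat \<Rightarrow> real ^ 3" where
  "decay_mid k = [
     vector [0.747519, 0.072882, 0.000009],
     vector [0.983925, 0.86429, 0.522981],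
     vector [0.978861, 0.825066, 0.42544],
     vector [0.957247, 0.674862, 0.174164],
     vector [0.748005, 0.073309, 0.000009],
     vector [0.99909, 0.991837, 0.964228]] ! (k mod 6)"

definition decay_rad :: "nat \<Rightarrow> real ^ 3" where
  "decay_rad k = [
     vector [0.00089, 0.000781, 0.000001],
     vector [0.000011, 0.00008, 0.000213],
     vector [0.000032, 0.000239, 0.000548],
     vector [0.000062, 0.000388, 0.000445],
     vector [0.000666, 0.000588, 0.000001],
     vector [0.00002, 0.000175, 0.000755]] ! (k mod 6)"

definition velo_mid :: "nat \<Rightarrow> real ^ 3" where
  "velo_mid k = [
     vector [77.233, 81.57, 0.045],
     vector [-166.081, -1916.695, -4698.897],
     vector [-171.117, -1610.015, -2090.186],
     vector [-165.541, -1102.926, -348.145],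
     vector [-24.444, 38.034, 0.057],
     vector [26.605, 441.664, 2028.415]] ! (k mod 6)"

definition velo_rad :: "nat \<Rightarrow> real ^ 3" where
  "velo_rad k = [
     vector [0.027, 0.82, 0.003],
     vector [0.033, 0.363, 2.334],
     vector [0.037, 0.764, 3.457],
     vector [0.041, 0.817, 1.304],
     vector [0.041, 0.302, 0.003],
     vector [0.023, 0.284, 2.399]] ! (k mod 6)"

definition coord_gain :: "nat \<Rightarrow> real ^ 3" where
  "coord_gain k = [
     vector [1.21, 2.34, 1.55],
     vector [1.47, 1.21, 1.01],
     vector [1.73, 2.2, 2.3],
     vector [1.89, 1.94, 2.9],
     vector [1.95, 1.6, 1.4],
     vector [1, 1.07, 1.01]] ! (k mod 6)"

definition coord_defect :: "nat \<Rightarrow> real ^ 3" where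
  "coord_defect k = [
     vector [0.06, 0.88, 4.03],
     vector [2.18, 2.31, 0.01],
     vector [0.14, 1.51, 3.69],
     vector [0.35, 3.27, 4.24],
     vector [0.27, 1.79, 0.57],
     vector [1.18, 1.84, 0.01]] ! (k mod 6)"

definition win_lo :: "nat \<Rightarrow> int" where
  "win_lo k = [51308003328, 67614146560, 67264643072, 65777303552, 51356827648, 68655579136] ! (k mod 6)"

definition win_hi :: "nat \<Rightarrow> int" where
  "win_hi k = [51430227968, 67615522816, 67268968448, 65785692160, 51448250368, 68658266112] ! (k mod 6)"

text \<open>Arcs 0 and 4 decay so far that cells are used on part of the range; where the entry
  equals \<open>win_lo\<close>, the slope bound covers the whole arc.\<close>

definition x_start :: "nat \<Rightarrow> int" where
  "x_start k = [58518929408, 67614146560, 67264643072, 65777303552, 66035122176, 68655579136] ! (k mod 6)"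

definition win_mid :: "nat \<Rightarrow> int" where
  "win_mid k = [51369107312, 67614837046, 67266780770, 65781498031, 51402542235, 68656934565] ! (k mod 6)"

definition slope_min :: "nat \<Rightarrow> real" where
  "slope_min k = [34.8, 1274, 493.3, 616.7, 20.6, 502.9] ! (k mod 6)"

definition shift_gain :: "nat \<Rightarrow> real" where
  "shift_gain k = [0.00661, 0.00049, 0.00073, 0.00058, 0.02365, 0.00083] ! (k mod 6)"

definition shift_defect :: "nat \<Rightarrow> real" where
  "shift_defect k = [0.03, 0.002, 0.003, 0.004, 0.05, 0.004] ! (k mod 6)"

definition gap_const :: "nat \<Rightarrow> int ^ 3" where
  "gap_const k = [
     vector [6644255, 14282485, 5763574],
     vector [2862566, -35239107, -2919391],
     vector [-4431747, -32687822, -1161138],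
     vector [-4622026, -33805437, 1376334],
     vector [-7405430, 9812970, -7586743],
     vector [-9388488, 12091908, 8156616]] ! (k mod 6)"

definition gap_coeff :: "nat \<Rightarrow> int ^ 3 ^ 3" where
  "gap_coeff k = [
     vector [vector [31019512, -16172576, -21491191], vector [-26143901, 72187789, -41351786], vector [27464911, -31899097, -1176147]],
     vector [vector [-66703740, 42179243, 50315035], vector [-56219325, 188270958, -96812527], vector [-59059997, 83195144, 2753588]],
     vector [vector [68726583, -36923704, -27371132], vector [-57924219, 164812371, -52665540], vector [-60851037, 72829018, 1497938]],
     vector [vector [66486753, -30241140, -10890591], vector [-56036443, 134984127, -20954883], vector [58867875, -59648201, -596009]],
     vector [vector [9817510, 7501797, 26802978], vector [8274405, 33484965, -51572340], vector [8692498, 14796687, 1466845]],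
     vector [vector [-10685326, 8600016, 11962092], vector [-9005819, 38386969, -23016587], vector [9460869, -16962836, -654649]]] ! (k mod 6)"

text \<open>In units of \<open>1 / 2 ^ 56\<close>: the variation of each gap over the box together
  with the rounding error of the coefficients.\<close>

definition gap_margin :: "nat \<Rightarrow> int ^ 3" where
  "gap_margin k = [
     vector [896321019969536, 2065058930622464, 897609510158336],
     vector [769391851470848, 1397328955047936, 707247969665024],
     vector [1147525067177984, 2368824787599360, 1003063842177024],
     vector [1260727520198656, 2435869227089920, 986330649591808],
     vector [990191825190912, 1824240114335744, 902746291044352],
     vector [619433068331008, 1227651977052160, 561481074606080]] ! (k mod 6)"

text \<open>Interior breakpoints only. They cluster towards the arrival window, where this gap tends
  to zero.\<close>

definition cells1 :: "nat \<Rightarrow> int list" where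
  "cells1 k = [
     [51437895680, 51455721472, 51497664512, 51589939200, 51808043008, 52344913920, 53687091200, 57713623040, 64961380352, 68182605824],
     [67617423360, 67654123520, 68383932416],
     [67270868992, 67288170496, 67444408320],
     [65786871808, 65790803968, 65804435456, 65858961408, 66035122176, 66571993088, 67645734912],
     [],
     [68664950784]] ! (k mod 6)"

definition cells2 :: "nat \<Rightarrow> int list" where
  "cells2 k = [
     [67108864000, 68451041280],
     [],
     [68451041280],
     [],
     [],
     []] ! (k mod 6)"

lemmas arc_data_defs = tie_state_def other_state_def gap_sign_def centre_def target_def la_def lb_def
  box_eps_def decay_mid_def decay_rad_def velo_mid_def velo_rad_def coord_gain_def coord_defect_def
  win_lo_def win_hi_def x_start_def win_mid_def slope_min_def shift_gain_def shift_defect_def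
  gap_const_def gap_coeff_def gap_margin_def cells1_def cells2_def

definition certified :: "nat \<Rightarrow> bool" where
  "certified k \<longleftrightarrow> certified_arc (($) (gap_sign k)) (tie_state k) (tie_state (Suc k)) (other_state k)
     (target k) (centre k) (centre (Suc k)) (box_eps k) (la k) (lb k) (la (Suc k)) (lb (Suc k))
     (decay_mid k) (decay_rad k) (velo_mid k) (velo_rad k) (coord_gain k) (coord_defect k)
     (slope_min k) (shift_gain k) (shift_defect k) (win_lo k) (win_hi k) (x_start k) (win_mid k)
     (gap_const k) (gap_margin k) (gap_coeff k) (cells1 k) (cells2 k)"

section \<open>Evaluation of the certificates\<close>

lemma cross3_vector:
  "cross3 (vector [a1, a2, a3]) (vector [b1, b2, b3]) =
     vector [a2 * b3 - a3 * b2, a3 * b1 - a1 * b3, a1 * b2 - a2 * b1]"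
  by (simp add: cross3_def vector_3)

lemma inner_vector:
  "(vector [a1, a2, a3] :: real ^ 3) \<bullet> vector [b1, b2, b3] = a1 * b1 + a2 * b2 + a3 * b3"
  by (simp add: inner_vec_def sum_3 vector_3)

lemma vec_lambda_vector: "(\<chi> j. f j) = (vector [f 1, f 2, f 3] :: real ^ 3)"
  by (simp add: vec_eq_iff forall_3 vector_3)

text \<open>Keeps the simplifier from normalising all entries of a table before selecting one.\<close>

lemma nth_index_cong: "i = j \<Longrightarrow> xs ! i = xs ! j"
  by simp

lemmas certificate_eval = inner_axis' diag_gain_def diag_defect_def row_gain_def row_defect_def
  abs_inner_def slope_mid_def slope_rad_def gap_coeffs_def gap_cell_def q_gap_eq cross3_vector inner_vector
  sum_3 forall_3 vector_3 vec_lambda_vector expo_simps normal_simps offset_simps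
  pow_dn_def pow_up_def fx_def ipow.simps
  cost_tol_def defect_def radius_def

lemma certified_0: "certified 0"
  unfolding certified_def certified_arc_def forall_3 arc_data_defs
  by (intro conjI; simp add: certificate_eval cong: nth_index_cong)

lemma certified_1: "certified 1"
  unfolding certified_def certified_arc_def forall_3 arc_data_defs
  by (intro conjI; simp add: certificate_eval cong: nth_index_cong)

lemma certified_2: "certified 2"
  unfolding certified_def certified_arc_def forall_3 arc_data_defs
  by (intro conjI; simp add: certificate_eval cong: nth_index_cong)

lemma certified_3: "certified 3"
  unfolding certified_def certified_arc_def forall_3 arc_data_defs
  by (intro conjI; simp add: certificate_eval cong: nth_index_cong)

lemma certified_4: "certified 4"
  unfolding certified_def certified_arc_def forall_3 arc_data_defs
  by (intro conjI; simp add: certificate_eval cong: nth_index_cong)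

lemma certified_5: "certified 5"
  unfolding certified_def certified_arc_def forall_3 arc_data_defs
  by (intro conjI; simp add: certificate_eval cong: nth_index_cong)

lemma less_6_cases: "k mod 6 = 0 \<or> k mod 6 = 1 \<or> k mod 6 = 2 \<or> k mod 6 = 3 \<or> k mod 6 = 4 \<or> k mod (6 :: nat) = 5"
  using mod_less_divisor[of 6 k] by linarith

lemma certified_all: "certified k"
proof -
  have "certified k \<longleftrightarrow> certified (k mod 6)"
    unfolding certified_def arc_data_defs by (simp only: mod_mod_trivial mod_Suc_eq)
  then show ?thesis
    using less_6_cases[of k] certified_0 certified_1 certified_2 certified_3 certified_4 certified_5 by auto
qed

section \<open>Costs-to-go\<close>

lemma action_cases: "(a :: 2) = 0 \<or> a = 1"
  using exhaust_2[of a] by auto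

lemma trans_nonneg: "0 \<le> trans i a $ j"
  using exhaust_3[of i] exhaust_3[of j] action_cases[of a] by (auto simp: trans_def vector_3)

lemma trans_sum: "(\<Sum>j\<in>UNIV. trans i a $ j) = 1"
  using exhaust_3[of i] action_cases[of a] by (auto simp: trans_def vector_3 sum_3)

definition bellman :: "2 ^ 3 \<Rightarrow> real ^ 3 ^ 3" where
  "bellman \<mu> = mat 1 - discount *\<^sub>R policy_trans \<mu>"

lemma bellman_mult: "(bellman \<mu> *v v) $ i = v $ i - discount * (\<Sum>j\<in>UNIV. trans i (\<mu> $ i) $ j * v $ j)"
  by (simp add: bellman_def matrix_vector_mult_diff_rdistrib scaleR_matrix_vector_assoc[symmetric])
    (simp add: matrix_vector_mult_def policy_trans_def)

text \<open>At a coordinate of largest modulus, stochastic rows give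
  \<open>m - discount * m \<le> b\<close>; hence the factor
  \<open>1 / (1 - 0.95) = 20\<close>.\<close>

lemma bellman_bound:
  assumes "\<And>i. \<bar>(bellman \<mu> *v v) $ i\<bar> \<le> b"
  shows "\<bar>v $ i\<bar> \<le> 20 * b"
proof -
  define m where "m = Max (range (\<lambda>i. \<bar>v $ i\<bar>))"
  have m: "\<bar>v $ i\<bar> \<le> m" for i unfolding m_def by (intro Max_ge) auto
  have "m \<in> range (\<lambda>i. \<bar>v $ i\<bar>)" unfolding m_def by (intro Max_in) auto
  then obtain i0 where i0: "m = \<bar>v $ i0\<bar>" by blast
  have "\<bar>\<Sum>j\<in>UNIV. trans i0 (\<mu> $ i0) $ j * v $ j\<bar> \<le> (\<Sum>j\<in>UNIV. trans i0 (\<mu> $ i0) $ j * m)"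
    by (rule order.trans[OF sum_abs]) (auto intro!: sum_mono mult_left_mono simp: abs_mult trans_nonneg m)
  also have "\<dots> = m" using trans_sum[of i0 "\<mu> $ i0"] by (simp flip: sum_distrib_right)
  finally have "discount * \<bar>\<Sum>j\<in>UNIV. trans i0 (\<mu> $ i0) $ j * v $ j\<bar> \<le> discount * m"
    by (intro mult_left_mono) (auto simp: discount_def)
  moreover have "\<bar>v $ i0 - discount * (\<Sum>j\<in>UNIV. trans i0 (\<mu> $ i0) $ j * v $ j)\<bar> \<le> b"
    using assms[of i0] by (simp add: bellman_mult)
  moreover have "\<bar>discount * (\<Sum>j\<in>UNIV. trans i0 (\<mu> $ i0) $ j * v $ j)\<bar> =
      discount * \<bar>\<Sum>j\<in>UNIV. trans i0 (\<mu> $ i0) $ j * v $ j\<bar>"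
    by (simp add: abs_mult discount_def)
  ultimately have "m - discount * m \<le> b" using i0 by linarith
  then have "m \<le> 20 * b" by (simp add: discount_def)
  then show ?thesis using m[of i] by simp
qed

text \<open>By \<open>bellman_bound\<close> the kernel is trivial, so the \<open>matrix_inv\<close>
  in \<open>cost_to_go\<close> is a genuine inverse.\<close>

lemma bellman_cost_to_go: "bellman \<mu> *v cost_to_go \<mu> = policy_cost \<mu>"
proof -
  have "v = 0" if "bellman \<mu> *v v = 0" for v
    using bellman_bound[of \<mu> v 0] that by (simp add: vec_eq_iff)
  then have "invertible (bellman \<mu>)"
    by (simp add: invertible_left_inverse matrix_left_invertible_ker)
  then show ?thesis
    unfolding cost_to_go_def bellman_def[symmetric] matrix_vector_mul_assoc matrix_inv_def invertible_def
    by (metis (mono_tags, lifting) matrix_vector_mul_lid someI_ex)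
qed

text \<open>A small residual in the Bellman equation certifies a rounded cost-to-go without
  inverting a matrix.\<close>

lemma cost_to_go_near:
  assumes "\<And>i. \<bar>cost i (\<mu> $ i) - C $ i + discount * (\<Sum>j\<in>UNIV. trans i (\<mu> $ i) $ j * C $ j)\<bar> \<le> b"
  shows "\<bar>cost_to_go \<mu> $ i - C $ i\<bar> \<le> 20 * b"
proof -
  have "\<bar>(bellman \<mu> *v (cost_to_go \<mu> - C)) $ i\<bar> \<le> b" for i
    using assms[of i] unfolding matrix_vector_mult_diff_distrib bellman_cost_to_go
    by (simp add: bellman_mult policy_cost_def algebra_simps)
  from bellman_bound[OF this, of i] show ?thesis by simp
qed

lemma cycle_target: "near (\<chi> j. cost_tol) (target k) (cost_to_go (cycle k))"
proof -
  have "\<forall>i. \<bar>cost i (cycle k $ i) - target k $ i +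
      discount * (\<Sum>j\<in>UNIV. trans i (cycle k $ i) $ j * target k $ j)\<bar> \<le> 1 / 2000000"
    unfolding forall_3 sum_3 cycle_def target_def
    using less_6_cases[of k]
    by (elim disjE) (simp_all add: cost_def trans_def discount_def vector_3 cong: nth_index_cong)
  then show ?thesis
    using cost_to_go_near[of "cycle k" "target k" "1 / 2000000"]
    by (simp add: near_def cost_tol_def)
qed

section \<open>Greedy policies along the cycle\<close>

lemma greedy_iff: "\<mu> \<in> greedy J \<longleftrightarrow> (\<forall>i. (\<mu> $ i = 0 \<longrightarrow> 0 \<le> q_gap J i) \<and> (\<mu> $ i = 1 \<longrightarrow> q_gap J i \<le> 0))"
proof -
  have "(\<forall>a. q_factor J i (\<mu> $ i) \<le> q_factor J i a) \<longleftrightarrow>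
      (\<mu> $ i = 0 \<longrightarrow> 0 \<le> q_gap J i) \<and> (\<mu> $ i = 1 \<longrightarrow> q_gap J i \<le> 0)" for i
  proof -
    have all: "(\<forall>a :: 2. Q a) \<longleftrightarrow> Q 0 \<and> Q 1" for Q using action_cases by metis
    show ?thesis using action_cases[of "\<mu> $ i"] unfolding all by (auto simp: q_gap_def)
  qed
  then show ?thesis by (auto simp: greedy_def)
qed

lemma gap_sign_cases: "gap_sign k $ i = 1 \<and> cycle k $ i = 0 \<or> gap_sign k $ i = -1 \<and> cycle k $ i = 1"
proof -
  have "\<forall>i. gap_sign k $ i = 1 \<and> cycle k $ i = 0 \<or> gap_sign k $ i = -1 \<and> cycle k $ i = 1"
    unfolding forall_3 gap_sign_def cycle_def using less_6_cases[of k]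
    by (elim disjE) (simp_all add: vector_3 cong: nth_index_cong)
  then show ?thesis ..
qed

definition region :: "nat \<Rightarrow> (real ^ 3) set" where
  "region k = {J. \<forall>i. 0 < gap_sign k $ i * q_gap J i}"

lemma greedy_region:
  assumes "J \<in> region k"
  shows "greedy J = {cycle k}"
proof -
  have sgn: "0 < q_gap J i \<and> cycle k $ i = 0 \<or> q_gap J i < 0 \<and> cycle k $ i = 1" for i
    using assms gap_sign_cases[of k i] by (auto simp: region_def dest!: spec[of _ i])
  have "\<mu> = cycle k" if "\<mu> \<in> greedy J" for \<mu>
  proof -
    have "\<mu> $ i = cycle k $ i" for i
      using that[unfolded greedy_iff, rule_format, of i] sgn[of i] action_cases[of "\<mu> $ i"] by auto
    then show ?thesis by (simp add: vec_eq_iff)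
  qed
  moreover have "cycle k \<in> greedy J"
    unfolding greedy_iff using sgn by (metis less_imp_le zero_neq_one)
  ultimately show ?thesis by blast
qed

lemma diag_mult: "(diag q *v v) = (\<chi> i. q $ i * v $ i)"
  by (simp add: vec_eq_iff matrix_vector_mult_def diag_def if_distrib[of "\<lambda>x. x * _"] cong: if_cong)

lemma diag_relax_field: "diag q *v (c - J) = relax_field q c J"
  by (simp add: diag_mult relax_field_def)

lemma filippov_singleton:
  assumes "greedy J = {\<mu>}"
  shows "filippov_field q J = {relax_field q (cost_to_go \<mu>) J}"
  by (simp add: filippov_field_def assms diag_relax_field)

lemma continuous_q_gap: "continuous_on A (\<lambda>J. q_gap J i)"
  unfolding q_gap_eq by (intro continuous_intros)

lemma open_region: "open (region k)"
proof -
  have "region k = (\<Inter>i. {J. 0 < gap_sign k $ i * q_gap J i})" by (auto simp: region_def)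
  moreover have "open {J. 0 < gap_sign k $ i * q_gap J i}" for i
    by (intro open_Collect_less continuous_intros continuous_q_gap)
  ultimately show ?thesis by (simp add: open_INT)
qed

lemma region_tie_set: "region k \<inter> tie_set = {}"
  by (auto simp: region_def tie_set_def) (metis less_irrefl mult_zero_right)

lemma closed_tie_set: "closed tie_set"
proof -
  have "tie_set = (\<Union>i. {J. q_gap J i = 0})" by (auto simp: tie_set_def)
  moreover have "closed {J. q_gap J i = 0}" for i
    by (intro closed_Collect_eq continuous_q_gap continuous_on_const)
  ultimately show ?thesis by (metis closed_UN finite)
qed

section \<open>Hybrid solutions solve the inclusion\<close>

lemma greedy_off_ties:
  assumes "J \<notin> tie_set"
  obtains \<mu> where "greedy J = {\<mu>}"
proof -
  have nz: "q_gap J i \<noteq> 0" for i using assms by (auto simp: tie_set_def)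
  define \<mu> :: "2 ^ 3" where "\<mu> = (\<chi> i. if 0 < q_gap J i then 0 else 1)"
  have "\<mu> \<in> greedy J" using nz by (auto simp: greedy_iff \<mu>_def)
  moreover have "\<nu> = \<mu>" if "\<nu> \<in> greedy J" for \<nu>
  proof -
    have "\<nu> $ i = \<mu> $ i" for i
      using that[unfolded greedy_iff, rule_format, of i] nz[of i] action_cases[of "\<nu> $ i"]
      by (auto simp: \<mu>_def)
    then show ?thesis by (simp add: vec_eq_iff)
  qed
  ultimately show thesis using that by blast
qed

lemma hybrid_field_off_ties:
  assumes "J \<notin> tie_set"
  shows "filippov_field q J = {hybrid_field q J}"
proof -
  obtain \<mu> where "greedy J = {\<mu>}" using greedy_off_ties[OF assms] by blast
  then show ?thesis by (simp add: filippov_singleton hybrid_field_def diag_relax_field)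
qed

text \<open>There are finitely many policies, hence a largest cost-to-go, and rates at most 1 do not
  increase the norm.\<close>

lemma hybrid_field_bounded:
  assumes q: "\<And>i. 0 \<le> q $ i" "\<And>i. q $ i \<le> 1"
  obtains B where "0 \<le> B" "\<And>J. norm (hybrid_field q J) \<le> B + norm J"
proof
  let ?B = "Max (range (\<lambda>\<mu>. norm (cost_to_go \<mu>)))"
  have B: "norm (cost_to_go \<mu>) \<le> ?B" for \<mu> by (intro Max_ge) auto
  then show "0 \<le> ?B" using norm_ge_zero order.trans by blast
  fix J
  define v where "v = cost_to_go (the_elem (greedy J)) - J"
  have "norm (hybrid_field q J) \<le> norm v"
    unfolding hybrid_field_def v_def[symmetric] diag_mult
    by (rule norm_le_componentwise_cart) (auto simp: abs_mult q intro!: mult_right_le_one_le mult_left_le_one_le)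
  also have "\<dots> \<le> ?B + norm J"
    unfolding v_def by (rule order.trans[OF norm_triangle_ineq4]) (simp add: B)
  finally show "norm (hybrid_field q J) \<le> ?B + norm J" .
qed

text \<open>The tie times form a closed discrete set, hence are finitely many on compact intervals.
  Off them the derivative is bounded on each such interval, so the curve is locally Lipschitz, and
  the hybrid field is the only element of the inclusion.\<close>

lemma hybrid_imp_inclusion_solution:
  assumes q: "\<And>i. 0 \<le> q $ i" "\<And>i. q $ i \<le> 1" and J: "hybrid_solution q {0..} J"
  shows "inclusion_solution (filippov_field q) J"
proof -
  have cont: "continuous_on {0..b} J" for b
    using J by (auto simp: hybrid_solution_def piecewise_C1_differentiable_on_def)
  have der: "(J has_vector_derivative hybrid_field q (J t)) (at t)" if "0 < t" "J t \<notin> tie_set" for t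
  proof -
    have "(J has_vector_derivative hybrid_field q (J t)) (at t within {0..})"
      using J that by (auto simp: hybrid_solution_def)
    moreover have "at t within {0..} = at t" using that by (intro at_within_interior) simp
    ultimately show ?thesis by simp
  qed
  have fin: "finite {t \<in> {0..b}. J t \<in> tie_set}" for b
  proof -
    have "closed {t \<in> {0..b}. J t \<in> tie_set}"
      using continuous_closed_preimage[OF cont[of b] closed_atLeastAtMost closed_tie_set]
      by (simp add: vimage_def Int_def)
    then have "compact {t \<in> {0..b}. J t \<in> tie_set}"
      by (intro compact_eq_bounded_closed[THEN iffD2] conjI) (auto intro: bounded_subset[of "{0..b}"])
    moreover have "discrete {t \<in> {0..b}. J t \<in> tie_set}"
      by (rule discrete_subset[of "{t \<in> {0..}. J t \<in> tie_set}"]) (use J in \<open>auto simp: hybrid_solution_def\<close>)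
    ultimately show ?thesis using discrete_compact_finite_iff by blast
  qed
  obtain B where B: "0 \<le> B" "\<And>y. norm (hybrid_field q y) \<le> B + norm y"
    using hybrid_field_bounded[OF q] by blast
  show ?thesis
    unfolding inclusion_solution_def
  proof (intro conjI allI impI)
    fix b :: real assume b: "0 \<le> b"
    have "bounded (J ` {0..b})" by (intro compact_imp_bounded compact_continuous_image cont) simp
    then obtain M where M: "\<forall>t\<in>{0..b}. norm (J t) \<le> M" by (auto simp: bounded_iff)
    have "norm (J 0) \<le> M" using M b by simp
    then have M0: "0 \<le> M" using norm_ge_zero order.trans by blast
    show "absolutely_continuous_on 0 b J"
    proof (rule Lipschitz_imp_absolutely_continuous_on)
      fix u v :: real assume uv: "0 \<le> u" "u \<le> v" "v \<le> b"
      have "norm (J v - J u) \<le> (B + M) * (v - u)"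
      proof (rule norm_diff_le_if_derivative_bounded_off_finite[OF fin uv(2)])
        show "continuous_on {u..v} J" by (rule continuous_on_subset[OF cont[of b]]) (use uv in auto)
        fix t assume t: "t \<in> {u<..<v} - {t \<in> {0..b}. J t \<in> tie_set}"
        have "norm (hybrid_field q (J t)) \<le> B + norm (J t)" by (rule B)
        also have "\<dots> \<le> B + M" using M t uv by auto
        finally show "\<exists>D. (J has_vector_derivative D) (at t) \<and> norm D \<le> B + M"
          using der[of t] t uv by auto
      qed (use B M0 in simp)
      then show "dist (J u) (J v) \<le> (B + M) * (v - u)" by (simp add: dist_norm norm_minus_commute)
    qed (use B M0 in simp)
  next
    define Z where "Z = insert 0 (\<Union>n. {t \<in> {0..real n}. J t \<in> tie_set})"
    have "negligible (\<Union>n. {t \<in> {0..real n}. J t \<in> tie_set})"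
      by (rule negligible_countable_Union) (auto intro!: negligible_finite fin simp del: atLeastAtMost_iff)
    then have "negligible Z" by (simp add: Z_def)
    then have "AE t in lebesgue. t \<notin> Z" by (intro AE_not_in) (simp add: negligible_iff_null_sets)
    then show "AE t in lebesgue. 0 \<le> t \<longrightarrow>
        (\<exists>v\<in>filippov_field q (J t). (J has_vector_derivative v) (at t))"
    proof eventually_elim
      case (elim t)
      show ?case
      proof
        assume t: "0 \<le> t"
        obtain n where n: "t \<le> real n" using real_arch_simple by blast
        have "t \<noteq> 0" "t \<notin> {t \<in> {0..real n}. J t \<in> tie_set}" using elim unfolding Z_def by blast+
        then have "J t \<notin> tie_set" "0 < t" using t n by simp_all
        then show "\<exists>v\<in>filippov_field q (J t). (J has_vector_derivative v) (at t)"
          using der by (simp add: hybrid_field_off_ties)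
      qed
    qed
  qed
qed

lemma uniformly_attracting_imp_hybrid:
  assumes q: "\<And>i. 0 \<le> q $ i" "\<And>i. q $ i \<le> 1" and "uniformly_attracting (filippov_field q) C"
  shows "hybrid_locally_attracting q C"
proof -
  obtain W where W: "open W" "C \<subseteq> W" and attr: "\<And>e. 0 < e \<Longrightarrow> \<exists>T\<ge>0. \<forall>J.
      inclusion_solution (filippov_field q) J \<and> J 0 \<in> W \<longrightarrow> (\<forall>t\<ge>T. infdist (J t) C < e)"
    using assms(3) unfolding uniformly_attracting_def by metis
  have "((\<lambda>t. infdist (J t) C) \<longlongrightarrow> 0) at_top" if J: "hybrid_solution q {0..} J" "J 0 \<in> W" for J
  proof (rule tendstoI)
    fix e :: real assume "0 < e"
    then obtain T where "\<And>t. T \<le> t \<Longrightarrow> infdist (J t) C < e"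
      using attr hybrid_imp_inclusion_solution[OF q J(1)] J(2) by metis
    then show "\<forall>\<^sub>F t in at_top. dist (infdist (J t) C) 0 < e"
      by (intro eventually_at_top_linorderI[of T]) (auto simp: infdist_nonneg)
  qed
  then show ?thesis unfolding hybrid_locally_attracting_def using W by blast
qed

section \<open>The arcs form an attracting cycle\<close>

definition rates :: "real ^ 3" where "rates = vector [0.02, 0.18, 0.80]"

lemma rates_simps: "rates $ 1 = 0.02" "rates $ 2 = 0.18" "rates $ 3 = 0.80"
  by (simp_all add: rates_def vector_3)

lemma rates_bounds: "0 \<le> rates $ i" "rates $ i \<le> 1"
  using exhaust_3[of i] by (auto simp: rates_simps)

lemma rates_expo: "rates $ i = real (expo i) * 0.02"
  using exhaust_3[of i] by (auto simp: rates_simps expo_simps)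

lemma relax_pflow: "relax rates c t y = pflow c y (exp (- (0.02 * t)))"
proof -
  have "exp (- (rates $ i * t)) = exp (- (0.02 * t)) ^ expo i" for i
    unfolding rates_expo by (simp add: exp_of_nat_mult[symmetric])
  then show ?thesis by (simp add: relax_def pflow_def)
qed

definition ctg :: "nat \<Rightarrow> real ^ 3" where "ctg k = cost_to_go (cycle k)"

definition sect :: "nat \<Rightarrow> (real ^ 3) set" where
  "sect k = section_box (tie_state k) (centre k) (la k) (lb k) radius"

definition metric :: "nat \<Rightarrow> real ^ 3 \<Rightarrow> real" where
  "metric k v = max \<bar>la k \<bullet> v\<bar> \<bar>lb k \<bullet> v\<bar>"

text \<open>The smaller box, of 95 percent of the radius, leaves the room around arrival points that
  \<open>sect_interior\<close> uses.\<close>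

definition arrives :: "nat \<Rightarrow> real ^ 3 \<Rightarrow> real \<Rightarrow> bool" where
  "arrives k y x \<longleftrightarrow> fx (win_lo k) < x \<and> x < fx (win_hi k) \<and>
     pflow (ctg k) y x \<in> section_box (tie_state (Suc k)) (centre (Suc k)) (la (Suc k)) (lb (Suc k)) (95 / 100 * radius) \<and>
     (\<forall>u i. x < u \<longrightarrow> u < 1 \<longrightarrow> 0 < gap_sign k $ i * q_gap (pflow (ctg k) y u) i)"

definition arrival :: "nat \<Rightarrow> real ^ 3 \<Rightarrow> real" where "arrival k y = (SOME x. arrives k y x)"

text \<open>Inverts \<open>x = exp (- 0.02 * t)\<close>; the factor is
  \<open>50 = 1 / 0.02\<close>.\<close>

definition travel :: "nat \<Rightarrow> real ^ 3 \<Rightarrow> real" where "travel k y = - 50 * ln (arrival k y)"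

lemma near_ctg: "near (\<chi> j. cost_tol) (target k) (ctg k)"
  unfolding ctg_def by (rule cycle_target)

lemmas certified_arc_k = certified_all[unfolded certified_def]

lemma arrives_arrival: "y \<in> sect k \<Longrightarrow> arrives k y (arrival k y)"
  unfolding arrival_def
proof (rule someI_ex)
  assume "y \<in> sect k"
  from certified_arc.arc_hits[OF certified_arc_k near_ctg this[unfolded sect_def]]
  show "\<exists>x. arrives k y x" unfolding arrives_def by metis
qed

lemma window_bounds: "7 / 10 \<le> fx (win_lo k)" "fx (win_hi k) \<le> 9995 / 10000"
  using less_6_cases[of k]
  by (elim disjE; simp add: win_lo_def win_hi_def fx_def cong: nth_index_cong)+

lemma arrival_bounds:
  assumes "y \<in> sect k"
  shows "7 / 10 < arrival k y" "arrival k y < 9995 / 10000"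
    "fx (win_lo k) \<le> arrival k y" "arrival k y \<le> fx (win_hi k)"
  using arrives_arrival[OF assms] window_bounds[of k] by (auto simp: arrives_def)

lemma pflow_travel:
  assumes "y \<in> sect k"
  shows "relax rates (ctg k) (travel k y) y = pflow (ctg k) y (arrival k y)"
  using arrival_bounds[OF assms] by (simp add: relax_pflow travel_def)

lemma data_periodic:
  "cycle (k + 6) = cycle k" "tie_state (k + 6) = tie_state k" "gap_sign (k + 6) = gap_sign k"
  "centre (k + 6) = centre k" "target (k + 6) = target k" "la (k + 6) = la k" "lb (k + 6) = lb k"
  "win_lo (k + 6) = win_lo k" "win_hi (k + 6) = win_hi k"
  by (simp_all only: cycle_def arc_data_defs mod_add_self2)

lemma derived_periodic:
  "ctg (k + 6) = ctg k" "sect (k + 6) = sect k" "region (k + 6) = region k" "metric (k + 6) = metric k"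
  "travel (k + 6) = travel k"
proof -
  have Suc6: "Suc (k + 6) = Suc k + 6" by simp
  show "ctg (k + 6) = ctg k" "sect (k + 6) = sect k" "region (k + 6) = region k" "metric (k + 6) = metric k"
    by (simp_all add: ctg_def sect_def region_def metric_def data_periodic fun_eq_iff)
  then show "travel (k + 6) = travel k"
    by (intro ext) (simp only: travel_def arrival_def arrives_def Suc6 data_periodic)
qed

lemma near_sect:
  assumes "y \<in> sect k"
  shows "near (\<chi> j. 3 / 100) (centre k) y"
proof -
  have "near (box_eps k) (centre k) y"
    using certified_arc.near_section[OF certified_arc_k near_ctg] assms by (simp add: sect_def)
  moreover have "\<forall>j. box_eps k $ j \<le> 3 / 100"
    unfolding forall_3 using less_6_cases[of k] by (elim disjE) (simp_all add: box_eps_def vector_3 cong: nth_index_cong)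
  ultimately show ?thesis unfolding near_def vec_lambda_beta using order.trans by blast
qed

subsection \<open>Transversality at the switching points\<close>

text \<open>The normal of the tie plane, signed so that it points into the region of the arc
  starting there.\<close>

definition direction :: "nat \<Rightarrow> real ^ 3" where
  "direction k = gap_sign k $ tie_state k *\<^sub>R normal (tie_state k)"

definition level :: "nat \<Rightarrow> real" where
  "level k = gap_sign k $ tie_state k * offset (tie_state k)"

lemma level_direction: "level k + direction k \<bullet> J = gap_sign k $ tie_state k * q_gap J (tie_state k)"
  by (simp add: level_def direction_def q_gap_eq algebra_simps)

text \<open>At a switching point only the gap of the tie state changes sign between the adjacent
  regions, and both adjacent fields cross in the same direction. The allowance
  \<open>6 / 100\<close> is \<open>1 / 20\<close> for the position plus \<open>1 / 100\<close> for
  the cost-to-go.\<close>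

lemma crossing_data:
  shows "\<forall>i. i \<noteq> tie_state (Suc k) \<longrightarrow> gap_sign k $ i = gap_sign (Suc k) $ i \<and>
      abs_inner (normal i) (\<chi> j. 1 / 20) < gap_sign (Suc k) $ i * q_gap (centre (Suc k)) i"
    and "gap_sign k $ tie_state (Suc k) = - gap_sign (Suc k) $ tie_state (Suc k)"
    and "\<forall>C\<in>{target k, target (Suc k)}.
      1 / 5 + abs_inner (normal (tie_state (Suc k))) (\<chi> j. rates $ j * (6 / 100)) \<le>
      gap_sign (Suc k) $ tie_state (Suc k) *
        (normal (tie_state (Suc k)) \<bullet> relax_field rates C (centre (Suc k)))"
  unfolding forall_3 using less_6_cases[of k]
  by (elim disjE; simp add: mod_Suc tie_state_def gap_sign_def centre_def target_def abs_inner_def q_gap_eq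
      normal_simps offset_simps sum_3 inner_vec_def vector_3 rates_simps relax_field_def cong: nth_index_cong)+

context
  fixes k :: nat and J :: "real ^ 3"
  assumes J: "near (\<chi> j. 1 / 20) (centre (Suc k)) J"
begin

private abbreviation "tie \<equiv> tie_state (Suc k)"
private abbreviation "s \<equiv> gap_sign (Suc k) $ tie"

lemma other_gaps:
  assumes "i \<noteq> tie"
  shows "0 < gap_sign (Suc k) $ i * q_gap J i" "0 < gap_sign k $ i * q_gap J i"
proof -
  have "\<bar>q_gap J i - q_gap (centre (Suc k)) i\<bar> \<le> abs_inner (normal i) (\<chi> j. 1 / 20)"
    using near_inner[OF J, of "normal i"] by (simp add: q_gap_eq)
  then show pos: "0 < gap_sign (Suc k) $ i * q_gap J i"
    using crossing_data(1)[rule_format, OF assms] gap_sign_cases[of "Suc k" i] by auto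
  then show "0 < gap_sign k $ i * q_gap J i"
    using crossing_data(1)[rule_format, OF assms] by simp
qed

lemma crossing_regions:
  shows "0 < s * q_gap J tie \<Longrightarrow> J \<in> region (Suc k)" "s * q_gap J tie < 0 \<Longrightarrow> J \<in> region k"
  unfolding region_def using other_gaps crossing_data(2)[of k] by force+

lemma crossing_greedy:
  assumes "\<mu> \<in> greedy J"
  shows "\<mu> = cycle k \<or> \<mu> = cycle (Suc k)"
proof -
  have other: "\<mu> $ i = cycle (Suc k) $ i \<and> \<mu> $ i = cycle k $ i" if "i \<noteq> tie" for i
    using other_gaps[OF that] gap_sign_cases[of "Suc k" i] gap_sign_cases[of k i]
      assms[unfolded greedy_iff, rule_format, of i] action_cases[of "\<mu> $ i"] by auto
  have "\<mu> $ tie = cycle (Suc k) $ tie \<or> \<mu> $ tie = cycle k $ tie"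
    using crossing_data(2)[of k] gap_sign_cases[of "Suc k" tie] gap_sign_cases[of k tie]
      action_cases[of "\<mu> $ tie"] by auto
  then show ?thesis using other by (metis vec_eq_iff)
qed

lemma crossing_speed:
  assumes "j = k \<or> j = Suc k"
  shows "1 / 5 \<le> direction (Suc k) \<bullet> relax_field rates (ctg j) J"
proof -
  have "near (\<chi> i. rates $ i * (6 / 100)) (relax_field rates (target j) (centre (Suc k))) (relax_field rates (ctg j) J)"
    unfolding near_def
  proof
    fix i
    have "\<bar>ctg j $ i - target j $ i\<bar> \<le> 1 / 100" "\<bar>J $ i - centre (Suc k) $ i\<bar> \<le> 1 / 20"
      using near_ctg[of j] J by (auto simp: near_def cost_tol_def dest!: spec[of _ i])
    then have "\<bar>(ctg j $ i - J $ i) - (target j $ i - centre (Suc k) $ i)\<bar> \<le> 6 / 100" by linarith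
    then have "rates $ i * \<bar>(ctg j $ i - J $ i) - (target j $ i - centre (Suc k) $ i)\<bar> \<le> rates $ i * (6 / 100)"
      by (intro mult_left_mono rates_bounds)
    moreover have "relax_field rates (ctg j) J $ i - relax_field rates (target j) (centre (Suc k)) $ i =
        rates $ i * ((ctg j $ i - J $ i) - (target j $ i - centre (Suc k) $ i))"
      by (simp add: relax_field_def algebra_simps)
    ultimately show "\<bar>relax_field rates (ctg j) J $ i - relax_field rates (target j) (centre (Suc k)) $ i\<bar>
        \<le> (\<chi> i. rates $ i * (6 / 100)) $ i"
      using rates_bounds[of i] by (simp add: abs_mult)
  qed
  from near_inner[OF this, of "normal tie"]
  have "\<bar>normal tie \<bullet> relax_field rates (ctg j) J - normal tie \<bullet> relax_field rates (target j) (centre (Suc k))\<bar>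
      \<le> abs_inner (normal tie) (\<chi> i. rates $ i * (6 / 100))" .
  moreover have "1 / 5 + abs_inner (normal tie) (\<chi> j. rates $ j * (6 / 100)) \<le>
      s * (normal tie \<bullet> relax_field rates (target j) (centre (Suc k)))"
    using assms by (intro crossing_data(3)[rule_format]) auto
  ultimately show ?thesis using gap_sign_cases[of "Suc k" tie] by (auto simp: direction_def)
qed

text \<open>Every greedy policy here belongs to one of the two adjacent arcs, and the half-space of
  velocities crossing at speed at least \<open>1 / 5\<close> is convex, so it contains the whole
  hull.\<close>

lemma crossing_inclusion:
  assumes "v \<in> filippov_field rates J"
  shows "1 / 5 \<le> direction (Suc k) \<bullet> v"
proof -
  let ?n = "direction (Suc k)"
  obtain w where w: "w \<in> convex hull ((\<lambda>\<mu>. cost_to_go \<mu> - J) ` greedy J)" "v = diag rates *v w"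
    using assms by (auto simp: filippov_field_def)
  have "linear (\<lambda>w. ?n \<bullet> (diag rates *v w))"
    by (intro linearI) (simp_all add: matrix_vector_right_distrib inner_add_right matrix_vector_mult_scaleR)
  then have "convex ((\<lambda>w. ?n \<bullet> (diag rates *v w)) -` {1 / 5..})"
    by (rule convex_linear_vimage) simp
  moreover have "(\<lambda>\<mu>. cost_to_go \<mu> - J) ` greedy J \<subseteq> (\<lambda>w. ?n \<bullet> (diag rates *v w)) -` {1 / 5..}"
    using crossing_greedy crossing_speed by (force simp: diag_relax_field ctg_def)
  ultimately have "convex hull ((\<lambda>\<mu>. cost_to_go \<mu> - J) ` greedy J) \<subseteq> (\<lambda>w. ?n \<bullet> (diag rates *v w)) -` {1 / 5..}"
    by (intro hull_minimal)
  then show ?thesis using w by auto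
qed

end

lemma near_switch:
  assumes "z \<in> sect k" "dist J z < 1 / 100"
  shows "near (\<chi> j. 1 / 20) (centre k) J"
  unfolding near_def
proof
  fix j
  have "\<bar>J $ j - z $ j\<bar> \<le> dist J z" using dist_vec_nth_le[of J j z] by (simp add: dist_real_def)
  moreover have "\<bar>z $ j - centre k $ j\<bar> \<le> 3 / 100" using near_sect[OF assms(1)] by (simp add: near_def)
  ultimately show "\<bar>J $ j - centre k $ j\<bar> \<le> (\<chi> j. 1 / 20) $ j"
    using assms(2) unfolding vec_lambda_beta by linarith
qed

subsection \<open>Sections, metrics and travel times\<close>

lemma metric_le:
  assumes "\<bar>la k \<bullet> v\<bar> \<le> b" "\<bar>lb k \<bullet> v\<bar> \<le> b"
  shows "metric k v \<le> b"
  using assms by (simp add: metric_def)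

lemma row_norms: "norm (la k) \<le> 3" "norm (lb k) \<le> 3"
proof -
  have "(\<Sum>i\<in>UNIV. \<bar>la k $ i\<bar>) \<le> 3 \<and> (\<Sum>i\<in>UNIV. \<bar>lb k $ i\<bar>) \<le> 3"
    unfolding sum_3 using less_6_cases[of k] by (elim disjE) (simp_all add: la_def lb_def vector_3 cong: nth_index_cong)
  then show "norm (la k) \<le> 3" "norm (lb k) \<le> 3" using norm_le_l1_cart order.trans by blast+
qed

lemma metric_le_norm: "metric k v \<le> 9 * norm v"
proof (rule metric_le)
  have "\<bar>l \<bullet> v\<bar> \<le> 9 * norm v" if "norm l \<le> 3" for l :: "real ^ 3"
    using Cauchy_Schwarz_ineq2[of l v] mult_right_mono[OF that norm_ge_zero[of v]] norm_ge_zero[of v] by linarith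
  then show "\<bar>la k \<bullet> v\<bar> \<le> 9 * norm v" "\<bar>lb k \<bullet> v\<bar> \<le> 9 * norm v" using row_norms by blast+
qed

lemma sect_diff:
  assumes "y \<in> sect k" "y' \<in> sect k"
  shows "normal (tie_state k) \<bullet> (y' - y) = 0"
  using assms by (simp add: sect_def section_box_def q_gap_diff[symmetric])

text \<open>Differences within a section have no component along the normal, so the two functionals
  determine them; the constant is three coordinates times a coordinate gain of at most 3.\<close>

lemma norm_le_metric:
  assumes "y \<in> sect k" "y' \<in> sect k"
  shows "norm (y' - y) \<le> 9 * metric k (y' - y)"
proof -
  note cert = certified_arc_k[of k]
  have "\<bar>(y' - y) $ j\<bar> \<le> 3 * metric k (y' - y)" for j
  proof -
    have "\<bar>axis j 1 \<bullet> (y' - y)\<bar> \<le> row_gain (la k) (lb k) (normal (tie_state k)) (axis j 1) * metric k (y' - y) +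
        row_defect (la k) (lb k) (normal (tie_state k)) (axis j 1) * 0"
      using sect_diff[OF assms]
      by (intro row_bound certified_arc.det[OF cert]) (auto simp: metric_def)
    moreover have "\<forall>j. coord_gain k $ j \<le> 3"
      unfolding forall_3 using less_6_cases[of k] by (elim disjE) (simp_all add: coord_gain_def vector_3 cong: nth_index_cong)
    then have "row_gain (la k) (lb k) (normal (tie_state k)) (axis j 1) \<le> 3"
      using certified_arc.coord(1)[OF cert, of j] order.trans by blast
    then have "row_gain (la k) (lb k) (normal (tie_state k)) (axis j 1) * metric k (y' - y) \<le> 3 * metric k (y' - y)"
      by (intro mult_right_mono) (simp_all add: metric_def)
    ultimately show ?thesis by (simp add: inner_axis')
  qed
  then have "(\<Sum>j\<in>UNIV. \<bar>(y' - y) $ j\<bar>) \<le> (\<Sum>j\<in>(UNIV :: 3 set). 3 * metric k (y' - y))"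
    by (intro sum_mono)
  then show ?thesis using norm_le_l1_cart[of "y' - y"] by simp
qed

lemma arrival_sect:
  assumes "y \<in> sect k"
  shows "pflow (ctg k) y (arrival k y) \<in> sect (Suc k)"
  using arrives_arrival[OF assms] by (auto simp: arrives_def sect_def section_box_def radius_def)

text \<open>\<open>contraction\<close> with slack zero, as all four points lie exactly on their tie
  planes.\<close>

lemma arrival_contract:
  assumes y: "y \<in> sect k" "y' \<in> sect k"
  shows "\<bar>arrival k y' - arrival k y\<bar> \<le> metric k (y' - y) / 10"
    and "metric (Suc k) (pflow (ctg k) y' (arrival k y') - pflow (ctg k) y (arrival k y)) \<le> 92 / 100 * metric k (y' - y)"
proof -
  note cert = certified_arc_k[of k]
  have near: "near (box_eps k) (centre k) y" "near (box_eps k) (centre k) y'"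
    using y certified_arc.near_section[OF cert near_ctg] by (auto simp: sect_def)
  have end0: "\<bar>normal (tie_state (Suc k)) \<bullet> (pflow (ctg k) y' (arrival k y') - pflow (ctg k) y (arrival k y))\<bar> \<le> 0"
    using sect_diff[OF arrival_sect[OF y(1)] arrival_sect[OF y(2)]] by simp
  have start0: "\<bar>normal (tie_state k) \<bullet> (y' - y)\<bar> \<le> 0" using sect_diff[OF y] by simp
  have m: "\<bar>la k \<bullet> (y' - y)\<bar> \<le> metric k (y' - y)" "\<bar>lb k \<bullet> (y' - y)\<bar> \<le> metric k (y' - y)"
    by (auto simp: metric_def)
  note b = arrival_bounds(3,4)[OF y(1)] arrival_bounds(3,4)[OF y(2)]
  note contraction = certified_arc.contraction[OF cert near_ctg near b m start0 end0]
  show "\<bar>arrival k y' - arrival k y\<bar> \<le> metric k (y' - y) / 10" using contraction(1) by simp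
  show "metric (Suc k) (pflow (ctg k) y' (arrival k y') - pflow (ctg k) y (arrival k y)) \<le> 92 / 100 * metric k (y' - y)"
    using contraction(2) by (intro metric_le) simp_all
qed

lemma ln_diff_le_scaled:
  fixes a b :: real
  assumes "7 / 10 < a" "7 / 10 < b"
  shows "\<bar>ln a - ln b\<bar> \<le> 2 * \<bar>a - b\<bar>"
proof -
  have "ln a - ln b \<le> 2 * \<bar>a - b\<bar>" if "7 / 10 < a" "7 / 10 < b" for a b :: real
  proof -
    have "ln a - ln b \<le> (a - b) / b" using that by (intro ln_diff_le) auto
    also have "\<dots> \<le> \<bar>a - b\<bar> / (1 / 2)" using that by (intro frac_le) auto
    finally show ?thesis by simp
  qed
  from this[of a b] this[of b a] show ?thesis using assms by (simp add: abs_minus_commute abs_le_iff)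
qed

lemma travel_Lipschitz:
  assumes "y \<in> sect k" "y' \<in> sect k"
  shows "\<bar>travel k y' - travel k y\<bar> \<le> 10 * metric k (y' - y)"
proof -
  have "travel k y' - travel k y = - 50 * (ln (arrival k y') - ln (arrival k y))"
    by (simp add: travel_def algebra_simps)
  then have "\<bar>travel k y' - travel k y\<bar> = 50 * \<bar>ln (arrival k y') - ln (arrival k y)\<bar>"
    by (simp only: abs_mult)
  also have "\<dots> \<le> 50 * (2 * \<bar>arrival k y' - arrival k y\<bar>)"
    using arrival_bounds(1)[OF assms(1)] arrival_bounds(1)[OF assms(2)] by (intro mult_left_mono ln_diff_le_scaled) auto
  also have "\<dots> \<le> 50 * (2 * (metric k (y' - y) / 10))"
    using arrival_contract(1)[OF assms] by (intro mult_left_mono) auto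
  finally show ?thesis by simp
qed

lemma travel_bounds:
  assumes "y \<in> sect k"
  shows "- 50 * ln (9995 / 10000) \<le> travel k y" "travel k y \<le> - 50 * ln (7 / 10)"
  using arrival_bounds(1,2)[OF assms] by (auto simp: travel_def)

lemma during_travel:
  assumes y: "y \<in> sect k" and t: "0 < t" "t < travel k y"
  shows "relax rates (ctg k) t y \<in> region k"
proof -
  have pos: "0 < arrival k y" using arrival_bounds(1)[OF y] by simp
  have "ln (arrival k y) < - (0.02 * t)" using t by (simp add: travel_def)
  then have "arrival k y < exp (- (0.02 * t))" using pos by (metis exp_less_cancel_iff exp_ln)
  moreover have "exp (- (0.02 * t)) < 1" using t by simp
  ultimately show ?thesis
    using arrives_arrival[OF y] by (auto simp: region_def arrives_def relax_pflow)
qed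

text \<open>The orthogonal projection of the rounded centre onto its tie plane is a point of the
  section.\<close>

lemma sect_nonempty: "sect 0 \<noteq> {}"
proof -
  define n where "n = normal 1"
  define y where "y = centre 0 - (q_gap (centre 0) 1 / (n \<bullet> n)) *\<^sub>R n"
  have nn: "n \<bullet> n \<noteq> 0" by (simp add: n_def normal_simps inner_vector)
  have "q_gap y 1 = q_gap (centre 0) 1 + n \<bullet> (y - centre 0)"
    using q_gap_diff[of y 1 "centre 0"] by (simp add: n_def)
  also have "n \<bullet> (y - centre 0) = - q_gap (centre 0) 1" using nn by (simp add: y_def)
  finally have "q_gap y 1 = 0" by simp
  moreover have "\<bar>l \<bullet> (y - centre 0)\<bar> \<le> radius" if "l = la 0 \<or> l = lb 0" for l
    using that
    by (auto simp: y_def n_def radius_def la_def lb_def centre_def q_gap_eq normal_simps offset_simps inner_vector)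
  ultimately have "y \<in> sect 0" by (simp add: sect_def section_box_def tie_state_def)
  then show ?thesis by blast
qed

lemma closed_sect: "closed (sect k)"
  unfolding sect_def section_box_def
  by (intro closed_Collect_conj closed_Collect_eq closed_Collect_le continuous_intros continuous_q_gap)

text \<open>The spare 5 percent of the radius is \<open>0.0005\<close>, and a functional of norm at
  most 3 changes by at most \<open>0.0003\<close>.\<close>

lemma sect_interior:
  assumes y: "y \<in> sect k" and z: "q_gap z (tie_state (Suc k)) = 0"
    "dist z (pflow (ctg k) y (arrival k y)) < 1 / 10000"
  shows "z \<in> sect (Suc k)"
proof -
  let ?p = "pflow (ctg k) y (arrival k y)" and ?Y = "centre (Suc k)"
  have "\<bar>l \<bullet> (z - ?Y)\<bar> \<le> radius" if l: "\<bar>l \<bullet> (?p - ?Y)\<bar> \<le> 95 / 100 * radius" "norm l \<le> 3" for l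
  proof -
    have "l \<bullet> (z - ?Y) = l \<bullet> (z - ?p) + l \<bullet> (?p - ?Y)" by (simp add: inner_diff_right)
    moreover have "\<bar>l \<bullet> (z - ?p)\<bar> \<le> norm l * norm (z - ?p)" by (rule Cauchy_Schwarz_ineq2)
    moreover have "norm l * norm (z - ?p) \<le> 3 * (1 / 10000)"
      using l(2) z(2) by (intro mult_mono) (auto simp: dist_norm)
    ultimately show ?thesis using l(1) unfolding radius_def by linarith
  qed
  then show ?thesis
    using arrives_arrival[OF y] z(1) row_norms[of "Suc k"] by (auto simp: sect_def section_box_def arrives_def)
qed

lemma sect_speed:
  assumes "y \<in> sect k"
  shows "rates $ i * \<bar>y $ i - ctg k $ i\<bar> \<le> 402"
proof -
  have "\<forall>i. \<bar>centre k $ i\<bar> \<le> 200 \<and> \<bar>target k $ i\<bar> \<le> 200"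
    unfolding forall_3 using less_6_cases[of k] by (elim disjE) (simp_all add: centre_def target_def vector_3 cong: nth_index_cong)
  moreover have "\<bar>y $ i - centre k $ i\<bar> \<le> 1" "\<bar>ctg k $ i - target k $ i\<bar> \<le> 1"
    using near_sect[OF assms] near_ctg[of k] by (auto simp: near_def cost_tol_def dest!: spec[of _ i])
  moreover from calculation(1) have "\<bar>centre k $ i\<bar> \<le> 200" "\<bar>target k $ i\<bar> \<le> 200" by blast+
  ultimately have "\<bar>y $ i - ctg k $ i\<bar> \<le> 402" by linarith
  then have "rates $ i * \<bar>y $ i - ctg k $ i\<bar> \<le> 1 * 402"
    by (intro mult_mono rates_bounds) auto
  then show ?thesis by simp
qed

interpretation cyc: relay_cycle rates ctg "filippov_field rates" region tie_set sect direction level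
  metric travel 6 "92 / 100" 9 10 "- 50 * ln (9995 / 10000)" "- 50 * ln (7 / 10)" 402 "1 / 5" "1 / 100" "1 / 10000"
proof
  fix k y y' z v J t i
  \<comment> \<open>The crossing lemmas speak of section \<open>Suc j\<close>; periodicity writes
    every section this way, with \<open>j = k + 5\<close>.\<close>
  have pred: "\<exists>j. sect k = sect (Suc j) \<and> direction k = direction (Suc j) \<and> level k = level (Suc j) \<and>
      region k = region (Suc j) \<and> centre k = centre (Suc j)" for k
  proof -
    have Suc5: "Suc (k + 5) = k + 6" by simp
    show ?thesis
      by (rule exI[of _ "k + 5"]) (simp only: Suc5 data_periodic derived_periodic direction_def level_def simp_thms)
  qed
  show "z \<in> sect k \<Longrightarrow> dist J z < 1 / 100 \<Longrightarrow> 0 < level k + direction k \<bullet> J \<Longrightarrow> J \<in> region k"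
    using pred[of k] near_switch[of z k J] crossing_regions(1) level_direction by metis
  show "z \<in> sect k \<Longrightarrow> dist J z < 1 / 100 \<Longrightarrow> v \<in> filippov_field rates J \<Longrightarrow> 1 / 5 \<le> direction k \<bullet> v"
    using pred[of k] near_switch[of z k J] crossing_inclusion by metis
  show "z \<in> sect (Suc k) \<Longrightarrow> dist J z < 1 / 100 \<Longrightarrow>
      1 / 5 \<le> direction (Suc k) \<bullet> relax_field rates (ctg k) J \<and>
      1 / 5 \<le> direction (Suc k) \<bullet> relax_field rates (ctg (Suc k)) J"
    using near_switch[of z "Suc k" J] crossing_speed by blast
  show "J \<in> region k \<Longrightarrow> filippov_field rates J = {relax_field rates (ctg k) J}"
    by (simp add: filippov_singleton greedy_region ctg_def)
  show "sect k \<subseteq> tie_set" by (auto simp: sect_def section_box_def tie_set_def)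
  show "y \<in> sect k \<Longrightarrow> level k + direction k \<bullet> y = 0"
    unfolding level_direction by (simp add: sect_def section_box_def)
  show "y \<in> sect k \<Longrightarrow> level (Suc k) + direction (Suc k) \<bullet> z = 0 \<Longrightarrow>
      dist z (relax rates (ctg k) (travel k y) y) < 1 / 10000 \<Longrightarrow> z \<in> sect (Suc k)"
    unfolding level_direction using sect_interior[of y k z] gap_sign_cases[of "Suc k" "tie_state (Suc k)"]
    by (auto simp: pflow_travel)
  show "y \<in> sect k \<Longrightarrow> y' \<in> sect k \<Longrightarrow>
      metric (Suc k) (relax rates (ctg k) (travel k y') y' - relax rates (ctg k) (travel k y) y) \<le> 92 / 100 * metric k (y' - y)"
    by (simp only: pflow_travel arrival_contract)
  show "y \<in> sect k \<Longrightarrow> relax rates (ctg k) (travel k y) y \<in> sect (Suc k)"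
    by (simp only: pflow_travel arrival_sect)
  show "direction (k + 6) = direction k" "level (k + 6) = level k"
    by (simp_all only: direction_def level_def data_periodic)
  show "0 \<le> metric k v'" for v' by (simp add: metric_def)
qed (use sect_nonempty closed_sect open_region region_tie_set derived_periodic rates_bounds
  metric_le_norm norm_le_metric travel_Lipschitz travel_bounds during_travel sect_speed in auto)

theorem proposition1:
  fixes q :: "real ^ 3"
  assumes "q = vector [0.02, 0.18, 0.80]"
  shows "\<exists>(J :: real \<Rightarrow> real ^ 3) p C.
    p > 0 \<and> hybrid_solution q UNIV J \<and> (\<forall>t. J (t + p) = J t) \<and> C = range J \<and>
    \<not> J constant_on UNIV \<and>
    follows_policies J p
      [vector [0, 1, 1], vector [0, 0, 1], vector [1, 0, 1],
       vector [1, 0, 0], vector [1, 1, 0], vector [1, 1, 1]] \<and>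
    hybrid_locally_attracting q C \<and>
    strict_local_attractor (filippov_field q) C"
proof -
  have q: "q = rates" by (simp add: assms rates_def)
  obtain J p \<tau> where p: "0 < p" "\<forall>t. J (t + p) = J t" "\<not> J constant_on UNIV"
    and \<tau>: "\<tau> 6 = \<tau> 0 + p" "\<forall>k\<le>6. J (\<tau> k) \<in> tie_set"
      "\<forall>k<6. \<tau> k < \<tau> (Suc k) \<and> (\<forall>t\<in>{\<tau> k<..<\<tau> (Suc k)}. J t \<in> region k)"
    and J: "\<forall>a b. J piecewise_C1_differentiable_on {a..b}"
      "\<forall>t. J t \<notin> tie_set \<longrightarrow> (\<exists>n. J t \<in> region n \<and> (J has_vector_derivative relax_field rates (ctg n) (J t)) (at t))"
      "discrete {t. J t \<in> tie_set}"
    and attr: "strict_local_attractor (filippov_field rates) (range J)"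
    using cyc.attracting_cycle by blast
  let ?\<nu>s = "[vector [0, 1, 1], vector [0, 0, 1], vector [1, 0, 1],
       vector [1, 0, 0], vector [1, 1, 0], vector [1, 1, 1]] :: (2 ^ 3) list"
  \<comment> \<open>The region index is unspecified, but the only greedy policy in that region is
    \<open>cycle n\<close>, whose cost-to-go is \<open>ctg n\<close>.\<close>
  have "(J has_vector_derivative hybrid_field rates (J t)) (at t)" if "J t \<notin> tie_set" for t
    using J(2) that by (force simp: hybrid_field_def greedy_region diag_relax_field ctg_def)
  then have hybrid: "hybrid_solution rates UNIV J"
    using J by (simp add: hybrid_solution_def)
  have "?\<nu>s ! k = cycle k" if "k < 6" for k using that by (simp add: cycle_def)
  moreover have "length ?\<nu>s = 6" by simp
  ultimately have "follows_policies J p ?\<nu>s"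
    unfolding follows_policies_def using \<tau> greedy_region by (intro exI[of _ \<tau>]) (simp only:, auto)
  moreover have "hybrid_locally_attracting rates (range J)"
    using attr by (intro uniformly_attracting_imp_hybrid rates_bounds) (simp add: strict_local_attractor_def)
  ultimately show ?thesis unfolding q using p hybrid attr by blast
qed

end
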